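(* Let $n=1$ and $c\in(1/2,1)$. There are nonzero smooth nonradial functions $f,g\in\mathcal D_c$ on $\mathbb C$ whose extended Toeplitz operators $\widetilde T_f$, $\widetilde T_g$ in $F^2(\mathbb C)$ are nonzero. Their domains $\mathcal D(\widetilde T_f)$ and $\mathcal D(\widetilde T_g)$ contain the space $\mathcal P=\mathbb C[z]$ of all holomorphic polynomials on $\mathbb C$. Moreover, $$\mathcal P\subset\mathcal D(\widetilde T_f\widetilde T_g),\qquad \widetilde T_f\widetilde T_g\,p=0\ \text{ in } F^2(\mathbb C)\quad\text{for every } p\in\mathcal P.$$ When $c\ge 3/4$, the symbol $g$ can be chosen bounded (that is, such a pair $f,g$ exists with $g$ in addition bounded).
   Context: Let $dA$ be area measure on $\mathbb C$ and $d\mu(z)=\pi^{-1}e^{-|z|^2}\,dA(z)$. The Fock space $F^2(\mathbb C)$ is the Hilbert space of entire functions in $L^2(\mathbb C,d\mu)$, with the $L^2(d\mu)$ inner product. The functions $e_j(z)=z^j/\sqrt{j!}$, $j\ge 0$, form its standard orthonormal basis. For $c>0$, $\mathcal D_c$ is the set of measurable $u:\mathbb C\to\mathbb C$ such that $e^{-c|\cdot|^2}u\in L^\infty(\mathbb C)$. A measurable function on $\mathbb C$ is radial if, up to equality almost everywhere, it depends only on $|z|$; nonradial means not radial. Smooth means $C^\infty$ in the real sense. Extended Toeplitz operator: for measurable $u:\mathbb C\to\mathbb C$, the domain $\mathcal D(\widetilde T_u)$ consists of all $h\in F^2(\mathbb C)$ such that $uh\overline{e_j}\in L^1(d\mu)$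 for every $j\ge 0$ and $\sum_{j\ge0}\left|\int_{\mathbb C}uh\overline{e_j}\,d\mu\right|^2<\infty$; and $\widetilde T_u:\mathcal D(\widetilde T_u)\to F^2(\mathbb C)$ is $$\widetilde T_uh=\sum_{j=0}^\infty\left(\int_{\mathbb C}uh\overline{e_j}\,d\mu\right)e_j .$$ The operator $\widetilde T_u$ is nonzero if $\widetilde T_uh\neq0$ for some $h\in\mathcal D(\widetilde T_u)$. The product $\widetilde T_f\widetilde T_g$ has domain $\mathcal D(\widetilde T_f\widetilde T_g)=\{h\in\mathcal D(\widetilde T_g):\widetilde T_gh\in\mathcal D(\widetilde T_f)\}$. *)

theory Defs
  imports "HOL-Analysis.Analysis" "HOL-Computational_Algebra.Polynomial"
begin

definition gauss_measure :: "complex measure" where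
  "gauss_measure = density lebesgue (\<lambda>z. ennreal (exp (- (cmod z)\<^sup>2) / pi))"

text \<open>Entire functions are determined by their values, so elements of the Fock space are
  honest functions and equality in the space is equality of functions.\<close>

definition fock_space :: "(complex \<Rightarrow> complex) set" where
  "fock_space = {h. h holomorphic_on UNIV \<and> integrable gauss_measure (\<lambda>z. (cmod (h z))\<^sup>2)}"

definition fock_norm :: "(complex \<Rightarrow> complex) \<Rightarrow> real" where
  "fock_norm h = sqrt (LINT z|gauss_measure. (cmod (h z))\<^sup>2)"

definition fock_basis :: "nat \<Rightarrow> complex \<Rightarrow> complex" where
  "fock_basis j z = z ^ j / complex_of_real (sqrt (fact j))"

definition fock_sums :: "(nat \<Rightarrow> complex) \<Rightarrow> (complex \<Rightarrow> complex) \<Rightarrow> bool" where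
  "fock_sums a k \<longleftrightarrow> k \<in> fock_space \<and>
     (\<lambda>N. fock_norm (\<lambda>z. k z - (\<Sum>j<N. a j * fock_basis j z))) \<longlonglongrightarrow> 0"

definition growth_class :: "real \<Rightarrow> (complex \<Rightarrow> complex) set" where
  "growth_class c = {u. u \<in> borel_measurable lebesgue \<and>
     (\<exists>M. AE z in lebesgue. cmod (complex_of_real (exp (- c * (cmod z)\<^sup>2)) * u z) \<le> M)}"

definition radial :: "(complex \<Rightarrow> complex) \<Rightarrow> bool" where
  "radial u \<longleftrightarrow> (\<exists>\<phi> :: real \<Rightarrow> complex. AE z in lebesgue. u z = \<phi> (cmod z))"

text \<open>Differentiability here is over the reals: \<open>f differentiable (at z)\<close> asks for an
  \<open>\<real>\<close>-linear Frechet derivative, so these are not holomorphy conditions.\<close>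

primrec k_smooth :: "nat \<Rightarrow> (complex \<Rightarrow> complex) \<Rightarrow> bool" where
  "k_smooth 0 f \<longleftrightarrow> continuous_on UNIV f"
| "k_smooth (Suc k) f \<longleftrightarrow> (\<forall>z. f differentiable (at z)) \<and>
     (\<forall>v. k_smooth k (\<lambda>z. frechet_derivative f (at z) v))"

definition smooth :: "(complex \<Rightarrow> complex) \<Rightarrow> bool" where
  "smooth f \<longleftrightarrow> (\<forall>k. k_smooth k f)"

definition toeplitz_coeff :: "(complex \<Rightarrow> complex) \<Rightarrow> (complex \<Rightarrow> complex) \<Rightarrow> nat \<Rightarrow> complex" where
  "toeplitz_coeff u h j = (LINT z|gauss_measure. u z * h z * cnj (fock_basis j z))"

definition toeplitz_dom :: "(complex \<Rightarrow> complex) \<Rightarrow> (complex \<Rightarrow> complex) set" where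
  "toeplitz_dom u = {h \<in> fock_space.
     (\<forall>j. integrable gauss_measure (\<lambda>z. u z * h z * cnj (fock_basis j z))) \<and>
     summable (\<lambda>j. (cmod (toeplitz_coeff u h j))\<^sup>2)}"

text \<open>The value is the sum of the orthonormal expansion in the norm of the Fock space; it is
  only meaningful for \<open>h \<in> toeplitz_dom u\<close>.\<close>

definition toeplitz :: "(complex \<Rightarrow> complex) \<Rightarrow> (complex \<Rightarrow> complex) \<Rightarrow> complex \<Rightarrow> complex" where
  "toeplitz u h = (THE k. fock_sums (toeplitz_coeff u h) k)"

definition toeplitz_nonzero :: "(complex \<Rightarrow> complex) \<Rightarrow> bool" where
  "toeplitz_nonzero u \<longleftrightarrow> (\<exists>h \<in> toeplitz_dom u. toeplitz u h \<noteq> (\<lambda>z. 0))"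

definition toeplitz_prod_dom ::
  "(complex \<Rightarrow> complex) \<Rightarrow> (complex \<Rightarrow> complex) \<Rightarrow> (complex \<Rightarrow> complex) set" where
  "toeplitz_prod_dom f g = {h \<in> toeplitz_dom g. toeplitz g h \<in> toeplitz_dom f}"

definition toeplitz_prod ::
  "(complex \<Rightarrow> complex) \<Rightarrow> (complex \<Rightarrow> complex) \<Rightarrow> (complex \<Rightarrow> complex) \<Rightarrow> complex \<Rightarrow> complex" where
  "toeplitz_prod f g h = toeplitz f (toeplitz g h)"

definition polynomial_functions :: "(complex \<Rightarrow> complex) set" where
  "polynomial_functions = range poly"

definition zero_product_pair ::
  "real \<Rightarrow> (complex \<Rightarrow> complex) \<Rightarrow> (complex \<Rightarrow> complex) \<Rightarrow> bool" where
  "zero_product_pair c f g \<longleftrightarrow>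
     f \<in> growth_class c \<and> g \<in> growth_class c \<and>
     f \<noteq> (\<lambda>z. 0) \<and> g \<noteq> (\<lambda>z. 0) \<and>
     smooth f \<and> smooth g \<and>
     \<not> radial f \<and> \<not> radial g \<and>
     toeplitz_nonzero f \<and> toeplitz_nonzero g \<and>
     polynomial_functions \<subseteq> toeplitz_dom f \<and>
     polynomial_functions \<subseteq> toeplitz_dom g \<and>
     polynomial_functions \<subseteq> toeplitz_prod_dom f g \<and>
     (\<forall>p \<in> polynomial_functions. toeplitz_prod f g p = (\<lambda>z. 0))"

end

theory Submission
  imports Defs "HOL-Probability.Sinc_Integral" "HOL-Complex_Analysis.Complex_Analysis"
begin

text \<open>
  Fix \<open>a\<close> with \<open>1 / 4 \<le> a < 1 / 2\<close>.  The symbol \<open>g\<close> is a Gaussian whose Toeplitz operator maps each polynomial \<open>p\<close> to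
  \<open>exp (a z\<^sup>2)\<close> times a polynomial; these functions lie in the Fock space because \<open>a < 1 / 2\<close>.  The symbol \<open>f\<close> is built
  to annihilate all of them.  For every polynomial \<open>q\<close> the coefficients of \<open>T\<^sub>f (exp (a z\<^sup>2) q)\<close> are moments of
  \<open>f z exp (a z\<^sup>2) exp (- |z|\<^sup>2)\<close>, so it suffices that all moments of this function vanish.  A function with
  Gaussian decay and vanishing moments is zero, but here only absolute convergence of the moments is required.  The choice
  \<open>f z exp (a z\<^sup>2) exp (- |z|\<^sup>2) = \<psi> (Re z) exp (- (Im z)\<^sup>2)\<close> works when \<open>\<psi>\<close> decays faster than every power and
  has vanishing moments on the line.  Solving for \<open>f\<close> gives \<open>f z = \<psi> x exp (x\<^sup>2 - a z\<^sup>2)\<close> with \<open>x = Re z\<close>, of growth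
  \<open>exp ((1 - a) |z|\<^sup>2)\<close>.  The condition \<open>a < 1 / 2\<close> is thus the reason for \<open>c > 1 / 2\<close>.

  For \<open>\<psi>\<close> one may take \<open>\<psi> x = exp (- sqrt (1 - \<i> t x))\<close> with \<open>t > 0\<close>: it extends holomorphically to the upper
  half-plane and decays there, so its moments vanish by pushing the line of integration to infinity
  (\<open>moment_free_moments\<close>).  As \<open>t \<rightarrow> 0\<close> the function tends to a nonzero constant, which shows that \<open>T\<^sub>f 1 \<noteq> 0\<close> for
  some \<open>t\<close>.

  Two computations remain.  That \<open>T\<^sub>f p\<close> is in the Fock space for a polynomial \<open>p\<close> is not visible from the size of
  \<open>f\<close>; the oscillation of \<open>exp (- a z\<^sup>2)\<close> in the direction of the imaginary axis has to be exploited, by shifting each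
  vertical line to the saddle point of the Gaussian (\<open>vertical_line_shift\<close>), after which the coefficients decay
  geometrically (\<open>annihilator_coeff_bound\<close>).  This is where \<open>a \<ge> 1 / 4\<close> enters.  Since the growth classes increase
  with \<open>c\<close>, the value \<open>a = 1 / 4\<close> serves all \<open>c \<ge> 3 / 4\<close>.  The operator of \<open>g\<close> is computed from the fact that Gaussian moments of an entire
  function are multiples of its Taylor coefficients (\<open>gauss_moment_eq_taylor_coeff\<close>).  The symbol
  \<open>exp (\<sigma> z\<^sup>2 - l |z|\<^sup>2)\<close> yields \<open>a = \<sigma> / (1 + l)\<^sup>2\<close>; it is bounded for \<open>l = \<sigma>\<close>, and then \<open>a\<close> can be
  as large as \<open>1 / 4\<close>, which corresponds to \<open>c \<ge> 3 / 4\<close>.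
\<close>

section \<open>Integration over the plane\<close>

lemma integrable_inverse_one_plus_square:
  "integrable lborel (\<lambda>x::real. inverse (1 + x\<^sup>2))"
proof -
  have "einterval (-\<infinity>) \<infinity> = UNIV"
    by (auto simp: einterval_def)
  then show ?thesis
    using integrable_inverse_1_plus_square by (simp add: set_integrable_def)
qed

lemma borel_measurable_Complex [measurable]:
  "(\<lambda>(x, y). Complex x y) \<in> borel_measurable (lborel \<Otimes>\<^sub>M lborel)"
proof -
  have "(\<lambda>p. of_real (fst p) + \<i> * of_real (snd p)) \<in> borel_measurable (lborel \<Otimes>\<^sub>M lborel)"
    by measurable
  then show ?thesis
    by (simp add: case_prod_beta' Complex_eq)
qed

lemma lborel_complex_eq_distr:
  "(lborel :: complex measure) = distr (lborel \<Otimes>\<^sub>M lborel) borel (\<lambda>(x, y). Complex x y)"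
proof (rule lborel_eqI)
  fix l u :: complex
  assume lu: "\<And>b. b \<in> Basis \<Longrightarrow> l \<bullet> b \<le> u \<bullet> b"
  have le: "Re l \<le> Re u" "Im l \<le> Im u"
    using lu[of 1] lu[of \<i>] by (auto simp: Basis_complex_def)
  have vimage: "(\<lambda>(x, y). Complex x y) -` box l u \<inter> space (lborel \<Otimes>\<^sub>M lborel)
      = {Re l<..<Re u} \<times> {Im l<..<Im u}"
    by (auto simp: box_def Basis_complex_def space_pair_measure)
  have "emeasure (distr (lborel \<Otimes>\<^sub>M lborel) borel (\<lambda>(x, y). Complex x y)) (box l u)
      = emeasure (lborel \<Otimes>\<^sub>M lborel) ({Re l<..<Re u} \<times> {Im l<..<Im u})"
    by (subst emeasure_distr) (simp_all add: vimage)
  also have "\<dots> = ennreal ((Re u - Re l) * (Im u - Im l))"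
    using le by (simp add: lborel.emeasure_pair_measure_Times ennreal_mult)
  also have "(Re u - Re l) * (Im u - Im l) = (\<Prod>b\<in>Basis. (u - l) \<bullet> b)"
    by (simp add: Basis_complex_def)
  finally show "emeasure (distr (lborel \<Otimes>\<^sub>M lborel) borel (\<lambda>(x, y). Complex x y)) (box l u)
      = ennreal (\<Prod>b\<in>Basis. (u - l) \<bullet> b)" .
qed simp

lemma
  fixes h :: "complex \<Rightarrow> complex"
  assumes h: "integrable lborel h"
  shows integral_plane_xy: "integral\<^sup>L lborel h = (\<integral>x. (\<integral>y. h (Complex x y) \<partial>lborel) \<partial>lborel)"
    and integral_plane_yx: "integral\<^sup>L lborel h = (\<integral>y. (\<integral>x. h (Complex x y) \<partial>lborel) \<partial>lborel)"
proof -
  have hb: "h \<in> borel_measurable borel"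
    using borel_measurable_integrable[OF h] by simp
  have int: "integrable (lborel \<Otimes>\<^sub>M lborel) (\<lambda>(x, y). h (Complex x y))"
    using h hb unfolding lborel_complex_eq_distr
    by (subst (asm) integrable_distr_eq) (auto simp: case_prod_beta')
  have eq: "integral\<^sup>L lborel h = integral\<^sup>L (lborel \<Otimes>\<^sub>M lborel) (\<lambda>(x, y). h (Complex x y))"
    using hb unfolding lborel_complex_eq_distr
    by (subst integral_distr) (auto simp: case_prod_beta')
  show "integral\<^sup>L lborel h = (\<integral>x. (\<integral>y. h (Complex x y) \<partial>lborel) \<partial>lborel)"
    using lborel_pair.integral_fst[OF int] eq by simp
  show "integral\<^sup>L lborel h = (\<integral>y. (\<integral>x. h (Complex x y) \<partial>lborel) \<partial>lborel)"
    using lborel_pair.integral_snd[OF int] eq by simp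
qed

text \<open>The majorant used for every integral over the plane.  Being a product of one-dimensional majorants it also
  bounds the restriction to each horizontal and vertical line.\<close>

definition plane_weight :: "complex \<Rightarrow> real" where
  "plane_weight z = inverse (1 + (Re z)\<^sup>2) * inverse (1 + (Im z)\<^sup>2)"

lemma integrable_plane_weight: "integrable lborel plane_weight"
proof (rule integrableI_nonneg)
  have "(\<integral>\<^sup>+z. ennreal (plane_weight z) \<partial>lborel)
      = (\<integral>\<^sup>+z. (\<Prod>b\<in>Basis. ennreal (inverse (1 + (z \<bullet> b)\<^sup>2))) \<partial>(lborel :: complex measure))"
    by (simp add: plane_weight_def Basis_complex_def ennreal_mult)
  also have "\<dots> = (\<Prod>b\<in>(Basis :: complex set). (\<integral>\<^sup>+x. ennreal (inverse (1 + x\<^sup>2)) \<partial>lborel))"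
    by (rule nn_integral_lborel_prod) auto
  also have "\<dots> < \<infinity>"
    using integrable_inverse_one_plus_square
    by (auto simp: integrable_iff_bounded Basis_complex_def ennreal_mult_less_top)
  finally show "(\<integral>\<^sup>+z. ennreal (plane_weight z) \<partial>lborel) < \<infinity>" .
  have "continuous_on UNIV plane_weight"
    unfolding plane_weight_def by (intro continuous_intros) (auto simp: add_nonneg_eq_0_iff)
  then show "plane_weight \<in> borel_measurable lborel"
    by (simp add: borel_measurable_continuous_onI)
qed (auto simp: plane_weight_def)

lemma plane_weight_pos: "0 < plane_weight z"
  by (auto simp: plane_weight_def add_pos_nonneg)

lemma integrable_plane_bound:
  fixes h :: "complex \<Rightarrow> 'b::{banach, second_countable_topology}"
  assumes "continuous_on UNIV h" and "\<And>z. norm (h z) \<le> C * plane_weight z"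
  shows "integrable lborel h"
proof (rule Bochner_Integration.integrable_bound)
  show "integrable lborel (\<lambda>z. C * plane_weight z)"
    using integrable_plane_weight by simp
  show "h \<in> borel_measurable lborel"
    using assms(1) by (simp add: borel_measurable_continuous_onI)
  show "AE z in lborel. norm (h z) \<le> norm (C * plane_weight z)"
    using assms(2) by (intro always_eventually) (auto intro: order_trans[OF _ abs_ge_self])
qed

lemma integrable_line_bound:
  fixes h :: "real \<Rightarrow> 'b::{banach, second_countable_topology}"
  assumes "continuous_on UNIV h" and "\<And>x. norm (h x) \<le> C * inverse (1 + x\<^sup>2)"
  shows "integrable lborel h"
proof (rule Bochner_Integration.integrable_bound)
  show "integrable lborel (\<lambda>x::real. C * inverse (1 + x\<^sup>2))"
    using integrable_inverse_one_plus_square by simp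
  show "h \<in> borel_measurable lborel"
    using assms(1) by (simp add: borel_measurable_continuous_onI)
  show "AE x in lborel. norm (h x) \<le> norm (C * inverse (1 + x\<^sup>2))"
    using assms(2) by (intro always_eventually) (auto intro: order_trans[OF _ abs_ge_self])
qed

lemma exp_neg_square_le:
  fixes x e :: real
  assumes "0 < e"
  shows "exp (- e * x\<^sup>2) \<le> (1 + 1 / e) * inverse (1 + x\<^sup>2)"
proof -
  have "1 + x\<^sup>2 \<le> (1 + 1 / e) * (1 + e * x\<^sup>2)"
    using assms by (simp add: field_simps)
  also have "\<dots> \<le> (1 + 1 / e) * exp (e * x\<^sup>2)"
    using assms exp_ge_add_one_self[of "e * x\<^sup>2"] by (intro mult_left_mono) auto
  finally show ?thesis
    by (simp add: exp_minus field_simps add_pos_nonneg)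
qed

lemma gaussian_le_plane_weight:
  assumes "0 < e"
  shows "exp (- e * (cmod z)\<^sup>2) \<le> (1 + 1 / e)\<^sup>2 * plane_weight z"
proof -
  have "exp (- e * (cmod z)\<^sup>2) = exp (- e * (Re z)\<^sup>2) * exp (- e * (Im z)\<^sup>2)"
    by (simp add: cmod_power2 exp_add[symmetric] algebra_simps)
  also have "\<dots> \<le> ((1 + 1 / e) * inverse (1 + (Re z)\<^sup>2)) * ((1 + 1 / e) * inverse (1 + (Im z)\<^sup>2))"
    using assms by (intro mult_mono exp_neg_square_le) auto
  finally show ?thesis
    by (simp add: plane_weight_def power2_eq_square mult_ac)
qed

lemma integrable_gaussian_bound:
  fixes h :: "complex \<Rightarrow> 'b::{banach, second_countable_topology}"
  assumes "continuous_on UNIV h" and e: "0 < e"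
    and C: "\<And>z. norm (h z) \<le> C * exp (- e * (cmod z)\<^sup>2)"
  shows "integrable lborel h"
proof -
  have "0 \<le> C"
    using order_trans[OF norm_ge_zero C[of 0]] by simp
  then have "norm (h z) \<le> C * (1 + 1 / e)\<^sup>2 * plane_weight z" for z
    using C[of z] mult_left_mono[OF gaussian_le_plane_weight[OF e, of z], of C]
    by (simp add: mult.assoc)
  with assms(1) show ?thesis
    by (rule integrable_plane_bound)
qed

lemma power_le_gaussian:
  fixes e :: real
  assumes "0 < e"
  shows "\<exists>C>0. \<forall>r\<ge>0. (1 + r) ^ n \<le> C * exp (e * r\<^sup>2)"
proof -
  define d where "d = e / (real n + 1)"
  have d: "0 < d"
    using assms by (simp add: d_def)
  have nd: "real n * d \<le> e"
    using assms by (simp add: d_def field_simps)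
  have base: "1 + r \<le> (2 + 1 / d) * exp (d * r\<^sup>2)" for r :: real
  proof -
    have "0 \<le> (2 * r - 1)\<^sup>2" by simp
    then have "1 + r \<le> 2 + r\<^sup>2" by (simp add: power2_eq_square algebra_simps)
    also have "\<dots> \<le> (2 + 1 / d) * (1 + d * r\<^sup>2)"
      using d by (simp add: field_simps)
    also have "\<dots> \<le> (2 + 1 / d) * exp (d * r\<^sup>2)"
      using d exp_ge_add_one_self[of "d * r\<^sup>2"] by (intro mult_left_mono) auto
    finally show ?thesis .
  qed
  show ?thesis
  proof (intro exI conjI allI impI)
    show "0 < (2 + 1 / d) ^ n"
      using d by (intro zero_less_power add_pos_pos) auto
    fix r :: real
    assume r: "0 \<le> r"
    have "(1 + r) ^ n \<le> ((2 + 1 / d) * exp (d * r\<^sup>2)) ^ n"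
      using r base by (intro power_mono) auto
    also have "\<dots> = (2 + 1 / d) ^ n * exp (real n * d * r\<^sup>2)"
      by (simp add: power_mult_distrib exp_of_nat_mult mult.assoc)
    also have "\<dots> \<le> (2 + 1 / d) ^ n * exp (e * r\<^sup>2)"
      using d nd by (intro mult_left_mono) (auto intro: mult_right_mono)
    finally show "(1 + r) ^ n \<le> (2 + 1 / d) ^ n * exp (e * r\<^sup>2)" .
  qed
qed

section \<open>The Gaussian measure\<close>

lemma
  fixes h :: "complex \<Rightarrow> 'b::{banach, second_countable_topology}"
  assumes "continuous_on UNIV h"
  shows integrable_gauss_measure_iff:
      "integrable gauss_measure h \<longleftrightarrow> integrable lborel (\<lambda>z. exp (- (cmod z)\<^sup>2) *\<^sub>R h z)"
    and integral_gauss_measure: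
      "integral\<^sup>L gauss_measure h = (\<integral>z. exp (- (cmod z)\<^sup>2) *\<^sub>R h z \<partial>lborel) /\<^sub>R pi"
proof -
  have hb: "h \<in> borel_measurable borel"
    using assms by (rule borel_measurable_continuous_onI)
  have hl: "h \<in> borel_measurable lebesgue"
    using hb by (simp add: measurable_completion)
  have eq: "(\<lambda>z. (exp (- (cmod z)\<^sup>2) / pi) *\<^sub>R h z) = (\<lambda>z. inverse pi *\<^sub>R (exp (- (cmod z)\<^sup>2) *\<^sub>R h z))"
    by (simp add: field_simps)
  have wl: "(\<lambda>z::complex. exp (- (cmod z)\<^sup>2) / pi) \<in> borel_measurable lebesgue"
    by (rule measurable_completion) simp
  have mb: "(\<lambda>z. (exp (- (cmod z)\<^sup>2) / pi) *\<^sub>R h z) \<in> borel_measurable lborel"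
    using hb by simp
  have "integrable gauss_measure h \<longleftrightarrow> integrable lebesgue (\<lambda>z. (exp (- (cmod z)\<^sup>2) / pi) *\<^sub>R h z)"
    unfolding gauss_measure_def by (rule integrable_density) (use hl wl in auto)
  also have "\<dots> \<longleftrightarrow> integrable lborel (\<lambda>z. (exp (- (cmod z)\<^sup>2) / pi) *\<^sub>R h z)"
    by (rule integrable_completion[OF mb])
  finally show "integrable gauss_measure h \<longleftrightarrow> integrable lborel (\<lambda>z. exp (- (cmod z)\<^sup>2) *\<^sub>R h z)"
    unfolding eq
    using integrable_scaleR_right[of pi lborel "\<lambda>z. inverse pi *\<^sub>R (exp (- (cmod z)\<^sup>2) *\<^sub>R h z)"]
      integrable_scaleR_right[of "inverse pi" lborel "\<lambda>z. exp (- (cmod z)\<^sup>2) *\<^sub>R h z"]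
    by (auto simp: mult.assoc[symmetric])
  have "integral\<^sup>L gauss_measure h = (\<integral>z. (exp (- (cmod z)\<^sup>2) / pi) *\<^sub>R h z \<partial>lebesgue)"
    unfolding gauss_measure_def by (rule integral_density) (use hl wl in auto)
  also have "\<dots> = (\<integral>z. (exp (- (cmod z)\<^sup>2) / pi) *\<^sub>R h z \<partial>lborel)"
    by (rule integral_completion[OF mb])
  finally show "integral\<^sup>L gauss_measure h = (\<integral>z. exp (- (cmod z)\<^sup>2) *\<^sub>R h z \<partial>lborel) /\<^sub>R pi"
    unfolding eq by (simp only: integral_scaleR_right)
qed

lemma continuous_AE_eq_imp_eq:
  fixes h k :: "complex \<Rightarrow> complex"
  assumes "continuous_on UNIV h" "continuous_on UNIV k" and "AE z in lebesgue. h z = k z"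
  shows "h = k"
proof -
  have op: "open {z. h z \<noteq> k z}"
    using assms(1,2) by (intro open_Collect_neq)
  have "{z. h z \<noteq> k z} \<in> sets lebesgue"
    using op by auto
  then have "{z. h z \<noteq> k z} \<in> null_sets lebesgue"
    using assms(3) by (subst AE_iff_null_sets) auto
  then have "negligible {z. h z \<noteq> k z}"
    by (simp add: negligible_iff_null_sets)
  then have "{z. h z \<noteq> k z} = {}"
    using op open_not_negligible by blast
  then show ?thesis by auto
qed

text \<open>A quarter turn preserves null sets, so a continuous radial function is invariant under it.\<close>

lemma radial_imp_quarter_turn:
  assumes cont: "continuous_on UNIV u" and "radial u"
  shows "u (\<i> * z) = u z"
proof -
  obtain \<phi> where \<phi>: "AE z in lebesgue. u z = \<phi> (cmod z)"
    using assms(2) by (auto simp: radial_def)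
  then obtain N where N: "N \<in> null_sets lebesgue" "\<And>z. z \<notin> N \<Longrightarrow> u z = \<phi> (cmod z)"
    by (auto elim!: AE_E3)
  have "negligible N"
    using N(1) by (simp add: negligible_iff_null_sets)
  then have "negligible ((\<lambda>z. - \<i> * z) ` N)"
    by (rule negligible_differentiable_image_negligible[OF order_refl])
       (auto intro!: derivative_intros simp: differentiable_on_def)
  moreover have "(\<lambda>z. \<i> * z) -` N \<subseteq> (\<lambda>z. - \<i> * z) ` N"
  proof
    fix z assume "z \<in> (\<lambda>z. \<i> * z) -` N"
    moreover have "z = - \<i> * (\<i> * z)" by simp
    ultimately show "z \<in> (\<lambda>z. - \<i> * z) ` N" by blast
  qed
  ultimately have "negligible ((\<lambda>z. \<i> * z) -` N)"
    by (rule negligible_subset)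
  then have "AE z in lebesgue. \<i> * z \<notin> N"
    by (intro AE_I'[of "(\<lambda>z. \<i> * z) -` N"]) (auto simp: negligible_iff_null_sets)
  with \<phi> have "AE z in lebesgue. u (\<i> * z) = u z"
    by eventually_elim (use N(2) in \<open>auto simp: norm_mult\<close>)
  then have "(\<lambda>z. u (\<i> * z)) = u"
    by (intro continuous_AE_eq_imp_eq continuous_on_compose2[OF cont] cont continuous_intros) auto
  then show ?thesis by metis
qed

section \<open>Integration by parts and contour shifts\<close>

lemma inverse_one_plus_square_tendsto:
  "((\<lambda>x::real. C * inverse (1 + x\<^sup>2)) \<longlongrightarrow> 0) at_top"
  "((\<lambda>x::real. C * inverse (1 + x\<^sup>2)) \<longlongrightarrow> 0) at_bot"
proof -
  have top: "filterlim (\<lambda>x::real. 1 + x\<^sup>2) at_top at_top"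
    by (intro filterlim_tendsto_add_at_top[OF tendsto_const] filterlim_pow_at_top filterlim_ident) simp
  have bot: "filterlim (\<lambda>x::real. 1 + x\<^sup>2) at_top at_bot"
    by (intro filterlim_tendsto_add_at_top[OF tendsto_const] filterlim_pow_at_bot_even filterlim_ident) simp_all
  show "((\<lambda>x::real. C * inverse (1 + x\<^sup>2)) \<longlongrightarrow> 0) at_top"
    using tendsto_mult_right_zero[OF tendsto_inverse_0_at_top[OF top]] .
  show "((\<lambda>x::real. C * inverse (1 + x\<^sup>2)) \<longlongrightarrow> 0) at_bot"
    using tendsto_mult_right_zero[OF tendsto_inverse_0_at_top[OF bot]] .
qed

lemma integral_derivative_eq_0:
  fixes G g :: "real \<Rightarrow> complex"
  assumes G: "\<And>x. (G has_vector_derivative g x) (at x)" and g: "continuous_on UNIV g"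
    and g_le: "\<And>x. norm (g x) \<le> C * inverse (1 + x\<^sup>2)"
    and G_le: "\<And>x. norm (G x) \<le> D * inverse (1 + x\<^sup>2)"
  shows "integral\<^sup>L lborel g = 0"
proof -
  have line: "einterval (-\<infinity>) \<infinity> = UNIV"
    by (auto simp: einterval_def)
  have int: "integrable lborel g"
    using g g_le by (rule integrable_line_bound)
  have lim: "(G \<longlongrightarrow> 0) at_top" "(G \<longlongrightarrow> 0) at_bot"
    by (rule Lim_null_comparison[OF _ inverse_one_plus_square_tendsto(1)[of D]] 
             Lim_null_comparison[OF _ inverse_one_plus_square_tendsto(2)[of D]];
        simp add: G_le)+
  have "(LBINT x=-\<infinity>..\<infinity>. g x) = 0 - 0"
  proof (rule interval_integral_FTC_integrable)
    show "set_integrable lborel (einterval (-\<infinity>) \<infinity>) g"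
      using int by (simp add: line set_integrable_def)
    show "((G \<circ> real_of_ereal) \<longlongrightarrow> 0) (at_right (-\<infinity>))" "((G \<circ> real_of_ereal) \<longlongrightarrow> 0) (at_left \<infinity>)"
      using lim by (simp_all add: ereal_tendsto_simps)
    show "isCont g x" for x
      using g by (simp add: continuous_on_eq_continuous_at)
  qed (use G in auto)
  then show ?thesis
    by (simp add: interval_lebesgue_integral_def line set_lebesgue_integral_def)
qed

lemma integral_partial_x_eq_0:
  fixes K L :: "complex \<Rightarrow> complex"
  assumes K: "\<And>x y. ((\<lambda>x. K (Complex x y)) has_vector_derivative L (Complex x y)) (at x)"
    and L: "continuous_on UNIV L"
    and L_le: "\<And>z. norm (L z) \<le> C * plane_weight z" and K_le: "\<And>z. norm (K z) \<le> D * plane_weight z"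
  shows "integral\<^sup>L lborel L = 0"
proof -
  have "(\<integral>x. L (Complex x y) \<partial>lborel) = 0" for y
  proof (rule integral_derivative_eq_0)
    show "continuous_on UNIV (\<lambda>x. L (Complex x y))"
      by (intro continuous_on_compose2[OF L] continuous_intros) auto
    show "norm (L (Complex x y)) \<le> (C * inverse (1 + y\<^sup>2)) * inverse (1 + x\<^sup>2)" 
         "norm (K (Complex x y)) \<le> (D * inverse (1 + y\<^sup>2)) * inverse (1 + x\<^sup>2)" for x
      using L_le[of "Complex x y"] K_le[of "Complex x y"] by (simp_all add: plane_weight_def mult_ac)
  qed (rule K)
  then show ?thesis
    using integral_plane_yx[OF integrable_plane_bound[OF L L_le]] by simp
qed

lemma integral_partial_y_eq_0:
  fixes K L :: "complex \<Rightarrow> complex"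
  assumes K: "\<And>x y. ((\<lambda>y. K (Complex x y)) has_vector_derivative L (Complex x y)) (at y)"
    and L: "continuous_on UNIV L"
    and L_le: "\<And>z. norm (L z) \<le> C * plane_weight z" and K_le: "\<And>z. norm (K z) \<le> D * plane_weight z"
  shows "integral\<^sup>L lborel L = 0"
proof -
  have "(\<integral>y. L (Complex x y) \<partial>lborel) = 0" for x
  proof (rule integral_derivative_eq_0)
    show "continuous_on UNIV (\<lambda>y. L (Complex x y))"
      by (intro continuous_on_compose2[OF L] continuous_intros) auto
    show "norm (L (Complex x y)) \<le> (C * inverse (1 + x\<^sup>2)) * inverse (1 + y\<^sup>2)" 
         "norm (K (Complex x y)) \<le> (D * inverse (1 + x\<^sup>2)) * inverse (1 + y\<^sup>2)" for y
      using L_le[of "Complex x y"] K_le[of "Complex x y"] by (simp_all add: plane_weight_def mult_ac)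
  qed (rule K)
  then show ?thesis
    using integral_plane_xy[OF integrable_plane_bound[OF L L_le]] by simp
qed

text \<open>If \<open>E = \<E>'\<close> then \<open>u \<mapsto> \<E> (u + \<i>\<eta>) - \<E> u\<close> tends to \<open>0\<close> at both ends, because it is the integral
  of \<open>E\<close> over a vertical segment; its derivative therefore has integral zero.\<close>

lemma contour_shift:
  assumes S: "open S" "convex S" and E: "E holomorphic_on S"
    and strip: "\<And>u t. 0 \<le> t \<Longrightarrow> t \<le> 1 \<Longrightarrow> Complex u (t * \<eta>) \<in> S"
    and bound: "\<And>u t. 0 \<le> t \<Longrightarrow> t \<le> 1 \<Longrightarrow> norm (E (Complex u (t * \<eta>))) \<le> C * inverse (1 + u\<^sup>2)"
  shows "(\<integral>u. E (Complex u \<eta>) \<partial>lborel) = (\<integral>u. E (Complex u 0) \<partial>lborel)"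
proof -
  obtain F where F: "\<And>z. z \<in> S \<Longrightarrow> (F has_field_derivative E z) (at z within S)"
  proof (rule holomorphic_convex_primitive'[OF S(2,1) E])
    fix g assume "\<And>z. z \<in> S \<Longrightarrow> (g has_field_derivative E z) (at z within S)"
    then show thesis by (rule that)
  qed
  have F': "(F has_field_derivative E z) (at z)" if "z \<in> S" for z
    using F[OF that] by (simp only: at_within_open[OF that S(1)])
  have cE: "continuous_on S E"
    using E by (rule holomorphic_on_imp_continuous_on)
  have in0: "Complex u 0 \<in> S" and in1: "Complex u \<eta> \<in> S" for u
    using strip[of 0 u] strip[of 1 u] by simp_all
  have c0: "continuous_on UNIV (\<lambda>u. E (Complex u 0))" and c1: "continuous_on UNIV (\<lambda>u. E (Complex u \<eta>))"
    by (intro continuous_on_compose2[OF cE] continuous_intros; use in0 in1 in auto)+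
  have b0: "norm (E (Complex u 0)) \<le> C * inverse (1 + u\<^sup>2)" and b1: "norm (E (Complex u \<eta>)) \<le> C * inverse (1 + u\<^sup>2)" for u
    using bound[of 0 u] bound[of 1 u] by simp_all
  have deriv: "((\<lambda>u. F (Complex u t)) has_vector_derivative E (Complex u t)) (at u)" if "Complex u t \<in> S" for u t
  proof -
    have "((\<lambda>u. of_real u + \<i> * of_real t) has_vector_derivative 1) (at u)"
      by (auto intro!: derivative_eq_intros)
    moreover have "(F has_field_derivative E (Complex u t)) (at (of_real u + \<i> * of_real t))"
      using F'[OF that] by (simp add: Complex_eq)
    ultimately have "(F \<circ> (\<lambda>u. of_real u + \<i> * of_real t) has_vector_derivative 1 * E (Complex u t)) (at u)"
      by (rule field_vector_diff_chain_at)
    then show ?thesis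
      by (simp add: o_def Complex_eq)
  qed
  have "(\<integral>u. (E (Complex u \<eta>) - E (Complex u 0)) \<partial>lborel) = 0"
  proof (rule integral_derivative_eq_0)
    show "((\<lambda>u. F (Complex u \<eta>) - F (Complex u 0)) has_vector_derivative E (Complex u \<eta>) - E (Complex u 0)) (at u)" for u
      by (intro has_vector_derivative_diff deriv in0 in1)
    show "continuous_on UNIV (\<lambda>u. E (Complex u \<eta>) - E (Complex u 0))"
      by (intro continuous_on_diff c0 c1)
    show "norm (E (Complex u \<eta>) - E (Complex u 0)) \<le> (2 * C) * inverse (1 + u\<^sup>2)" for u
      using b0[of u] b1[of u] norm_triangle_ineq4[of "E (Complex u \<eta>)" "E (Complex u 0)"] by simp
    show "norm (F (Complex u \<eta>) - F (Complex u 0)) \<le> (C * \<bar>\<eta>\<bar>) * inverse (1 + u\<^sup>2)" for u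
    proof -
      have seg: "\<exists>t. 0 \<le> t \<and> t \<le> 1 \<and> z = Complex u (t * \<eta>)" if "z \<in> closed_segment (Complex u 0) (Complex u \<eta>)" for z
        using that by (auto simp: closed_segment_def complex_eq_iff algebra_simps)
      have "norm (F (Complex u \<eta>) - F (Complex u 0)) \<le> C * inverse (1 + u\<^sup>2) * norm (Complex u \<eta> - Complex u 0)"
      proof (rule field_differentiable_bound[of "closed_segment (Complex u 0) (Complex u \<eta>)"])
        show "(F has_field_derivative E z) (at z within closed_segment (Complex u 0) (Complex u \<eta>))"
          if "z \<in> closed_segment (Complex u 0) (Complex u \<eta>)" for z
          using seg[OF that] strip F' by (auto intro: has_field_derivative_at_within)
        show "norm (E z) \<le> C * inverse (1 + u\<^sup>2)" if "z \<in> closed_segment (Complex u 0) (Complex u \<eta>)" for z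
          using seg[OF that] bound by auto
      qed auto
      also have "norm (Complex u \<eta> - Complex u 0) = \<bar>\<eta>\<bar>"
        by (simp add: cmod_def)
      finally show ?thesis by (simp add: mult_ac)
    qed
  qed
  then show ?thesis
    using Bochner_Integration.integral_diff[OF integrable_line_bound[OF c1 b1] integrable_line_bound[OF c0 b0]] by simp
qed

text \<open>Pushing the contour to \<open>\<i>\<infinity>\<close> kills the integral of a function that decays in the upper
  half-plane.\<close>

lemma integral_upper_half_plane_eq_0:
  assumes d: "0 < d" and E: "E holomorphic_on {z. - d < Im z}"
    and bound: "\<And>z. 0 \<le> Im z \<Longrightarrow> norm (E z) \<le> C * plane_weight z"
  shows "(\<integral>x. E (of_real x) \<partial>lborel) = 0"
proof -
  have C: "0 \<le> C"
    using bound[of 0] order_trans[OF norm_ge_zero] by (fastforce simp: plane_weight_def)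
  define I where "I = (\<integral>x. inverse (1 + (x::real)\<^sup>2) \<partial>lborel)"
  have le: "norm (\<integral>x. E (of_real x) \<partial>lborel) \<le> C * I * inverse (1 + \<eta>\<^sup>2)" if "0 \<le> \<eta>" for \<eta>
  proof -
    have cE: "continuous_on {z. - d < Im z} E"
      using E by (rule holomorphic_on_imp_continuous_on)
    have "(\<integral>x. E (Complex x \<eta>) \<partial>lborel) = (\<integral>x. E (Complex x 0) \<partial>lborel)"
    proof (rule contour_shift[where S = "{z. - d < Im z}" and C = C])
      show "open {z. - d < Im z}" "convex {z. - d < Im z}"
        by (simp_all add: open_halfspace_Im_gt convex_halfspace_Im_gt)
      fix u t :: real
      assume t: "0 \<le> t" "t \<le> 1"
      show "Complex u (t * \<eta>) \<in> {z. - d < Im z}"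
        using d t that by (simp add: less_le_trans[of "-d" 0])
      have "C * plane_weight (Complex u (t * \<eta>)) \<le> C * inverse (1 + u\<^sup>2)"
        unfolding plane_weight_def using C
        by (intro mult_left_mono) (auto simp: divide_simps add_pos_nonneg)
      then show "norm (E (Complex u (t * \<eta>))) \<le> C * inverse (1 + u\<^sup>2)"
        using bound[of "Complex u (t * \<eta>)"] t that by simp
    qed (rule E)
    also have "(\<lambda>x. E (Complex x 0)) = (\<lambda>x. E (of_real x))"
      by (simp add: complex_of_real_def)
    finally have "norm (\<integral>x. E (of_real x) \<partial>lborel) = norm (\<integral>x. E (Complex x \<eta>) \<partial>lborel)"
      by simp
    also have "\<dots> \<le> (\<integral>x. norm (E (Complex x \<eta>)) \<partial>lborel)"
      by (rule integral_norm_bound)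
    also have "\<dots> \<le> (\<integral>x. (C * inverse (1 + \<eta>\<^sup>2)) * inverse (1 + x\<^sup>2) \<partial>lborel)"
    proof (rule integral_mono)
      show b: "norm (E (Complex x \<eta>)) \<le> (C * inverse (1 + \<eta>\<^sup>2)) * inverse (1 + x\<^sup>2)" for x
        using bound[of "Complex x \<eta>"] that by (simp add: plane_weight_def mult_ac)
      have "continuous_on UNIV (\<lambda>x. E (Complex x \<eta>))"
        using d that by (intro continuous_on_compose2[OF cE] continuous_intros) auto
      then show "integrable lborel (\<lambda>x. norm (E (Complex x \<eta>)))"
        using b by (intro integrable_norm integrable_line_bound)
    qed (intro integrable_mult_right integrable_inverse_one_plus_square)
    finally show ?thesis
      by (simp add: I_def mult_ac)
  qed
  have "norm (\<integral>x. E (of_real x) \<partial>lborel) \<le> 0"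
  proof (rule tendsto_lowerbound)
    show "((\<lambda>\<eta>. C * I * inverse (1 + \<eta>\<^sup>2)) \<longlongrightarrow> 0) at_top"
      by (rule inverse_one_plus_square_tendsto)
    show "\<forall>\<^sub>F \<eta> in at_top. norm (\<integral>x. E (of_real x) \<partial>lborel) \<le> C * I * inverse (1 + \<eta>\<^sup>2)"
      using eventually_ge_at_top[of 0] by eventually_elim (rule le)
  qed simp
  then show ?thesis by simp
qed

section \<open>Entire functions of Gaussian growth\<close>

definition gauss_bounded :: "real \<Rightarrow> (complex \<Rightarrow> complex) \<Rightarrow> bool" where
  "gauss_bounded \<tau> H \<longleftrightarrow> (\<exists>C. \<forall>z. cmod (H z) \<le> C * exp (\<tau> * (cmod z)\<^sup>2))"

lemma gauss_boundedD:
  assumes "gauss_bounded \<tau> H"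
  shows "\<exists>C>0. \<forall>z. cmod (H z) \<le> C * exp (\<tau> * (cmod z)\<^sup>2)"
proof -
  obtain C where C: "\<And>z. cmod (H z) \<le> C * exp (\<tau> * (cmod z)\<^sup>2)"
    using assms unfolding gauss_bounded_def by blast
  have "cmod (H z) \<le> max C 1 * exp (\<tau> * (cmod z)\<^sup>2)" for z
    using C[of z] by (rule order_trans) (intro mult_right_mono, auto)
  then show ?thesis
    by (intro exI[of _ "max C 1"]) simp
qed

lemma gaussian_decay:
  assumes "gauss_bounded \<tau> H" and "\<tau> < \<gamma>"
  shows "\<exists>C. \<forall>z. (1 + cmod z) ^ n * cmod (H z) * exp (- \<gamma> * (cmod z)\<^sup>2) \<le> C * plane_weight z"
proof -
  obtain A where A: "0 < A" "\<And>z. cmod (H z) \<le> A * exp (\<tau> * (cmod z)\<^sup>2)"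
    using gauss_boundedD[OF assms(1)] by blast
  define e where "e = (\<gamma> - \<tau>) / 2"
  have e: "0 < e"
    using assms(2) by (simp add: e_def)
  obtain B where B: "0 < B" "\<And>r. 0 \<le> r \<Longrightarrow> (1 + r) ^ n \<le> B * exp (e * r\<^sup>2)"
    using power_le_gaussian[OF e] by blast
  show ?thesis
  proof (intro exI allI)
    fix z
    have "(1 + cmod z) ^ n * cmod (H z) * exp (- \<gamma> * (cmod z)\<^sup>2)
        \<le> (B * exp (e * (cmod z)\<^sup>2)) * (A * exp (\<tau> * (cmod z)\<^sup>2)) * exp (- \<gamma> * (cmod z)\<^sup>2)"
      using A B by (intro mult_mono) auto
    also have "\<dots> = A * B * exp (e * (cmod z)\<^sup>2 + \<tau> * (cmod z)\<^sup>2 + - \<gamma> * (cmod z)\<^sup>2)"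
      by (simp only: exp_add mult_ac)
    also have "e * (cmod z)\<^sup>2 + \<tau> * (cmod z)\<^sup>2 + - \<gamma> * (cmod z)\<^sup>2 = - e * (cmod z)\<^sup>2"
      by (simp add: e_def field_simps)
    also have "A * B * exp (- e * (cmod z)\<^sup>2) \<le> A * B * ((1 + 1 / e)\<^sup>2 * plane_weight z)"
      using A B by (intro mult_left_mono gaussian_le_plane_weight e) auto
    finally show "(1 + cmod z) ^ n * cmod (H z) * exp (- \<gamma> * (cmod z)\<^sup>2) 
        \<le> (A * B * (1 + 1 / e)\<^sup>2) * plane_weight z"
      by (simp add: mult_ac)
  qed
qed

lemma poly_bound:
  fixes p :: "complex poly"
  shows "\<exists>A\<ge>0. \<forall>z. cmod (poly p z) \<le> A * (1 + cmod z) ^ degree p"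
proof (intro exI conjI allI)
  show "0 \<le> (\<Sum>i\<le>degree p. cmod (coeff p i))"
    by (intro sum_nonneg) auto
  fix z
  have "cmod (poly p z) \<le> (\<Sum>i\<le>degree p. cmod (coeff p i) * cmod z ^ i)"
    unfolding poly_altdef by (rule order_trans[OF norm_sum]) (simp add: norm_mult norm_power)
  also have "\<dots> \<le> (\<Sum>i\<le>degree p. cmod (coeff p i) * (1 + cmod z) ^ degree p)"
    by (intro sum_mono mult_left_mono order_trans[OF power_mono[of _ "1 + cmod z"] power_increasing]) auto
  finally show "cmod (poly p z) \<le> (\<Sum>i\<le>degree p. cmod (coeff p i)) * (1 + cmod z) ^ degree p"
    by (simp add: sum_distrib_right)
qed

lemma gauss_bounded_poly_mult:
  assumes "gauss_bounded \<tau> H" "\<tau> < \<tau>'"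
  shows "gauss_bounded \<tau>' (\<lambda>z. H z * poly p z)"
proof -
  obtain C where C: "0 < C" "\<And>z. cmod (H z) \<le> C * exp (\<tau> * (cmod z)\<^sup>2)"
    using gauss_boundedD[OF assms(1)] by blast
  obtain A where A: "0 \<le> A" "\<And>z. cmod (poly p z) \<le> A * (1 + cmod z) ^ degree p"
    using poly_bound[of p] by blast
  obtain B where B: "0 < B" "\<And>r. 0 \<le> r \<Longrightarrow> (1 + r) ^ degree p \<le> B * exp ((\<tau>' - \<tau>) * r\<^sup>2)"
    using power_le_gaussian[of "\<tau>' - \<tau>" "degree p"] assms(2) by auto
  have "cmod (H z * poly p z) \<le> (C * A * B) * exp (\<tau>' * (cmod z)\<^sup>2)" for z
  proof -
    have "cmod (poly p z) \<le> A * (B * exp ((\<tau>' - \<tau>) * (cmod z)\<^sup>2))"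
      using A(2)[of z] mult_left_mono[OF B(2)[of "cmod z"] A(1)] by simp
    then have "cmod (H z * poly p z) \<le> (C * exp (\<tau> * (cmod z)\<^sup>2)) * (A * (B * exp ((\<tau>' - \<tau>) * (cmod z)\<^sup>2)))"
      unfolding norm_mult using C by (intro mult_mono) auto
    also have "\<dots> = (C * A * B) * exp (\<tau> * (cmod z)\<^sup>2 + (\<tau>' - \<tau>) * (cmod z)\<^sup>2)"
      by (simp only: exp_add mult_ac)
    finally show ?thesis
      by (simp add: algebra_simps)
  qed
  then show ?thesis
    unfolding gauss_bounded_def by blast
qed

text \<open>Cauchy's estimate on the unit circle around \<open>z\<close>; passing from \<open>(1 + |z|)\<^sup>2\<close> to \<open>|z|\<^sup>2\<close> in the exponent costs
  an arbitrarily small increase of the rate.\<close>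

lemma gauss_bounded_deriv:
  assumes H: "H holomorphic_on UNIV" "gauss_bounded \<tau> H" and \<tau>: "0 \<le> \<tau>" "\<tau> < \<tau>'"
  shows "gauss_bounded \<tau>' (deriv H)"
proof -
  obtain C where C: "0 < C" "\<And>z. cmod (H z) \<le> C * exp (\<tau> * (cmod z)\<^sup>2)"
    using gauss_boundedD[OF H(2)] by blast
  obtain B where B: "0 < B" "\<And>r. 0 \<le> r \<Longrightarrow> exp (\<tau> * (1 + r)\<^sup>2) \<le> B * exp (\<tau>' * r\<^sup>2)"
  proof
    \<comment> \<open>The maximum over \<open>r\<close> of \<open>\<tau> (1 + r)\<^sup>2 - \<tau>' r\<^sup>2\<close>.\<close>
    define K where "K = \<tau> + \<tau>\<^sup>2 / (\<tau>' - \<tau>)"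
    show "0 < exp K" by simp
    fix r :: real
    have "0 \<le> (\<tau> - (\<tau>' - \<tau>) * r)\<^sup>2 / (\<tau>' - \<tau>)"
      using \<tau> by auto
    also have "\<dots> = \<tau>\<^sup>2 / (\<tau>' - \<tau>) - 2 * \<tau> * r + (\<tau>' - \<tau>) * r\<^sup>2"
      using \<tau> by (simp add: field_simps power2_eq_square)
    finally have "\<tau> * (1 + r)\<^sup>2 \<le> K + \<tau>' * r\<^sup>2"
      by (simp add: K_def power2_eq_square algebra_simps)
    then show "exp (\<tau> * (1 + r)\<^sup>2) \<le> exp K * exp (\<tau>' * r\<^sup>2)"
      by (simp add: exp_add[symmetric])
  qed
  have "cmod (deriv H z) \<le> (C * B) * exp (\<tau>' * (cmod z)\<^sup>2)" for z
  proof -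
    have "norm ((deriv ^^ 1) H z) \<le> fact 1 * (C * exp (\<tau> * (1 + cmod z)\<^sup>2)) / 1 ^ 1"
    proof (rule Cauchy_inequality)
      show "H holomorphic_on ball z 1"
        using H(1) by (rule holomorphic_on_subset) simp
      show "continuous_on (cball z 1) H"
        using H(1) by (auto intro: holomorphic_on_imp_continuous_on holomorphic_on_subset)
      fix w assume w: "cmod (z - w) = 1"
      have "cmod w \<le> 1 + cmod z"
        using norm_triangle_ineq4[of z "z - w"] w by simp
      then have "exp (\<tau> * (cmod w)\<^sup>2) \<le> exp (\<tau> * (1 + cmod z)\<^sup>2)"
        using \<tau> by (auto intro!: mult_left_mono power_mono)
      then show "cmod (H w) \<le> C * exp (\<tau> * (1 + cmod z)\<^sup>2)"
        using C(2)[of w] mult_left_mono[of "exp (\<tau> * (cmod w)\<^sup>2)" "exp (\<tau> * (1 + cmod z)\<^sup>2)" C] C(1) by linarith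
    qed simp
    then have "cmod (deriv H z) \<le> C * exp (\<tau> * (1 + cmod z)\<^sup>2)"
      by simp
    also have "\<dots> \<le> C * (B * exp (\<tau>' * (cmod z)\<^sup>2))"
      using C(1) B by (intro mult_left_mono) auto
    finally show ?thesis by (simp add: mult_ac)
  qed
  then show ?thesis
    unfolding gauss_bounded_def by blast
qed

section \<open>Gaussian moments and Taylor coefficients of entire functions\<close>

definition gauss_moment :: "real \<Rightarrow> (complex \<Rightarrow> complex) \<Rightarrow> nat \<Rightarrow> complex" where
  "gauss_moment \<gamma> H j = (\<integral>z. exp (- \<gamma> * (cmod z)\<^sup>2) *\<^sub>R (H z * cnj z ^ j) \<partial>lborel)"

lemma gauss_moment_integrand_bound:
  assumes "gauss_bounded \<tau> H" and "\<tau> < \<gamma>"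
  shows "\<exists>C. \<forall>z. norm (exp (- \<gamma> * (cmod z)\<^sup>2) *\<^sub>R (H z * cnj z ^ j)) \<le> C * plane_weight z"
proof -
  obtain C where C: "\<And>z. (1 + cmod z) ^ j * cmod (H z) * exp (- \<gamma> * (cmod z)\<^sup>2) \<le> C * plane_weight z"
    using gaussian_decay[OF assms] by blast
  have "norm (exp (- \<gamma> * (cmod z)\<^sup>2) *\<^sub>R (H z * cnj z ^ j)) \<le> C * plane_weight z" for z
  proof -
    have "norm (exp (- \<gamma> * (cmod z)\<^sup>2) *\<^sub>R (H z * cnj z ^ j)) = cmod z ^ j * cmod (H z) * exp (- \<gamma> * (cmod z)\<^sup>2)"
      by (simp add: norm_mult norm_power mult_ac)
    also have "\<dots> \<le> (1 + cmod z) ^ j * cmod (H z) * exp (- \<gamma> * (cmod z)\<^sup>2)"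
      by (intro mult_right_mono power_mono) auto
    finally show ?thesis
      using C[of z] by linarith
  qed
  then show ?thesis by blast
qed

lemma integrable_gauss_moment:
  assumes "continuous_on UNIV H" "gauss_bounded \<tau> H" "\<tau> < \<gamma>"
  shows "integrable lborel (\<lambda>z. exp (- \<gamma> * (cmod z)\<^sup>2) *\<^sub>R (H z * cnj z ^ j))"
proof -
  obtain C where "\<And>z. norm (exp (- \<gamma> * (cmod z)\<^sup>2) *\<^sub>R (H z * cnj z ^ j)) \<le> C * plane_weight z"
    using gauss_moment_integrand_bound[OF assms(2,3)] by blast
  moreover have "continuous_on UNIV (\<lambda>z. exp (- \<gamma> * (cmod z)\<^sup>2) *\<^sub>R (H z * cnj z ^ j))"
    by (intro continuous_intros assms(1))
  ultimately show ?thesis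
    by (intro integrable_plane_bound)
qed

text \<open>Both partial derivatives of \<open>K z = exp (- \<gamma> |z|\<^sup>2) H z (cnj z)\<^bsup>j\<^esup>\<close> have integral zero.  In the combination
  \<open>\<partial>K/\<partial>x + \<i> \<partial>K/\<partial>y\<close> the derivative of the entire factor \<open>H\<close> cancels, and the two surviving terms are the two sides
  of the identity.\<close>

lemma gauss_moment_times_z:
  assumes H: "H holomorphic_on UNIV" and gH: "gauss_bounded \<tau> H" and \<tau>: "0 \<le> \<tau>" "\<tau> < \<gamma>"
  shows "of_real \<gamma> * gauss_moment \<gamma> (\<lambda>z. z * H z) j = of_nat j * gauss_moment \<gamma> H (j - 1)"
proof -
  define w where "w z = exp (- \<gamma> * (cmod z)\<^sup>2)" for z
  define K where "K z = w z *\<^sub>R (H z * cnj z ^ j)" for z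
  define L1 where "L1 z = w z *\<^sub>R (deriv H z * cnj z ^ j + of_nat j * H z * cnj z ^ (j - 1)
      - 2 * of_real \<gamma> * of_real (Re z) * H z * cnj z ^ j)" for z
  define L2 where "L2 z = w z *\<^sub>R (\<i> * deriv H z * cnj z ^ j - \<i> * of_nat j * H z * cnj z ^ (j - 1)
      - 2 * of_real \<gamma> * of_real (Im z) * H z * cnj z ^ j)" for z
  define \<tau>' where "\<tau>' = (\<tau> + \<gamma>) / 2"
  have gH': "gauss_bounded \<tau>' (deriv H)" "\<tau>' < \<gamma>"
    using gauss_bounded_deriv[OF H gH \<tau>(1)] \<tau> by (simp_all add: \<tau>'_def)
  have cH: "continuous_on UNIV H" "continuous_on UNIV (deriv H)"
    using H by (auto intro!: holomorphic_on_imp_continuous_on holomorphic_deriv)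
  have dH: "(H has_field_derivative deriv H z) (at z)" for z
    using H by (simp add: holomorphic_derivI)
  obtain C0 where C0: "\<And>z. (1 + cmod z) ^ (j + 1) * cmod (H z) * exp (- \<gamma> * (cmod z)\<^sup>2) \<le> C0 * plane_weight z"
    using gaussian_decay[OF gH \<tau>(2)] by blast
  obtain C1 where C1: "\<And>z. (1 + cmod z) ^ (j + 1) * cmod (deriv H z) * exp (- \<gamma> * (cmod z)\<^sup>2) \<le> C1 * plane_weight z"
    using gaussian_decay[OF gH'] by blast
  have pow: "cmod z ^ j \<le> (1 + cmod z) ^ (j + 1)" "cmod z ^ (j - 1) \<le> (1 + cmod z) ^ (j + 1)" for z :: complex
    by (rule order_trans[OF power_mono[of _ "1 + cmod z"] power_increasing]; simp)+
  have pow': "\<bar>Re z\<bar> * cmod z ^ j \<le> (1 + cmod z) ^ (j + 1)" "\<bar>Im z\<bar> * cmod z ^ j \<le> (1 + cmod z) ^ (j + 1)" for z :: complex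
    using abs_Re_le_cmod[of z] abs_Im_le_cmod[of z] power_mono[of "cmod z" "1 + cmod z" j]
    by (auto intro!: mult_mono)
  have w: "0 < w z" for z by (simp add: w_def)
  have K_le: "norm (K z) \<le> C0 * plane_weight z" for z
  proof -
    have "norm (K z) = cmod z ^ j * cmod (H z) * w z"
      using w[of z] by (simp add: K_def norm_mult norm_power mult_ac)
    also have "\<dots> \<le> (1 + cmod z) ^ (j + 1) * cmod (H z) * w z"
      using pow(1) w[of z] by (intro mult_right_mono) (auto intro: less_imp_le)
    finally show ?thesis
      using C0[of z] by (simp add: w_def)
  qed
  have L_le: "w z * (cmod (deriv H z) * cmod z ^ j + real j * cmod (H z) * cmod z ^ (j - 1)
      + 2 * \<gamma> * t * cmod (H z) * cmod z ^ j) \<le> (C1 + (real j + 2 * \<gamma>) * C0) * plane_weight z"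
    if t: "t * cmod z ^ j \<le> (1 + cmod z) ^ (j + 1)" for z t
  proof -
    have "w z * (cmod (deriv H z) * cmod z ^ j + real j * cmod (H z) * cmod z ^ (j - 1)
      + 2 * \<gamma> * t * cmod (H z) * cmod z ^ j)
      = cmod z ^ j * (cmod (deriv H z) * w z) + real j * (cmod z ^ (j - 1) * (cmod (H z) * w z))
        + 2 * \<gamma> * ((t * cmod z ^ j) * (cmod (H z) * w z))"
      by (simp add: algebra_simps)
    also have "\<dots> \<le> (1 + cmod z) ^ (j + 1) * (cmod (deriv H z) * w z)
        + real j * ((1 + cmod z) ^ (j + 1) * (cmod (H z) * w z))
        + 2 * \<gamma> * ((1 + cmod z) ^ (j + 1) * (cmod (H z) * w z))"
      using w[of z] \<tau> pow[of z] t by (intro add_mono mult_left_mono mult_right_mono) auto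
    also have "\<dots> \<le> C1 * plane_weight z + real j * (C0 * plane_weight z) + 2 * \<gamma> * (C0 * plane_weight z)"
      using \<tau> C0[of z] C1[of z] by (intro add_mono mult_left_mono) (auto simp: w_def mult.assoc)
    finally show ?thesis
      by (simp add: algebra_simps)
  qed
  have L1_le: "norm (L1 z) \<le> (C1 + (real j + 2 * \<gamma>) * C0) * plane_weight z" for z
  proof -
    have "norm (L1 z) \<le> w z * (cmod (deriv H z) * cmod z ^ j + real j * cmod (H z) * cmod z ^ (j - 1)
      + 2 * \<gamma> * \<bar>Re z\<bar> * cmod (H z) * cmod z ^ j)"
      unfolding L1_def norm_scaleR using w[of z] \<tau>
      by (auto intro!: mult_left_mono order_trans[OF norm_triangle_ineq4] add_mono order_trans[OF norm_triangle_ineq]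
          simp: norm_mult norm_power)
    then show ?thesis
      using L_le[OF pow'(1)] by (rule order_trans)
  qed
  have L2_le: "norm (L2 z) \<le> (C1 + (real j + 2 * \<gamma>) * C0) * plane_weight z" for z
  proof -
    have "norm (L2 z) \<le> w z * (cmod (deriv H z) * cmod z ^ j + real j * cmod (H z) * cmod z ^ (j - 1)
      + 2 * \<gamma> * \<bar>Im z\<bar> * cmod (H z) * cmod z ^ j)"
      unfolding L2_def norm_scaleR using w[of z] \<tau>
      by (auto intro!: mult_left_mono order_trans[OF norm_triangle_ineq4] add_mono
          simp: norm_mult norm_power)
    then show ?thesis
      using L_le[OF pow'(2)] by (rule order_trans)
  qed
  have wC: "complex_of_real (w (Complex x y)) = exp (- of_real \<gamma> * (of_real x ^ 2 + of_real y ^ 2))" for x y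
    unfolding w_def by (simp add: cmod_power2 exp_of_real[symmetric])
  have cL1: "continuous_on UNIV L1" and cL2: "continuous_on UNIV L2"
    unfolding L1_def L2_def w_def by (intro continuous_intros cH)+
  have "integral\<^sup>L lborel L1 = 0"
  proof (rule integral_partial_x_eq_0[OF _ cL1 L1_le K_le])
    fix x y
    \<comment> \<open>On a horizontal line \<open>K\<close> is the restriction of an entire function of \<open>x\<close>, so complex differentiation applies.\<close>
    define \<Phi> where "\<Phi> s = exp (- of_real \<gamma> * (s ^ 2 + of_real y ^ 2)) * (H (s + \<i> * of_real y) * (s - \<i> * of_real y) ^ j)" for s
    have "(\<Phi> has_field_derivative L1 (Complex x y)) (at (of_real x))"
      unfolding \<Phi>_def L1_def scaleR_conv_of_real wC
      by (auto intro!: derivative_eq_intros DERIV_chain2[OF dH] simp: Complex_eq algebra_simps)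
    then have "((\<lambda>x. \<Phi> (of_real x)) has_vector_derivative L1 (Complex x y)) (at x)"
      by (rule has_vector_derivative_real_field)
    also have "(\<lambda>x. \<Phi> (of_real x)) = (\<lambda>x. K (Complex x y))"
      by (simp add: \<Phi>_def K_def scaleR_conv_of_real wC) (simp add: Complex_eq)
    finally show "((\<lambda>x. K (Complex x y)) has_vector_derivative L1 (Complex x y)) (at x)" .
  qed
  moreover have "integral\<^sup>L lborel L2 = 0"
  proof (rule integral_partial_y_eq_0[OF _ cL2 L2_le K_le])
    fix x y
    have swap: "exp (- (of_real \<gamma> * (of_real y)\<^sup>2) - of_real \<gamma> * (of_real x)\<^sup>2)
        = exp (- (of_real \<gamma> * (of_real x)\<^sup>2) - of_real \<gamma> * (of_real y)\<^sup>2 :: complex)"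
      by (rule arg_cong[where f = exp]) simp
    define \<Phi> where "\<Phi> s = exp (- of_real \<gamma> * (of_real x ^ 2 + s ^ 2)) * (H (of_real x + \<i> * s) * (of_real x - \<i> * s) ^ j)" for s
    have "(\<Phi> has_field_derivative L2 (Complex x y)) (at (of_real y))"
      unfolding \<Phi>_def L2_def scaleR_conv_of_real wC
      by (auto intro!: derivative_eq_intros DERIV_chain2[OF dH] simp: Complex_eq algebra_simps
          swap)
    then have "((\<lambda>y. \<Phi> (of_real y)) has_vector_derivative L2 (Complex x y)) (at y)"
      by (rule has_vector_derivative_real_field)
    also have "(\<lambda>y. \<Phi> (of_real y)) = (\<lambda>y. K (Complex x y))"
      by (simp add: \<Phi>_def K_def scaleR_conv_of_real wC) (simp add: Complex_eq)
    finally show "((\<lambda>y. K (Complex x y)) has_vector_derivative L2 (Complex x y)) (at y)" .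
  qed
  moreover have "(\<integral>z. L1 z + \<i> * L2 z \<partial>lborel) = integral\<^sup>L lborel L1 + \<i> * integral\<^sup>L lborel L2"
    using integrable_plane_bound[OF cL1 L1_le] integrable_plane_bound[OF cL2 L2_le] by simp
  ultimately have zero: "(\<integral>z. L1 z + \<i> * L2 z \<partial>lborel) = 0" by simp
  have eq: "L1 z + \<i> * L2 z = (2 * of_nat j) * (w z *\<^sub>R (H z * cnj z ^ (j - 1)))
      - (2 * of_real \<gamma>) * (w z *\<^sub>R ((z * H z) * cnj z ^ j))" for z
  proof -
    have "of_real (Re z) + \<i> * of_real (Im z) = z" by (rule complex_eq[symmetric])
    moreover have "L1 z + \<i> * L2 z = (2 * of_nat j) * (w z *\<^sub>R (H z * cnj z ^ (j - 1)))
      - (2 * of_real \<gamma>) * (w z *\<^sub>R (((of_real (Re z) + \<i> * of_real (Im z)) * H z) * cnj z ^ j))"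
      unfolding L1_def L2_def scaleR_conv_of_real by (simp add: algebra_simps)
    ultimately show ?thesis by simp
  qed
  have i1: "integrable lborel (\<lambda>z. w z *\<^sub>R (H z * cnj z ^ (j - 1)))"
    unfolding w_def using integrable_gauss_moment[OF cH(1) gH \<tau>(2)] .
  have i2: "integrable lborel (\<lambda>z. w z *\<^sub>R ((z * H z) * cnj z ^ j))"
  proof -
    have "gauss_bounded \<tau>' (\<lambda>z. H z * poly [:0, 1:] z)"
      using gH \<tau> by (intro gauss_bounded_poly_mult) (auto simp: \<tau>'_def)
    then show ?thesis
      unfolding w_def
      by (intro integrable_gauss_moment[OF _ _ gH'(2)] continuous_intros cH) (simp add: mult_ac)
  qed
  have "0 = (2 * of_nat j) * gauss_moment \<gamma> H (j - 1) - (2 * of_real \<gamma>) * gauss_moment \<gamma> (\<lambda>z. z * H z) j"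
    using zero unfolding eq gauss_moment_def w_def[symmetric]
    by (simp only: Bochner_Integration.integral_diff[OF integrable_mult_right[OF i1] integrable_mult_right[OF i2]]
        integral_mult_right_zero)
  then show ?thesis by simp
qed

definition taylor_coeff :: "(complex \<Rightarrow> complex) \<Rightarrow> nat \<Rightarrow> complex" where
  "taylor_coeff G j = (deriv ^^ j) G 0 / fact j"

text \<open>Writing \<open>G z = G 0 + z G\<^sub>1 z\<close> and integrating by parts turns the \<open>j\<close>-th moment of \<open>G\<close> into the \<open>(j - 1)\<close>-st
  moment of \<open>G\<^sub>1\<close>, whose Taylor coefficients are those of \<open>G\<close> shifted by one; the induction starts from the mean value
  property.  The integral of the Gaussian remains as a normalizing factor.\<close>

lemma gauss_moment_eq_taylor_coeff:
  assumes "G holomorphic_on UNIV" "gauss_bounded \<tau> G" "0 \<le> \<tau>" "\<tau> < \<gamma>"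
  shows "gauss_moment \<gamma> G j = fact j / of_real \<gamma> ^ j * taylor_coeff G j * gauss_moment \<gamma> (\<lambda>z. 1) 0"
  using assms(1,2)
proof (induction j arbitrary: G)
  have \<gamma>: "0 < \<gamma>" using assms by simp
  have one: "gauss_bounded 0 (\<lambda>z. 1)"
    unfolding gauss_bounded_def by (intro exI[of _ 1]) simp
  have step: "\<exists>G\<^sub>1. G\<^sub>1 holomorphic_on UNIV \<and> gauss_bounded \<tau> G\<^sub>1 \<and> (\<forall>z. G z = G 0 + z * G\<^sub>1 z) \<and>
      (\<forall>j. gauss_moment \<gamma> G j = G 0 * gauss_moment \<gamma> (\<lambda>z. 1) j + gauss_moment \<gamma> (\<lambda>z. z * G\<^sub>1 z) j)"
    if G: "G holomorphic_on UNIV" and gG: "gauss_bounded \<tau> G" for G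
  proof -
    define G\<^sub>1 where "G\<^sub>1 z = (if z = 0 then deriv G 0 else (G z - G 0) / (z - 0))" for z
    have h1: "G\<^sub>1 holomorphic_on UNIV"
      unfolding G\<^sub>1_def[abs_def] using pole_lemma_open[OF G, of 0] by simp
    have eq: "G z = G 0 + z * G\<^sub>1 z" for z
      by (simp add: G\<^sub>1_def)
    obtain C where C: "0 < C" "\<And>z. cmod (G z) \<le> C * exp (\<tau> * (cmod z)\<^sup>2)"
      using gauss_boundedD[OF gG] by blast
    have "compact (G\<^sub>1 ` cball 0 1)"
      using h1 by (intro compact_continuous_image holomorphic_on_imp_continuous_on) (auto intro: holomorphic_on_subset)
    then have "bounded (G\<^sub>1 ` cball 0 1)"
      by (rule compact_imp_bounded)
    then obtain B where "\<forall>w\<in>G\<^sub>1 ` cball 0 1. cmod w \<le> B"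
      unfolding bounded_iff by blast
    then have B: "cmod (G\<^sub>1 z) \<le> B" if "cmod z \<le> 1" for z
      using that by auto
    have "cmod (G\<^sub>1 z) \<le> (max B 0 + 2 * C) * exp (\<tau> * (cmod z)\<^sup>2)" for z
    proof -
      have e1: "1 \<le> exp (\<tau> * (cmod z)\<^sup>2)"
        using assms by simp
      show ?thesis
      proof (cases "cmod z \<le> 1")
        case True
        have "cmod (G\<^sub>1 z) \<le> max B 0 + 2 * C"
          using B[OF True] C by simp
        also have "\<dots> = (max B 0 + 2 * C) * 1"
          by simp
        also have "\<dots> \<le> (max B 0 + 2 * C) * exp (\<tau> * (cmod z)\<^sup>2)"
          using e1 C by (intro mult_left_mono) auto
        finally show ?thesis .
      next
        case False
        then have "cmod (G\<^sub>1 z) = cmod (G z - G 0) / cmod z"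
          by (auto simp: G\<^sub>1_def norm_divide)
        also have "\<dots> \<le> cmod (G z - G 0) / 1"
          using False by (intro divide_left_mono) auto
        also have "\<dots> \<le> C * exp (\<tau> * (cmod z)\<^sup>2) + C"
          using norm_triangle_ineq4[of "G z" "G 0"] C(2)[of z] C(2)[of 0] by simp
        also have "\<dots> \<le> 2 * C * exp (\<tau> * (cmod z)\<^sup>2)"
          using e1 C(1) by simp
        also have "\<dots> \<le> (max B 0 + 2 * C) * exp (\<tau> * (cmod z)\<^sup>2)"
          by (intro mult_right_mono) auto
        finally show ?thesis .
      qed
    qed
    then have g1: "gauss_bounded \<tau> G\<^sub>1"
      unfolding gauss_bounded_def by blast
    have "gauss_moment \<gamma> G j = G 0 * gauss_moment \<gamma> (\<lambda>z. 1) j + gauss_moment \<gamma> (\<lambda>z. z * G\<^sub>1 z) j" for j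
    proof -
      have i1: "integrable lborel (\<lambda>z. exp (- \<gamma> * (cmod z)\<^sup>2) *\<^sub>R (1 * cnj z ^ j))"
        by (rule integrable_gauss_moment[OF _ one \<gamma>]) simp
      have i2: "integrable lborel (\<lambda>z. exp (- \<gamma> * (cmod z)\<^sup>2) *\<^sub>R (G z * cnj z ^ j))"
        using G by (intro integrable_gauss_moment[OF _ gG assms(4)] holomorphic_on_imp_continuous_on)
      have "(\<lambda>z. exp (- \<gamma> * (cmod z)\<^sup>2) *\<^sub>R ((z * G\<^sub>1 z) * cnj z ^ j)) =
          (\<lambda>z. exp (- \<gamma> * (cmod z)\<^sup>2) *\<^sub>R (G z * cnj z ^ j) - G 0 * (exp (- \<gamma> * (cmod z)\<^sup>2) *\<^sub>R (1 * cnj z ^ j)))"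
        by (subst eq) (simp add: algebra_simps)
      then have "gauss_moment \<gamma> (\<lambda>z. z * G\<^sub>1 z) j = gauss_moment \<gamma> G j - G 0 * gauss_moment \<gamma> (\<lambda>z. 1) j"
        unfolding gauss_moment_def
        by (simp only: Bochner_Integration.integral_diff[OF i2 integrable_mult_right[OF i1]] integral_mult_right_zero)
      then show ?thesis by simp
    qed
    with h1 g1 eq show ?thesis by blast
  qed
  {
    case 0
    obtain G\<^sub>1 where G\<^sub>1: "G\<^sub>1 holomorphic_on UNIV" "gauss_bounded \<tau> G\<^sub>1"
      "\<And>j. gauss_moment \<gamma> G j = G 0 * gauss_moment \<gamma> (\<lambda>z. 1) j + gauss_moment \<gamma> (\<lambda>z. z * G\<^sub>1 z) j"
      using step[OF 0] by blast
    then show ?case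
      using gauss_moment_times_z[OF G\<^sub>1(1,2) assms(3,4), of 0] \<gamma> by (simp add: taylor_coeff_def)
  next
    case (Suc j)
    obtain G\<^sub>1 where G\<^sub>1: "G\<^sub>1 holomorphic_on UNIV" "gauss_bounded \<tau> G\<^sub>1" "\<And>z. G z = G 0 + z * G\<^sub>1 z"
      "\<And>j. gauss_moment \<gamma> G j = G 0 * gauss_moment \<gamma> (\<lambda>z. 1) j + gauss_moment \<gamma> (\<lambda>z. z * G\<^sub>1 z) j"
      using step[OF Suc.prems] by blast
    have zero: "gauss_moment \<gamma> (\<lambda>z. 1) (Suc j) = 0"
    proof -
      have "gauss_bounded (\<gamma> / 2) (\<lambda>z. 1 * poly (monom 1 j) z)"
        using one \<gamma> by (intro gauss_bounded_poly_mult) auto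
      then have "of_real \<gamma> * gauss_moment \<gamma> (\<lambda>z. z * z ^ j) 0 = of_nat 0 * gauss_moment \<gamma> (\<lambda>z. z ^ j) (0 - 1)"
        using \<gamma> by (intro gauss_moment_times_z[where \<tau> = "\<gamma> / 2"] holomorphic_intros) (auto simp: poly_monom)
      then have "gauss_moment \<gamma> (\<lambda>z. z * z ^ j) 0 = 0"
        using \<gamma> by simp
      moreover have "gauss_moment \<gamma> (\<lambda>z. 1) (Suc j) = cnj (gauss_moment \<gamma> (\<lambda>z. z * z ^ j) 0)"
        unfolding gauss_moment_def by (subst Bochner_Integration.integral_cnj[symmetric]) simp
      ultimately show ?thesis by simp
    qed
    have coeff: "taylor_coeff G (Suc j) = taylor_coeff G\<^sub>1 j"
    proof -
      have hz: "(\<lambda>z. z * G\<^sub>1 z) holomorphic_on UNIV"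
        by (intro holomorphic_intros G\<^sub>1(1))
      have "(deriv ^^ Suc j) G 0 = (deriv ^^ Suc j) (\<lambda>z. G 0 + z * G\<^sub>1 z) 0"
        using G\<^sub>1(3) by (metis (no_types, lifting) ext)
      also have "\<dots> = (deriv ^^ Suc j) (\<lambda>z. z * G\<^sub>1 z) 0"
        using higher_deriv_add[of "\<lambda>_. G 0" UNIV "\<lambda>z. z * G\<^sub>1 z" 0 "Suc j"] hz by simp
      also have "\<dots> = (\<Sum>i = 0..Suc j. of_nat (Suc j choose i) * (deriv ^^ i) (\<lambda>z. z) 0 * (deriv ^^ (Suc j - i)) G\<^sub>1 0)"
        using higher_deriv_mult[of "\<lambda>z. z" UNIV G\<^sub>1 0 "Suc j"] G\<^sub>1(1) by simp
      also have "\<dots> = (\<Sum>i\<in>{1}. of_nat (Suc j choose i) * (deriv ^^ i) (\<lambda>z. z) 0 * (deriv ^^ (Suc j - i)) G\<^sub>1 0)"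
        by (rule sum.mono_neutral_right) (auto simp: higher_deriv_ident)
      also have "\<dots> = of_nat (Suc j) * (deriv ^^ j) G\<^sub>1 0"
        by (simp add: higher_deriv_ident)
      finally show ?thesis
        unfolding taylor_coeff_def by (simp del: of_nat_Suc funpow.simps)
    qed
    have "gauss_moment \<gamma> G (Suc j) = of_nat (Suc j) / of_real \<gamma> * gauss_moment \<gamma> G\<^sub>1 j"
      using G\<^sub>1(4)[of "Suc j"] zero gauss_moment_times_z[OF G\<^sub>1(1,2) assms(3,4), of "Suc j"] \<gamma>
      by (simp add: field_simps)
    then show ?case
      using Suc.IH[OF G\<^sub>1(1,2)] by (simp add: coeff field_simps)
  }
qed

section \<open>Orthonormal expansions in the Fock space\<close>

lemma power_le_fact_mult_exp:
  fixes v :: real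
  assumes "0 \<le> v"
  shows "v ^ j \<le> fact j * exp v"
proof -
  have "(\<Sum>i\<in>{j}. inverse (fact i) * v ^ i) \<le> (\<Sum>i. inverse (fact i) * v ^ i)"
    using assms by (intro sum_le_suminf summable_exp) auto
  then have "v ^ j / fact j \<le> exp v"
    by (simp add: exp_def divide_inverse mult.commute)
  then show ?thesis
    by (simp add: pos_divide_le_eq mult.commute)
qed

text \<open>The \<open>j\<close>-th term of the exponential series for \<open>q |z|\<^sup>2\<close> is \<open>q\<^bsup>j\<^esup> |e\<^sub>j z|\<^sup>2\<close>.  This pointwise bound takes
  the place of Gamma function estimates throughout: it produces the factor \<open>sqrt (fact j)\<close> that the normalization
  of \<open>e\<^sub>j\<close> removes.\<close>

lemma fock_basis_growth:
  assumes "0 < q"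
  shows "cmod (fock_basis j z) \<le> (1 / sqrt q) ^ j * exp (q * (cmod z)\<^sup>2 / 2)"
proof -
  define v where "v = q * (cmod z)\<^sup>2"
  have v: "0 \<le> v" using assms by (simp add: v_def)
  have "v ^ j / fact j \<le> exp v"
    using power_le_fact_mult_exp[OF v, of j] by (simp add: pos_divide_le_eq mult.commute)
  then have "sqrt (v ^ j / fact j) \<le> sqrt (exp v)"
    by simp
  also have "sqrt (exp v) = exp (v / 2)"
    by (rule real_sqrt_unique) (simp_all add: power2_eq_square exp_add[symmetric])
  finally have *: "sqrt v ^ j / sqrt (fact j) \<le> exp (v / 2)"
    by (simp add: real_sqrt_divide real_sqrt_power)
  have "cmod (fock_basis j z) = cmod z ^ j / sqrt (fact j)"
    by (simp add: fock_basis_def norm_divide norm_power)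
  also have "cmod z = 1 / sqrt q * sqrt v"
    using assms by (simp add: v_def real_sqrt_mult)
  also have "(1 / sqrt q * sqrt v) ^ j / sqrt (fact j) = (1 / sqrt q) ^ j * (sqrt v ^ j / sqrt (fact j))"
    by (simp only: power_mult_distrib times_divide_eq_right)
  also have "\<dots> \<le> (1 / sqrt q) ^ j * exp (v / 2)"
    using assms * by (intro mult_left_mono) auto
  finally show ?thesis by (simp add: v_def)
qed

lemma fock_spaceI:
  assumes h: "h holomorphic_on UNIV" and le: "\<And>z. cmod (h z) \<le> D * exp (q * (cmod z)\<^sup>2 / 2)" and q: "q < 1"
  shows "h \<in> fock_space"
proof -
  have cont: "continuous_on UNIV (\<lambda>z. (cmod (h z))\<^sup>2)"
    using h by (intro continuous_intros holomorphic_on_imp_continuous_on)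
  have "integrable lborel (\<lambda>z. exp (- (cmod z)\<^sup>2) *\<^sub>R (cmod (h z))\<^sup>2)"
  proof (rule integrable_gaussian_bound)
    show "continuous_on UNIV (\<lambda>z. exp (- (cmod z)\<^sup>2) *\<^sub>R (cmod (h z))\<^sup>2)"
      by (intro continuous_intros cont)
    show "0 < 1 - q" using q by simp
    fix z
    have "(cmod (h z))\<^sup>2 \<le> (D * exp (q * (cmod z)\<^sup>2 / 2))\<^sup>2"
      using le[of z] by (intro power_mono) auto
    also have "\<dots> = D\<^sup>2 * exp (q * (cmod z)\<^sup>2)"
      by (simp add: power_mult_distrib exp_double[symmetric])
    finally have "exp (- (cmod z)\<^sup>2) * (cmod (h z))\<^sup>2 \<le> exp (- (cmod z)\<^sup>2) * (D\<^sup>2 * exp (q * (cmod z)\<^sup>2))"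
      by (intro mult_left_mono) auto
    also have "\<dots> = D\<^sup>2 * exp (- (cmod z)\<^sup>2 + q * (cmod z)\<^sup>2)"
      by (simp only: exp_add mult_ac)
    finally show "norm (exp (- (cmod z)\<^sup>2) *\<^sub>R (cmod (h z))\<^sup>2) \<le> D\<^sup>2 * exp (- (1 - q) * (cmod z)\<^sup>2)"
      by (simp add: algebra_simps)
  qed
  then show ?thesis
    using h integrable_gauss_measure_iff[OF cont] by (simp add: fock_space_def)
qed

lemma fock_space_add:
  assumes "h \<in> fock_space" "k \<in> fock_space"
  shows "(\<lambda>z. h z + k z) \<in> fock_space"
    and "(fock_norm (\<lambda>z. h z + k z))\<^sup>2 \<le> 2 * (fock_norm h)\<^sup>2 + 2 * (fock_norm k)\<^sup>2"
proof -
  have hk: "h holomorphic_on UNIV" "k holomorphic_on UNIV"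
    and int: "integrable gauss_measure (\<lambda>z. (cmod (h z))\<^sup>2)" "integrable gauss_measure (\<lambda>z. (cmod (k z))\<^sup>2)"
    using assms by (simp_all add: fock_space_def)
  have le: "(cmod (h z + k z))\<^sup>2 \<le> 2 * (cmod (h z))\<^sup>2 + 2 * (cmod (k z))\<^sup>2" for z
  proof -
    have "(cmod (h z + k z))\<^sup>2 \<le> (cmod (h z) + cmod (k z))\<^sup>2"
      by (intro power_mono norm_triangle_ineq) auto
    also have "\<dots> \<le> 2 * (cmod (h z))\<^sup>2 + 2 * (cmod (k z))\<^sup>2"
      using zero_le_power2[of "cmod (h z) - cmod (k z)"] by (simp add: power2_eq_square algebra_simps)
    finally show ?thesis .
  qed
  have hol: "(\<lambda>z. h z + k z) holomorphic_on UNIV"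
    using hk by (intro holomorphic_intros)
  have "(\<lambda>z. (cmod (h z + k z))\<^sup>2) \<in> borel_measurable borel"
    using hol by (intro borel_measurable_continuous_onI continuous_intros holomorphic_on_imp_continuous_on)
  then have meas: "(\<lambda>z. (cmod (h z + k z))\<^sup>2) \<in> borel_measurable gauss_measure"
    by (simp add: gauss_measure_def measurable_completion)
  have int': "integrable gauss_measure (\<lambda>z. (cmod (h z + k z))\<^sup>2)"
  proof (rule Bochner_Integration.integrable_bound)
    show "integrable gauss_measure (\<lambda>z. 2 * (cmod (h z))\<^sup>2 + 2 * (cmod (k z))\<^sup>2)"
      using int by simp
    show "AE z in gauss_measure. norm ((cmod (h z + k z))\<^sup>2) \<le> norm (2 * (cmod (h z))\<^sup>2 + 2 * (cmod (k z))\<^sup>2)"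
      using le by simp
  qed (rule meas)
  then show "(\<lambda>z. h z + k z) \<in> fock_space"
    using hol by (simp add: fock_space_def)
  have "(LINT z|gauss_measure. (cmod (h z + k z))\<^sup>2)
      \<le> (LINT z|gauss_measure. 2 * (cmod (h z))\<^sup>2 + 2 * (cmod (k z))\<^sup>2)"
    using int int' le by (intro integral_mono) auto
  then show "(fock_norm (\<lambda>z. h z + k z))\<^sup>2 \<le> 2 * (fock_norm h)\<^sup>2 + 2 * (fock_norm k)\<^sup>2"
    using int by (simp add: fock_norm_def)
qed

lemma fock_space_cmult:
  assumes "h \<in> fock_space"
  shows "(\<lambda>z. c * h z) \<in> fock_space" and "fock_norm (\<lambda>z. c * h z) = cmod c * fock_norm h"
  using assms
  by (auto simp: fock_space_def fock_norm_def norm_mult power_mult_distrib real_sqrt_mult intro!: holomorphic_intros)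

lemma fock_partial_sum_in_fock_space: "(\<lambda>z. \<Sum>j<N. a j * fock_basis j z) \<in> fock_space"
proof (induction N)
  case 0
  show ?case by (simp add: fock_space_def)
next
  case (Suc N)
  have "fock_basis N \<in> fock_space"
  proof (rule fock_spaceI)
    show "fock_basis N holomorphic_on UNIV"
      unfolding fock_basis_def by (intro holomorphic_intros) auto
    show "cmod (fock_basis N z) \<le> (1 / sqrt (1 / 2)) ^ N * exp (1 / 2 * (cmod z)\<^sup>2 / 2)" for z
      by (rule fock_basis_growth) simp
  qed simp
  then show ?case
    using fock_space_add(1)[OF Suc fock_space_cmult(1)] by simp
qed

lemma fock_norm_eq_0:
  assumes "h \<in> fock_space" "fock_norm h = 0"
  shows "h = (\<lambda>z. 0)"
proof -
  have hol: "h holomorphic_on UNIV" and int: "integrable gauss_measure (\<lambda>z. (cmod (h z))\<^sup>2)"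
    using assms(1) by (simp_all add: fock_space_def)
  have "(LINT z|gauss_measure. (cmod (h z))\<^sup>2) = 0"
    using assms(2) by (simp add: fock_norm_def)
  then have "AE z in gauss_measure. (cmod (h z))\<^sup>2 = 0"
    using int by (subst (asm) integral_nonneg_eq_0_iff_AE) auto
  then have "AE z in lebesgue. h z = 0"
    unfolding gauss_measure_def
    by (subst (asm) AE_density) (auto simp: measurable_completion)
  then show ?thesis
    using hol by (intro continuous_AE_eq_imp_eq) (auto intro: holomorphic_on_imp_continuous_on)
qed

text \<open>This is what gives the definite description in the extended Toeplitz operator its meaning.\<close>

lemma fock_sums_unique:
  assumes "fock_sums a h" "fock_sums a k"
  shows "h = k"
proof -
  define S where "S N z = (\<Sum>j<N. a j * fock_basis j z)" for N z
  have S: "S N \<in> fock_space" for N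
    unfolding S_def by (rule fock_partial_sum_in_fock_space)
  have h: "h \<in> fock_space" "(\<lambda>N. fock_norm (\<lambda>z. h z + (-1) * S N z)) \<longlonglongrightarrow> 0"
    and k: "k \<in> fock_space" "(\<lambda>N. fock_norm (\<lambda>z. k z + (-1) * S N z)) \<longlonglongrightarrow> 0"
    using assms by (simp_all add: fock_sums_def S_def)
  have hk: "(\<lambda>z. h z + (-1) * k z) \<in> fock_space"
    using h k by (intro fock_space_add fock_space_cmult)
  have "(fock_norm (\<lambda>z. h z + (-1) * k z))\<^sup>2 \<le> 0"
  proof (rule LIMSEQ_le_const)
    show "(\<lambda>N. 2 * (fock_norm (\<lambda>z. h z + (-1) * S N z))\<^sup>2 + 2 * (fock_norm (\<lambda>z. k z + (-1) * S N z))\<^sup>2) \<longlonglongrightarrow> 0"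
      using tendsto_add[OF tendsto_mult[OF tendsto_const tendsto_power[OF h(2), of 2]]
          tendsto_mult[OF tendsto_const tendsto_power[OF k(2), of 2]], of 2 2] by simp
    have "(fock_norm (\<lambda>z. h z + (-1) * k z))\<^sup>2
        \<le> 2 * (fock_norm (\<lambda>z. h z + (-1) * S N z))\<^sup>2 + 2 * (fock_norm (\<lambda>z. k z + (-1) * S N z))\<^sup>2" for N
    proof -
      have A: "(\<lambda>z. h z + (-1) * S N z) \<in> fock_space" and B: "(\<lambda>z. k z + (-1) * S N z) \<in> fock_space"
        using h k S by (intro fock_space_add fock_space_cmult; simp)+
      have "(\<lambda>z. (h z + (-1) * S N z) + (-1) * (k z + (-1) * S N z)) = (\<lambda>z. h z + (-1) * k z)"
        by auto
      then show ?thesis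
        using fock_space_add(2)[OF A fock_space_cmult(1)[OF B, of "-1"]] fock_space_cmult(2)[OF B, of "-1"] by simp
    qed
    then show "\<exists>M. \<forall>N\<ge>M. (fock_norm (\<lambda>z. h z + (-1) * k z))\<^sup>2
        \<le> 2 * (fock_norm (\<lambda>z. h z + (-1) * S N z))\<^sup>2 + 2 * (fock_norm (\<lambda>z. k z + (-1) * S N z))\<^sup>2"
      by blast
  qed
  then have "(\<lambda>z. h z + (-1) * k z) = (\<lambda>z. 0)"
    by (intro fock_norm_eq_0[OF hk]) simp
  then show ?thesis
    by (auto simp: fun_eq_iff)
qed

text \<open>Since \<open>|e\<^sub>j z| \<le> q\<^bsup>-j/2\<^esup> e\<^bsup>q|z|\<^sup>2/2\<^esup>\<close>, a series with coefficients \<open>O(q\<^bsup>j\<^esup>)\<close>, \<open>q < 1\<close>, has tails that are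
  geometrically small multiples of one square-integrable Gaussian.\<close>

lemma fock_sums_geometric:
  assumes q: "0 < q" "q < 1" and a: "\<And>j. cmod (a j) \<le> C * q ^ j"
  shows "\<exists>k. fock_sums a k \<and> (\<forall>z. (\<lambda>j. a j * fock_basis j z) sums k z)"
proof -
  define s where "s = sqrt q"
  have s: "0 < s" "s < 1" "q / s = s"
    using q by (simp_all add: s_def real_div_sqrt)
  have C: "0 \<le> C"
    using order_trans[OF norm_ge_zero a[of 0]] by simp
  define E where "E z = exp (q * (cmod z)\<^sup>2 / 2)" for z :: complex
  have term_le: "norm (a j * fock_basis j z) \<le> C * E z * s ^ j" for j z
  proof -
    have "norm (a j * fock_basis j z) \<le> (C * q ^ j) * ((1 / s) ^ j * E z)"
      unfolding norm_mult s_def E_def using C q by (intro mult_mono a fock_basis_growth) auto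
    also have "\<dots> = C * E z * (q / s) ^ j"
      by (simp add: power_divide)
    finally show ?thesis by (simp add: s(3))
  qed
  have geo: "summable (\<lambda>j. C * E z * s ^ j)" for z
    using s by (intro summable_mult summable_geometric) simp
  have sum: "summable (\<lambda>j. a j * fock_basis j z)" for z
    by (rule summable_comparison_test'[OF geo]) (rule term_le)
  define k where "k z = (\<Sum>j. a j * fock_basis j z)" for z
  have k: "(\<lambda>j. a j * fock_basis j z) sums k z" for z
    unfolding k_def using sum by (rule summable_sums)
  have tail: "cmod (k z - (\<Sum>j<N. a j * fock_basis j z)) \<le> C * s ^ N / (1 - s) * E z" for N z
  proof -
    have "(\<lambda>j. a (j + N) * fock_basis (j + N) z) sums (k z - (\<Sum>j<N. a j * fock_basis j z))"
      using sums_split_initial_segment[OF k] .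
    then have "k z - (\<Sum>j<N. a j * fock_basis j z) = (\<Sum>j. a (j + N) * fock_basis (j + N) z)"
      by (simp add: sums_iff)
    also have "norm \<dots> \<le> (\<Sum>j. C * E z * s ^ (j + N))"
      using geo[of z] term_le by (intro norm_suminf_le) (auto simp: summable_iff_shift[of "\<lambda>j. C * E z * s ^ j"])
    also have "\<dots> = (\<Sum>j. (C * E z * s ^ N) * s ^ j)"
      by (simp add: power_add mult_ac)
    also have "\<dots> = (C * E z * s ^ N) * (1 / (1 - s))"
      using s by (subst suminf_mult) (auto simp: suminf_geometric)
    finally show ?thesis by (simp add: mult_ac)
  qed
  have hol: "k holomorphic_on UNIV"
  proof -
    have "k holomorphic_on ball 0 R" for R
    proof (rule power_series_holomorphic)
      show "(\<lambda>j. a j / of_real (sqrt (fact j)) * (w - 0) ^ j) sums k w" for w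
        using k[of w] by (simp add: fock_basis_def)
    qed
    then have "k field_differentiable at z" for z
      by (rule holomorphic_on_imp_differentiable_at[of _ "ball 0 (cmod z + 1)"]) auto
    then show ?thesis
      by (simp add: holomorphic_on_def field_differentiable_at_within)
  qed
  have kf: "k \<in> fock_space"
    using tail[of _ 0] by (intro fock_spaceI[OF hol _ q(2), of "C / (1 - s)"]) (simp add: E_def)
  have expf: "integrable gauss_measure (\<lambda>z. (E z)\<^sup>2)"
  proof -
    have E2: "(E z)\<^sup>2 = exp (q * (cmod z)\<^sup>2)" for z
      by (simp add: E_def exp_double[symmetric])
    have cont: "continuous_on UNIV (\<lambda>z. (E z)\<^sup>2)"
      unfolding E_def by (intro continuous_intros) simp
    have "integrable lborel (\<lambda>z. exp (- (cmod z)\<^sup>2) *\<^sub>R (E z)\<^sup>2)"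
    proof (rule integrable_gaussian_bound)
      show "continuous_on UNIV (\<lambda>z. exp (- (cmod z)\<^sup>2) *\<^sub>R (E z)\<^sup>2)"
        by (intro continuous_intros cont)
      show "0 < 1 - q" using q by simp
      show "norm (exp (- (cmod z)\<^sup>2) *\<^sub>R (E z)\<^sup>2) \<le> 1 * exp (- (1 - q) * (cmod z)\<^sup>2)" for z
        by (simp add: E2 exp_add[symmetric] algebra_simps)
    qed
    then show ?thesis
      using integrable_gauss_measure_iff[OF cont] by simp
  qed
  have "(\<lambda>N. fock_norm (\<lambda>z. k z - (\<Sum>j<N. a j * fock_basis j z))) \<longlonglongrightarrow> 0"
  proof (rule Lim_null_comparison)
    define I where "I = sqrt (LINT z|gauss_measure. (E z)\<^sup>2)"
    have "fock_norm (\<lambda>z. k z - (\<Sum>j<N. a j * fock_basis j z)) \<le> C * s ^ N / (1 - s) * I" for N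
    proof -
      have "(\<lambda>z. k z + (-1) * (\<Sum>j<N. a j * fock_basis j z)) \<in> fock_space"
        using kf by (intro fock_space_add fock_space_cmult fock_partial_sum_in_fock_space)
      then have int: "integrable gauss_measure (\<lambda>z. (cmod (k z - (\<Sum>j<N. a j * fock_basis j z)))\<^sup>2)"
        by (simp add: fock_space_def)
      have "(LINT z|gauss_measure. (cmod (k z - (\<Sum>j<N. a j * fock_basis j z)))\<^sup>2)
          \<le> (LINT z|gauss_measure. (C * s ^ N / (1 - s))\<^sup>2 * (E z)\<^sup>2)"
      proof (rule integral_mono[OF int])
        show "integrable gauss_measure (\<lambda>z. (C * s ^ N / (1 - s))\<^sup>2 * (E z)\<^sup>2)"
          using expf by simp
        show "(cmod (k z - (\<Sum>j<N. a j * fock_basis j z)))\<^sup>2 \<le> (C * s ^ N / (1 - s))\<^sup>2 * (E z)\<^sup>2" for z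
          unfolding power_mult_distrib[symmetric] using tail by (intro power_mono) auto
      qed
      also have "\<dots> = (C * s ^ N / (1 - s))\<^sup>2 * (LINT z|gauss_measure. (E z)\<^sup>2)"
        by simp
      finally have "fock_norm (\<lambda>z. k z - (\<Sum>j<N. a j * fock_basis j z))
          \<le> sqrt ((C * s ^ N / (1 - s))\<^sup>2 * (LINT z|gauss_measure. (E z)\<^sup>2))"
        unfolding fock_norm_def by (rule real_sqrt_le_mono)
      also have "\<dots> = C * s ^ N / (1 - s) * I"
        using C s by (simp add: real_sqrt_mult I_def real_sqrt_abs)
      finally show ?thesis .
    qed
    moreover have "0 \<le> fock_norm h" for h
      by (simp add: fock_norm_def)
    ultimately show "\<forall>\<^sub>F N in sequentially. norm (fock_norm (\<lambda>z. k z - (\<Sum>j<N. a j * fock_basis j z))) \<le> C * s ^ N / (1 - s) * I"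
      by simp
    have "(\<lambda>N. C / (1 - s) * I * s ^ N) \<longlonglongrightarrow> 0"
      using s by (intro tendsto_mult_right_zero LIMSEQ_power_zero) auto
    then show "(\<lambda>N. C * s ^ N / (1 - s) * I) \<longlonglongrightarrow> 0"
      by (simp add: mult_ac)
  qed
  with kf k show ?thesis
    by (auto simp: fock_sums_def)
qed

text \<open>All Toeplitz operators below are evaluated through this criterion: geometric decay of the coefficients yields
  membership in the domain and a pointwise formula for the value.\<close>

lemma toeplitz_geometric:
  assumes q: "0 < q" "q < 1" and a: "\<And>j. cmod (toeplitz_coeff u h j) \<le> C * q ^ j"
  shows "summable (\<lambda>j. (cmod (toeplitz_coeff u h j))\<^sup>2)"
    and "(\<lambda>j. toeplitz_coeff u h j * fock_basis j z) sums toeplitz u h z"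
    and "toeplitz u h \<in> fock_space"
proof -
  obtain k where k: "fock_sums (toeplitz_coeff u h) k" "\<forall>z. (\<lambda>j. toeplitz_coeff u h j * fock_basis j z) sums k z"
    using fock_sums_geometric[OF q a] by blast
  have "toeplitz u h = k"
    unfolding toeplitz_def
  proof (rule the_equality)
    show "fock_sums (toeplitz_coeff u h) k" by (rule k(1))
    show "k' = k" if "fock_sums (toeplitz_coeff u h) k'" for k'
      using that k(1) by (rule fock_sums_unique)
  qed
  with k show "(\<lambda>j. toeplitz_coeff u h j * fock_basis j z) sums toeplitz u h z"
    and "toeplitz u h \<in> fock_space"
    by (auto simp: fock_sums_def)
  show "summable (\<lambda>j. (cmod (toeplitz_coeff u h j))\<^sup>2)"
  proof (rule summable_comparison_test')
    show "summable (\<lambda>j. C\<^sup>2 * (q\<^sup>2) ^ j)"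
      using q by (intro summable_mult summable_geometric) (simp add: abs_square_less_1)
    show "norm ((cmod (toeplitz_coeff u h j))\<^sup>2) \<le> C\<^sup>2 * (q\<^sup>2) ^ j" for j
      using power_mono[OF a[of j], of 2] by (simp add: power_mult_distrib power_mult[symmetric] mult.commute)
  qed
qed

section \<open>Smoothness\<close>

lemma k_smooth_add:
  assumes "k_smooth k f" "k_smooth k g"
  shows "k_smooth k (\<lambda>z. f z + g z)"
  using assms
proof (induction k arbitrary: f g)
  case 0
  then show ?case by (auto intro: continuous_on_add)
next
  case (Suc k)
  have d: "f differentiable (at z)" "g differentiable (at z)" for z
    using Suc.prems by auto
  have "frechet_derivative (\<lambda>z. f z + g z) (at z) = (\<lambda>v. frechet_derivative f (at z) v + frechet_derivative g (at z) v)" for z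
    using d[of z] by (intro frechet_derivative_at[symmetric] has_derivative_add)
      (simp_all add: frechet_derivative_works)
  then show ?case
    using Suc d by (auto intro: differentiable_add)
qed

text \<open>The real derivative of a product \<open>\<Psi> (Re z) \<Phi> (Im z) E z\<close> of holomorphic functions is a sum of
  three products of the same form.\<close>

lemma k_smooth_product:
  assumes U: "open U" "\<And>x::real. of_real x \<in> U" 
    and "\<Psi> holomorphic_on U" "\<Phi> holomorphic_on U" "E holomorphic_on UNIV"
  shows "k_smooth k (\<lambda>z. \<Psi> (of_real (Re z)) * \<Phi> (of_real (Im z)) * E z)"
  using assms(3-)
proof (induction k arbitrary: \<Psi> \<Phi> E)
  case 0
  have "continuous_on UNIV (\<lambda>z. \<Psi> (of_real (Re z)))"
    by (rule continuous_on_compose2[OF holomorphic_on_imp_continuous_on[OF 0(1)]])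
       (auto intro!: continuous_intros U(2))
  moreover have "continuous_on UNIV (\<lambda>z. \<Phi> (of_real (Im z)))"
    by (rule continuous_on_compose2[OF holomorphic_on_imp_continuous_on[OF 0(2)]])
       (auto intro!: continuous_intros U(2))
  moreover have "continuous_on UNIV E"
    using 0(3) by (rule holomorphic_on_imp_continuous_on)
  ultimately show ?case
    by (simp add: continuous_on_mult)
next
  case (Suc k)
  let ?f = "\<lambda>z. \<Psi> (of_real (Re z)) * \<Phi> (of_real (Im z)) * E z"
  define D where "D z v = deriv \<Psi> (of_real (Re z)) * \<Phi> (of_real (Im z)) * (of_real (Re v) * E z)
      + \<Psi> (of_real (Re z)) * deriv \<Phi> (of_real (Im z)) * (of_real (Im v) * E z)
      + \<Psi> (of_real (Re z)) * \<Phi> (of_real (Im z)) * (v * deriv E z)" for z v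
  have D: "(?f has_derivative D z) (at z)" for z
  proof -
    have d\<Psi>: "(\<Psi> has_field_derivative deriv \<Psi> (of_real (Re z))) (at (of_real (Re z)))"
      and d\<Phi>: "(\<Phi> has_field_derivative deriv \<Phi> (of_real (Im z))) (at (of_real (Im z)))"
      using Suc.prems U by (auto intro: holomorphic_derivI)
    have dE: "(E has_field_derivative deriv E z) (at z)"
      using Suc.prems by (auto intro: holomorphic_derivI)
    have Re: "((\<lambda>z. complex_of_real (Re z)) has_derivative (\<lambda>v. of_real (Re v))) (at z)"
      and Im: "((\<lambda>z. complex_of_real (Im z)) has_derivative (\<lambda>v. of_real (Im v))) (at z)"
      by (intro derivative_intros)+
    have 1: "((\<lambda>z. \<Psi> (of_real (Re z))) has_derivative (\<lambda>v. deriv \<Psi> (of_real (Re z)) * of_real (Re v))) (at z)"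
      using has_derivative_compose[OF Re has_field_derivative_imp_has_derivative[OF d\<Psi>]] .
    have 2: "((\<lambda>z. \<Phi> (of_real (Im z))) has_derivative (\<lambda>v. deriv \<Phi> (of_real (Im z)) * of_real (Im v))) (at z)"
      using has_derivative_compose[OF Im has_field_derivative_imp_has_derivative[OF d\<Phi>]] .
    show ?thesis
      by (rule has_derivative_eq_rhs[OF has_derivative_mult[OF has_derivative_mult[OF 1 2]
            has_field_derivative_imp_has_derivative[OF dE]]])
         (simp add: D_def fun_eq_iff algebra_simps)
  qed
  have "frechet_derivative ?f (at z) = D z" for z
    using frechet_derivative_at[OF D] by simp
  moreover have "k_smooth k (\<lambda>z. D z v)" for v
    unfolding D_def using Suc.prems U(1)
    by (intro k_smooth_add Suc.IH holomorphic_intros holomorphic_deriv) auto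
  ultimately show ?case
    using D by (auto simp: differentiable_def)
qed

section \<open>Toeplitz coefficients\<close>

lemma toeplitz_coeff_eq_integral:
  assumes "continuous_on UNIV u" "continuous_on UNIV h"
    and int: "integrable lborel (\<lambda>z. exp (- (cmod z)\<^sup>2) *\<^sub>R (u z * h z * cnj z ^ j))"
  shows "integrable gauss_measure (\<lambda>z. u z * h z * cnj (fock_basis j z))"
    and "toeplitz_coeff u h j =
      (\<integral>z. exp (- (cmod z)\<^sup>2) *\<^sub>R (u z * h z * cnj z ^ j) \<partial>lborel) / of_real (pi * sqrt (fact j))"
proof -
  have cont: "continuous_on UNIV (\<lambda>z. u z * h z * cnj (fock_basis j z))"
    unfolding fock_basis_def by (intro continuous_intros assms(1,2)) simp
  have eq: "exp (- (cmod z)\<^sup>2) *\<^sub>R (u z * h z * cnj (fock_basis j z))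
      = (exp (- (cmod z)\<^sup>2) *\<^sub>R (u z * h z * cnj z ^ j)) / of_real (sqrt (fact j))" for z
    by (simp add: fock_basis_def scaleR_conv_of_real)
  show "integrable gauss_measure (\<lambda>z. u z * h z * cnj (fock_basis j z))"
    unfolding integrable_gauss_measure_iff[OF cont] eq using int by (rule integrable_divide_zero)
  show "toeplitz_coeff u h j =
      (\<integral>z. exp (- (cmod z)\<^sup>2) *\<^sub>R (u z * h z * cnj z ^ j) \<partial>lborel) / of_real (pi * sqrt (fact j))"
    unfolding toeplitz_coeff_def integral_gauss_measure[OF cont] eq integral_divide_zero
    by (simp add: scaleR_conv_of_real field_simps)
qed

text \<open>A Bochner integral that does not exist is \<open>0\<close>.  Iterated integrals can therefore be bounded without first
  proving that the inner integral is a measurable function of the outer variable.\<close>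

lemma norm_integral_le:
  fixes f :: "'a \<Rightarrow> 'b::{banach, second_countable_topology}"
  assumes "integrable M g" and "\<And>x. norm (f x) \<le> g x"
  shows "norm (integral\<^sup>L M f) \<le> integral\<^sup>L M g"
proof (cases "integrable M f")
  case True
  then show ?thesis
    using assms by (intro order_trans[OF integral_norm_bound] integral_mono) auto
next
  case False
  then show ?thesis
    using assms order_trans[OF norm_ge_zero] by (auto simp: not_integrable_integral_eq intro!: integral_nonneg_AE)
qed

lemma gauss_bounded_const: "gauss_bounded 0 (\<lambda>z. c)"
  unfolding gauss_bounded_def by (intro exI[of _ "cmod c"]) simp

lemma fock_space_gauss_bounded:
  assumes "h holomorphic_on UNIV" "gauss_bounded \<tau> h" "\<tau> < 1 / 2"
  shows "h \<in> fock_space"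
proof -
  obtain C where "\<And>z. cmod (h z) \<le> C * exp (\<tau> * (cmod z)\<^sup>2)"
    using gauss_boundedD[OF assms(2)] by blast
  then show ?thesis
    using assms(3) by (intro fock_spaceI[OF assms(1), of C "2 * \<tau>"]) simp_all
qed

lemma gauss_bounded_poly:
  assumes "0 < \<tau>"
  shows "gauss_bounded \<tau> (poly p)"
  using gauss_bounded_poly_mult[OF gauss_bounded_const[of 1] assms, of p] by simp

lemma poly_in_fock_space: "poly p \<in> fock_space"
  by (rule fock_space_gauss_bounded[OF _ gauss_bounded_poly[of "1 / 4"]]) (auto intro: holomorphic_intros)

section \<open>Symbols that map polynomials to polynomial multiples of a Gaussian\<close>

text \<open>With \<open>l = 0\<close> the symbol is entire and its Toeplitz operator is multiplication on polynomials.  Raising \<open>l\<close> to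
  \<open>\<sigma>\<close> makes the symbol bounded, at the price of a dilation by \<open>1 / (1 + l)\<close>, which lowers the rate of the resulting
  Gaussian from \<open>\<sigma>\<close> to \<open>\<sigma> / (1 + l)\<^sup>2\<close>.\<close>

definition gaussian_symbol :: "real \<Rightarrow> real \<Rightarrow> complex \<Rightarrow> complex" where
  "gaussian_symbol \<sigma> l z = exp (of_real \<sigma> * z\<^sup>2 - of_real (l * (cmod z)\<^sup>2))"

lemma Re_square_le: "Re (z\<^sup>2) \<le> (cmod z)\<^sup>2"
  by (simp add: cmod_power2 power2_eq_square[of z] power2_eq_square[of "Re z"] power2_eq_square[of "Im z"])

lemma norm_gaussian_symbol_le:
  assumes "0 \<le> \<sigma>"
  shows "cmod (gaussian_symbol \<sigma> l z) \<le> exp ((\<sigma> - l) * (cmod z)\<^sup>2)"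
proof -
  have "cmod (gaussian_symbol \<sigma> l z) = exp (\<sigma> * Re (z\<^sup>2) - l * (cmod z)\<^sup>2)"
    by (simp add: gaussian_symbol_def)
  also have "\<dots> \<le> exp ((\<sigma> - l) * (cmod z)\<^sup>2)"
    using mult_left_mono[OF Re_square_le assms, of z] by (simp add: left_diff_distrib)
  finally show ?thesis .
qed

lemma continuous_gaussian_symbol: "continuous_on A (gaussian_symbol \<sigma> l)"
  unfolding gaussian_symbol_def by (intro continuous_intros)

lemma smooth_gaussian_symbol: "smooth (gaussian_symbol \<sigma> l)"
proof -
  have "gaussian_symbol \<sigma> l z = exp (- of_real l * (of_real (Re z))\<^sup>2) * exp (- of_real l * (of_real (Im z))\<^sup>2) * exp (of_real \<sigma> * z\<^sup>2)" for z
    by (simp add: gaussian_symbol_def exp_add[symmetric] cmod_power2 algebra_simps)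
  moreover have "k_smooth k (\<lambda>z. exp (- of_real l * (of_real (Re z))\<^sup>2) * exp (- of_real l * (of_real (Im z))\<^sup>2) * exp (of_real \<sigma> * z\<^sup>2))" for k
    by (rule k_smooth_product[where U = UNIV and \<Psi> = "\<lambda>w. exp (- of_real l * w\<^sup>2)" and \<Phi> = "\<lambda>w. exp (- of_real l * w\<^sup>2)"])
       (auto intro!: holomorphic_intros)
  ultimately show ?thesis
    unfolding smooth_def by presburger
qed

lemma not_radial_gaussian_symbol:
  assumes "0 < \<sigma>"
  shows "\<not> radial (gaussian_symbol \<sigma> l)"
proof
  assume "radial (gaussian_symbol \<sigma> l)"
  then have "gaussian_symbol \<sigma> l (\<i> * 1) = gaussian_symbol \<sigma> l 1"
    by (rule radial_imp_quarter_turn[OF continuous_gaussian_symbol])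
  then have "cmod (gaussian_symbol \<sigma> l \<i>) = cmod (gaussian_symbol \<sigma> l 1)"
    by simp
  then show False
    using assms by (simp add: gaussian_symbol_def)
qed

lemma gaussian_symbol_in_growth_class:
  assumes "0 \<le> \<sigma>" "\<sigma> - l \<le> c"
  shows "gaussian_symbol \<sigma> l \<in> growth_class c"
proof -
  have "cmod (complex_of_real (exp (- c * (cmod z)\<^sup>2)) * gaussian_symbol \<sigma> l z) \<le> 1" for z
  proof -
    have "cmod (gaussian_symbol \<sigma> l z) \<le> exp (c * (cmod z)\<^sup>2)"
      using assms by (intro order_trans[OF norm_gaussian_symbol_le]) (auto intro: mult_right_mono)
    then have "exp (- c * (cmod z)\<^sup>2) * cmod (gaussian_symbol \<sigma> l z) \<le> exp (- c * (cmod z)\<^sup>2) * exp (c * (cmod z)\<^sup>2)"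
      by (intro mult_left_mono) auto
    then show ?thesis
      by (simp add: norm_mult exp_add[symmetric])
  qed
  moreover have "gaussian_symbol \<sigma> l \<in> borel_measurable lebesgue"
    by (intro measurable_completion) (simp add: borel_measurable_continuous_onI continuous_gaussian_symbol)
  ultimately show ?thesis
    by (auto simp: growth_class_def)
qed

lemma gauss_moment_1_neq_0:
  assumes "0 < \<gamma>"
  shows "gauss_moment \<gamma> (\<lambda>z. 1) 0 \<noteq> 0"
proof
  assume "gauss_moment \<gamma> (\<lambda>z. 1) 0 = 0"
  then have "complex_of_real (\<integral>z. exp (- \<gamma> * (cmod z)\<^sup>2) \<partial>(lborel :: complex measure)) = 0"
    unfolding gauss_moment_def by (subst integral_complex_of_real[symmetric]) (simp add: scaleR_conv_of_real)
  then have "(\<integral>z. exp (- \<gamma> * (cmod z)\<^sup>2) \<partial>(lborel :: complex measure)) = 0"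
    by (simp only: of_real_eq_0_iff)
  moreover have "integrable lborel (\<lambda>z::complex. exp (- \<gamma> * (cmod z)\<^sup>2))"
    by (rule integrable_gaussian_bound[OF _ assms, of _ 1]) (auto intro!: continuous_intros)
  ultimately have "AE z in lborel. exp (- \<gamma> * (cmod (z::complex))\<^sup>2) = 0"
    by (subst (asm) integral_nonneg_eq_0_iff_AE) auto
  then have "AE z::complex in lborel. False"
    by simp
  then show False
    by (simp add: trivial_limit_def[symmetric] ae_filter_eq_bot_iff)
qed

definition gauss_poly :: "real \<Rightarrow> complex poly \<Rightarrow> complex \<Rightarrow> complex" where
  "gauss_poly \<sigma> p z = exp (of_real \<sigma> * z\<^sup>2) * poly p z"

lemma holomorphic_gauss_poly: "gauss_poly \<sigma> p holomorphic_on UNIV"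
  unfolding gauss_poly_def by (intro holomorphic_intros)

context
  fixes \<sigma> l :: real
  assumes \<sigma>: "0 \<le> \<sigma>" and l: "0 \<le> l" and \<sigma>l: "\<sigma> < l + 1 / 2"
begin

lemma gauss_bounded_gauss_poly:
  assumes "\<sigma> < \<tau>"
  shows "gauss_bounded \<tau> (gauss_poly \<sigma> p)"
proof -
  have "cmod (exp (of_real \<sigma> * z\<^sup>2)) \<le> 1 * exp (\<sigma> * (cmod z)\<^sup>2)" for z
    using mult_left_mono[OF Re_square_le \<sigma>, of z] by simp
  then have "gauss_bounded \<sigma> (\<lambda>z. exp (of_real \<sigma> * z\<^sup>2))"
    unfolding gauss_bounded_def by blast
  then show ?thesis
    unfolding gauss_poly_def using assms by (rule gauss_bounded_poly_mult)
qed

lemma gaussian_symbol_integrand: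
  "exp (- (cmod z)\<^sup>2) *\<^sub>R (gaussian_symbol \<sigma> l z * poly p z * cnj z ^ j)
    = exp (- (1 + l) * (cmod z)\<^sup>2) *\<^sub>R (gauss_poly \<sigma> p z * cnj z ^ j)"
proof -
  have "complex_of_real (exp (- (cmod z)\<^sup>2)) * gaussian_symbol \<sigma> l z
      = complex_of_real (exp (- (1 + l) * (cmod z)\<^sup>2)) * exp (of_real \<sigma> * z\<^sup>2)"
    by (simp add: gaussian_symbol_def exp_of_real[symmetric] exp_add[symmetric] algebra_simps)
  then show ?thesis
    unfolding scaleR_conv_of_real gauss_poly_def by (metis (no_types, opaque_lifting) mult.assoc)
qed

lemma gaussian_symbol_coeff:
  shows "integrable gauss_measure (\<lambda>z. gaussian_symbol \<sigma> l z * poly p z * cnj (fock_basis j z))"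
    and "toeplitz_coeff (gaussian_symbol \<sigma> l) (poly p) j = gauss_moment (1 + l) (gauss_poly \<sigma> p) j / of_real (pi * sqrt (fact j))"
proof -
  define \<tau> where "\<tau> = (\<sigma> + (1 + l)) / 2"
  have \<tau>: "\<sigma> < \<tau>" "\<tau> < 1 + l"
    using \<sigma>l by (auto simp: \<tau>_def field_simps)
  have int: "integrable lborel (\<lambda>z. exp (- (cmod z)\<^sup>2) *\<^sub>R (gaussian_symbol \<sigma> l z * poly p z * cnj z ^ j))"
    unfolding gaussian_symbol_integrand
    by (intro integrable_gauss_moment[OF _ gauss_bounded_gauss_poly \<tau>(2)] holomorphic_on_imp_continuous_on holomorphic_gauss_poly \<tau>)
  show "integrable gauss_measure (\<lambda>z. gaussian_symbol \<sigma> l z * poly p z * cnj (fock_basis j z))"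
    by (intro toeplitz_coeff_eq_integral(1)[OF _ _ int] continuous_gaussian_symbol continuous_intros)
  show "toeplitz_coeff (gaussian_symbol \<sigma> l) (poly p) j = gauss_moment (1 + l) (gauss_poly \<sigma> p) j / of_real (pi * sqrt (fact j))"
    by (subst toeplitz_coeff_eq_integral(2)[OF _ _ int])
       (auto intro!: continuous_gaussian_symbol continuous_intros simp only: gaussian_symbol_integrand gauss_moment_def)
qed

text \<open>The hypothesis \<open>\<sigma> < l + 1 / 2\<close> leaves room for a rate \<open>\<delta> > 1 / 2\<close> with \<open>\<sigma> + \<delta> < 1 + l\<close>.  The part
  \<open>exp (- \<delta> |z|\<^sup>2) |z|\<^bsup>j\<^esup>\<close> of the integrand is at most \<open>sqrt (fact j) (2 \<delta>)\<^bsup>-j/2\<^esup>\<close>, and \<open>2 \<delta> > 1\<close>.\<close>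

lemma gaussian_symbol_coeff_bound: "\<exists>C q. 0 < q \<and> q < 1 \<and> (\<forall>j. cmod (toeplitz_coeff (gaussian_symbol \<sigma> l) (poly p) j) \<le> C * q ^ j)"
proof -
  define \<eta> where "\<eta> = (l + 1 / 2 - \<sigma>) / 3"
  have \<eta>: "0 < \<eta>" using \<sigma>l by (simp add: \<eta>_def)
  define \<delta> where "\<delta> = 1 / 2 + \<eta>"
  define q where "q = 1 / sqrt (2 * \<delta>)"
  have q: "0 < q" "q < 1" "0 < \<delta>"
    using \<eta> by (auto simp: q_def \<delta>_def)
  have "\<sigma> + \<eta> < 1 + l - \<delta>"
  proof -
    have "3 * \<eta> = l + 1 / 2 - \<sigma>"
      by (simp add: \<eta>_def)
    then show ?thesis
      using \<eta> by (simp add: \<delta>_def)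
  qed
  then obtain D where D: "\<And>z. (1 + cmod z) ^ 0 * cmod (gauss_poly \<sigma> p z) * exp (- (1 + l - \<delta>) * (cmod z)\<^sup>2) \<le> D * plane_weight z"
    using gaussian_decay[OF gauss_bounded_gauss_poly[of "\<sigma> + \<eta>"], of "1 + l - \<delta>" 0] \<eta> by auto
  have le: "norm (exp (- (1 + l) * (cmod z)\<^sup>2) *\<^sub>R (gauss_poly \<sigma> p z * cnj z ^ j)) \<le> sqrt (fact j) * q ^ j * D * plane_weight z" for z j
  proof -
    have "cmod z ^ j / sqrt (fact j) \<le> q ^ j * exp (\<delta> * (cmod z)\<^sup>2)"
      using fock_basis_growth[of "2 * \<delta>" j z] q(3) by (simp add: q_def fock_basis_def norm_divide norm_power)
    then have z: "cmod z ^ j \<le> sqrt (fact j) * q ^ j * exp (\<delta> * (cmod z)\<^sup>2)"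
      by (simp add: field_simps)
    have "norm (exp (- (1 + l) * (cmod z)\<^sup>2) *\<^sub>R (gauss_poly \<sigma> p z * cnj z ^ j))
        = exp (- (1 + l) * (cmod z)\<^sup>2) * (cmod (gauss_poly \<sigma> p z) * cmod z ^ j)"
      by (simp add: norm_mult norm_power)
    also have "\<dots> \<le> exp (- (1 + l) * (cmod z)\<^sup>2) * (cmod (gauss_poly \<sigma> p z) * (sqrt (fact j) * q ^ j * exp (\<delta> * (cmod z)\<^sup>2)))"
      using z by (intro mult_left_mono) auto
    also have "\<dots> = sqrt (fact j) * q ^ j * (cmod (gauss_poly \<sigma> p z) * exp (- (1 + l) * (cmod z)\<^sup>2 + \<delta> * (cmod z)\<^sup>2))"
      by (simp only: exp_add mult_ac)
    also have "- (1 + l) * (cmod z)\<^sup>2 + \<delta> * (cmod z)\<^sup>2 = - (1 + l - \<delta>) * (cmod z)\<^sup>2"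
      by (simp add: algebra_simps)
    also have "sqrt (fact j) * q ^ j * (cmod (gauss_poly \<sigma> p z) * exp (- (1 + l - \<delta>) * (cmod z)\<^sup>2)) \<le> sqrt (fact j) * q ^ j * (D * plane_weight z)"
      using D[of z] q by (intro mult_left_mono) auto
    finally show ?thesis by (simp add: mult_ac)
  qed
  define J where "J = (\<integral>z. plane_weight z \<partial>lborel)"
  have "cmod (toeplitz_coeff (gaussian_symbol \<sigma> l) (poly p) j) \<le> (D * J / pi) * q ^ j" for j
  proof -
    have "cmod (gauss_moment (1 + l) (gauss_poly \<sigma> p) j) \<le> (\<integral>z. sqrt (fact j) * q ^ j * D * plane_weight z \<partial>lborel)"
      unfolding gauss_moment_def
      by (rule norm_integral_le[OF _ le]) (intro integrable_mult_right integrable_plane_weight)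
    then have "cmod (gauss_moment (1 + l) (gauss_poly \<sigma> p) j) / (pi * sqrt (fact j)) \<le> (sqrt (fact j) * q ^ j * D * J) / (pi * sqrt (fact j))"
      unfolding J_def by (intro divide_right_mono) auto
    then show ?thesis
      unfolding gaussian_symbol_coeff by (simp add: norm_divide norm_mult field_simps)
  qed
  with q show ?thesis by blast
qed

lemma poly_in_toeplitz_dom_gaussian_symbol: "poly p \<in> toeplitz_dom (gaussian_symbol \<sigma> l)"
proof -
  obtain C q where q: "0 < q" "q < 1" "\<And>j. cmod (toeplitz_coeff (gaussian_symbol \<sigma> l) (poly p) j) \<le> C * q ^ j"
    using gaussian_symbol_coeff_bound by blast
  show ?thesis
    using toeplitz_geometric(1)[OF q] gaussian_symbol_coeff(1) poly_in_fock_space by (simp add: toeplitz_dom_def)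
qed

text \<open>By the moment formula the expansion coefficients are, up to a constant, the Taylor coefficients of
  \<open>exp (\<sigma> z\<^sup>2) p z\<close> divided by powers of \<open>1 + l\<close>.\<close>

lemma toeplitz_gaussian_symbol:
  "toeplitz (gaussian_symbol \<sigma> l) (poly p) z = gauss_moment (1 + l) (\<lambda>z. 1) 0 / of_real pi * 
     (exp (of_real \<sigma> * (z / of_real (1 + l))\<^sup>2) * poly p (z / of_real (1 + l)))"
proof -
  define M where "M = gauss_moment (1 + l) (\<lambda>z. 1) 0"
  define \<tau> where "\<tau> = (\<sigma> + (1 + l)) / 2"
  have \<tau>: "\<sigma> < \<tau>" "\<tau> < 1 + l" "0 \<le> \<tau>"
    using \<sigma>l \<sigma> l by (auto simp: \<tau>_def field_simps)
  obtain C q where q: "0 < q" "q < 1" "\<And>j. cmod (toeplitz_coeff (gaussian_symbol \<sigma> l) (poly p) j) \<le> C * q ^ j"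
    using gaussian_symbol_coeff_bound by blast
  define w where "w = z / of_real (1 + l)"
  have "toeplitz_coeff (gaussian_symbol \<sigma> l) (poly p) j * fock_basis j z
      = M / of_real pi * ((deriv ^^ j) (gauss_poly \<sigma> p) 0 / fact j * (w - 0) ^ j)" for j
  proof -
    have ss: "complex_of_real (sqrt (fact j)) * complex_of_real (sqrt (fact j)) = fact j"
      unfolding of_real_mult[symmetric] by simp
    have "toeplitz_coeff (gaussian_symbol \<sigma> l) (poly p) j * fock_basis j z 
       = (fact j / of_real (1 + l) ^ j * taylor_coeff (gauss_poly \<sigma> p) j * M) * z ^ j / (of_real pi * (complex_of_real (sqrt (fact j)) * complex_of_real (sqrt (fact j))))"
      unfolding gaussian_symbol_coeff gauss_moment_eq_taylor_coeff[OF holomorphic_gauss_poly gauss_bounded_gauss_poly[OF \<tau>(1)] \<tau>(3,2)] M_def fock_basis_def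
      by simp
    then show ?thesis
      unfolding ss by (simp add: taylor_coeff_def w_def power_divide mult_ac)
  qed
  moreover have "(\<lambda>j. M / of_real pi * ((deriv ^^ j) (gauss_poly \<sigma> p) 0 / fact j * (w - 0) ^ j)) sums (M / of_real pi * gauss_poly \<sigma> p w)"
    by (intro sums_mult holomorphic_power_series[where r = "cmod w + 1"] holomorphic_on_subset[OF holomorphic_gauss_poly]) auto
  ultimately have "(\<lambda>j. toeplitz_coeff (gaussian_symbol \<sigma> l) (poly p) j * fock_basis j z) sums (M / of_real pi * gauss_poly \<sigma> p w)"
    by simp
  then have "toeplitz (gaussian_symbol \<sigma> l) (poly p) z = M / of_real pi * gauss_poly \<sigma> p w"
    using toeplitz_geometric(2)[OF q] by (rule sums_unique2[rotated])
  then show ?thesis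
    by (simp add: gauss_poly_def w_def M_def)
qed

lemma toeplitz_gaussian_symbol_in_fock_space: "toeplitz (gaussian_symbol \<sigma> l) (poly p) \<in> fock_space"
proof -
  obtain C q where "0 < q" "q < 1" "\<And>j. cmod (toeplitz_coeff (gaussian_symbol \<sigma> l) (poly p) j) \<le> C * q ^ j"
    using gaussian_symbol_coeff_bound by blast
  then show ?thesis
    by (rule toeplitz_geometric(3))
qed

lemma toeplitz_nonzero_gaussian_symbol: "toeplitz_nonzero (gaussian_symbol \<sigma> l)"
proof -
  have "toeplitz (gaussian_symbol \<sigma> l) (poly 1) 0 \<noteq> 0"
    unfolding toeplitz_gaussian_symbol using gauss_moment_1_neq_0[of "1 + l"] l by simp
  then have "toeplitz (gaussian_symbol \<sigma> l) (poly 1) \<noteq> (\<lambda>z. 0)"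
    by auto
  then show ?thesis
    using poly_in_toeplitz_dom_gaussian_symbol unfolding toeplitz_nonzero_def by blast
qed

end

section \<open>A function with vanishing moments on the line\<close>

text \<open>On the closed upper half-plane \<open>1 - \<i> t w\<close> has real part at least \<open>1\<close>, so its principal square root has argument at
  most \<open>\<pi> / 4\<close> in absolute value and the function decays like \<open>exp (- C sqrt |w|)\<close>.  That is faster than every power, yet
  slow enough for all moments to vanish; a function on the line with Gaussian, or even exponential, decay and vanishing
  moments is zero.  The parameter \<open>t\<close> is a scaling that is used to make the Toeplitz operator nonzero.\<close>

definition moment_free :: "real \<Rightarrow> complex \<Rightarrow> complex" where
  "moment_free t w = exp (- csqrt (1 - \<i> * of_real t * w))"

lemma holomorphic_moment_free:
  assumes "0 < t"
  shows "moment_free t holomorphic_on {w. - (1 / t) < Im w}"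
proof -
  have "1 - \<i> * of_real t * w \<notin> \<real>\<^sub>\<le>\<^sub>0" if "- (1 / t) < Im w" for w
  proof
    assume "1 - \<i> * of_real t * w \<in> \<real>\<^sub>\<le>\<^sub>0"
    then have "1 + t * Im w \<le> 0"
      by (simp add: complex_nonpos_Reals_iff)
    moreover have "0 < 1 + t * Im w"
      using assms that by (simp add: field_simps)
    ultimately show False by simp
  qed
  then show ?thesis
    unfolding moment_free_def by (intro holomorphic_intros) auto
qed

lemma norm_moment_free_le_1: "cmod (moment_free t w) \<le> 1"
  using Re_csqrt[of "1 - \<i> * of_real t * w"] by (simp add: moment_free_def)

lemma moment_free_decay:
  assumes t: "0 < t"
  shows "\<exists>C>0. \<forall>z. 0 \<le> Im z \<longrightarrow> cmod (moment_free t z) * (1 + cmod z) ^ N \<le> C"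
proof -
  define K where "K = 1 + 1 / t"
  define C where "C = (2 * K) ^ N * (fact (2 * N) * exp 1)"
  have K: "0 < K" using t by (simp add: K_def add_pos_pos)
  have "cmod (moment_free t z) * (1 + cmod z) ^ N \<le> C" if z: "0 \<le> Im z" for z
  proof -
    define w where "w = 1 - \<i> * of_real t * z"
    define s where "s = sqrt (cmod w / 2)"
    have Rew: "0 \<le> Re w"
      using t z by (simp add: w_def)
    have s: "0 \<le> s" "s\<^sup>2 = cmod w / 2"
      by (simp_all add: s_def)
    have "s \<le> Re (csqrt w)"
      using Rew by (simp add: s_def)
    then have e: "cmod (moment_free t z) \<le> exp (- s)"
      by (simp add: moment_free_def w_def)
    have "t * cmod z = cmod (1 - w)"
      using t by (simp add: w_def norm_mult)
    also have "\<dots> \<le> 1 + cmod w"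
      using norm_triangle_ineq4[of 1 w] by simp
    finally have tz: "t * cmod z \<le> 1 + cmod w" .
    have "0 \<le> t * cmod w"
      using t by simp
    with tz have "t * (1 + cmod z) \<le> (t + 1) * (1 + cmod w)"
      unfolding distrib_left distrib_right mult_1_left mult_1_right by linarith
    then have "1 + cmod z \<le> (t + 1) * (1 + cmod w) / t"
      using t by (simp add: pos_le_divide_eq mult.commute[of t])
    moreover have Kt: "K = (t + 1) / t"
      using t by (simp add: K_def add_divide_distrib)
    ultimately have zw: "1 + cmod z \<le> K * (1 + cmod w)"
      by simp
    have "1 + cmod w \<le> 2 * (1 + s)\<^sup>2"
      using s by (simp add: power2_sum)
    then have "K * (1 + cmod w) \<le> K * (2 * (1 + s)\<^sup>2)"
      using K by (intro mult_left_mono) auto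
    with zw have zs: "1 + cmod z \<le> 2 * K * (1 + s)\<^sup>2"
      by (simp only: mult_ac)
    have "(1 + cmod z) ^ N \<le> (2 * K * (1 + s)\<^sup>2) ^ N"
      using zs by (intro power_mono) auto
    also have "\<dots> = (2 * K) ^ N * (1 + s) ^ (2 * N)"
      by (simp add: power_mult_distrib power_mult)
    also have "\<dots> \<le> (2 * K) ^ N * (fact (2 * N) * exp (1 + s))"
      using K s by (intro mult_left_mono power_le_fact_mult_exp) auto
    finally have "cmod (moment_free t z) * (1 + cmod z) ^ N
        \<le> exp (- s) * ((2 * K) ^ N * (fact (2 * N) * exp (1 + s)))"
      using e by (intro mult_mono) auto
    also have "\<dots> = C * (exp (- s) * exp s)"
      by (simp add: C_def exp_add)
    also have "exp (- s) * exp s = 1"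
      by (simp add: exp_add[symmetric])
    finally show ?thesis by simp
  qed
  moreover have "0 < C"
    using K by (simp add: C_def)
  ultimately show ?thesis by blast
qed

lemma one_le_power_mult_plane_weight: "1 \<le> (1 + cmod z) ^ 4 * plane_weight z"
proof -
  have sq: "(1 + cmod z)\<^sup>2 = 1 + (Re z)\<^sup>2 + (Im z)\<^sup>2 + 2 * cmod z"
    by (simp add: power2_sum cmod_power2)
  have "1 + (Re z)\<^sup>2 \<le> (1 + cmod z)\<^sup>2"
    unfolding sq by simp
  moreover have "1 + (Im z)\<^sup>2 \<le> (1 + cmod z)\<^sup>2"
    unfolding sq by simp
  ultimately have "(1 + (Re z)\<^sup>2) * (1 + (Im z)\<^sup>2) \<le> (1 + cmod z)\<^sup>2 * (1 + cmod z)\<^sup>2"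
    by (intro mult_mono) auto
  also have "\<dots> = (1 + cmod z) ^ 4"
    by (simp add: power_add[symmetric])
  finally have "(1 + (Re z)\<^sup>2) * (1 + (Im z)\<^sup>2) \<le> (1 + cmod z) ^ 4" .
  moreover have "0 < (1 + (Re z)\<^sup>2) * (1 + (Im z)\<^sup>2)"
    by (intro mult_pos_pos add_pos_nonneg) auto
  ultimately have "1 \<le> (1 + cmod z) ^ 4 / ((1 + (Re z)\<^sup>2) * (1 + (Im z)\<^sup>2))"
    by (simp only: le_divide_eq_1_pos)
  then show ?thesis
    by (simp only: plane_weight_def divide_inverse inverse_mult_distrib)
qed

lemma moment_free_moments:
  assumes t: "0 < t"
  shows "(\<integral>x. moment_free t (of_real x) * poly q (of_real x) \<partial>lborel) = 0"
proof -
  obtain A where A: "0 \<le> A" "\<And>z. cmod (poly q z) \<le> A * (1 + cmod z) ^ degree q"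
    using poly_bound[of q] by blast
  obtain C where C: "0 < C" "\<And>z. 0 \<le> Im z \<Longrightarrow> cmod (moment_free t z) * (1 + cmod z) ^ (degree q + 4) \<le> C"
    using moment_free_decay[OF t, of "degree q + 4"] by blast
  show ?thesis
  proof (rule integral_upper_half_plane_eq_0[of "1 / t" "\<lambda>z. moment_free t z * poly q z"])
    show "0 < 1 / t" using t by simp
    show "(\<lambda>z. moment_free t z * poly q z) holomorphic_on {z. - (1 / t) < Im z}"
      by (intro holomorphic_intros holomorphic_moment_free t)
    fix z assume z: "0 \<le> Im z"
    have "norm (moment_free t z * poly q z) \<le> cmod (moment_free t z) * (A * (1 + cmod z) ^ degree q) * 1"
      using A(2)[of z] by (simp add: norm_mult mult_left_mono)
    also have "\<dots> \<le> cmod (moment_free t z) * (A * (1 + cmod z) ^ degree q) * ((1 + cmod z) ^ 4 * plane_weight z)"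
      using A(1) by (intro mult_left_mono one_le_power_mult_plane_weight) auto
    also have "\<dots> = A * plane_weight z * (cmod (moment_free t z) * (1 + cmod z) ^ (degree q + 4))"
      by (simp add: power_add mult_ac)
    also have "\<dots> \<le> A * plane_weight z * C"
      using A(1) C(2)[OF z] plane_weight_pos[of z] by (intro mult_left_mono) auto
    finally show "norm (moment_free t z * poly q z) \<le> (A * C) * plane_weight z"
      by (simp add: mult_ac)
  qed
qed

lemma continuous_moment_free:
  assumes "0 < t"
  shows "continuous_on UNIV (\<lambda>x::real. moment_free t (of_real x))"
    and "continuous_on UNIV (\<lambda>z. moment_free t (of_real (Re z)))"
proof -
  have c: "continuous_on {w. - (1 / t) < Im w} (moment_free t)"
    using holomorphic_moment_free[OF assms] by (rule holomorphic_on_imp_continuous_on)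
  show "continuous_on UNIV (\<lambda>x::real. moment_free t (of_real x))"
       "continuous_on UNIV (\<lambda>z. moment_free t (of_real (Re z)))"
    by (rule continuous_on_compose2[OF c]; use assms in \<open>auto intro!: continuous_intros\<close>)+
qed

section \<open>The annihilating symbol\<close>

text \<open>The factors are chosen so that \<open>exp (- |z|\<^sup>2) exp (a z\<^sup>2)\<close> times the symbol is
  \<open>moment_free t (Re z) exp (- (Im z)\<^sup>2)\<close>.  The Gaussian in \<open>Im z\<close> could have another rate as far as this product is
  concerned; rate \<open>1\<close> keeps the image of the polynomials in the Fock space for every \<open>a\<close> between \<open>1 / 4\<close> and
  \<open>1 / 2\<close>.\<close>

definition annihilator :: "real \<Rightarrow> real \<Rightarrow> complex \<Rightarrow> complex" where
  "annihilator a t z = moment_free t (of_real (Re z)) * exp ((of_real (Re z))\<^sup>2 - of_real a * z\<^sup>2)"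

lemma continuous_annihilator:
  assumes "0 < t"
  shows "continuous_on UNIV (annihilator a t)"
  unfolding annihilator_def by (intro continuous_intros continuous_moment_free assms)

lemma smooth_annihilator:
  assumes "0 < t"
  shows "smooth (annihilator a t)"
proof -
  have "annihilator a t = (\<lambda>z. (moment_free t (of_real (Re z)) * exp ((of_real (Re z))\<^sup>2)) * 1 * exp (- of_real a * z\<^sup>2))"
    by (simp add: annihilator_def fun_eq_iff exp_diff exp_minus divide_inverse)
  moreover have "k_smooth k (\<lambda>z. (moment_free t (of_real (Re z)) * exp ((of_real (Re z))\<^sup>2)) * 1 * exp (- of_real a * z\<^sup>2))" for k
    using assms
    by (intro k_smooth_product[where U = "{w. - (1 / t) < Im w}" and \<Psi> = "\<lambda>w. moment_free t w * exp (w\<^sup>2)" and \<Phi> = "\<lambda>w. 1"]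
        holomorphic_intros holomorphic_moment_free) (auto simp: open_halfspace_Im_gt)
  ultimately show ?thesis
    unfolding smooth_def by presburger
qed

lemma norm_annihilator:
  "cmod (annihilator a t z) = cmod (moment_free t (of_real (Re z))) * exp ((1 - a) * (Re z)\<^sup>2 + a * (Im z)\<^sup>2)"
  by (simp add: annihilator_def norm_mult power2_eq_square algebra_simps flip: of_real_mult)

lemma norm_annihilator_le:
  assumes "a \<le> 1 / 2"
  shows "cmod (annihilator a t z) \<le> exp ((1 - a) * (cmod z)\<^sup>2)"
proof -
  have "a * (Im z)\<^sup>2 \<le> (1 - a) * (Im z)\<^sup>2"
    using assms by (intro mult_right_mono) auto
  then have "exp ((1 - a) * (Re z)\<^sup>2 + a * (Im z)\<^sup>2) \<le> exp ((1 - a) * (cmod z)\<^sup>2)"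
    by (simp add: cmod_power2 algebra_simps)
  then show ?thesis
    unfolding norm_annihilator
    using mult_mono[OF norm_moment_free_le_1[of t "of_real (Re z)"]] by simp
qed

lemma annihilator_in_growth_class:
  assumes "a \<le> 1 / 2" "1 - a \<le> c" "0 < t"
  shows "annihilator a t \<in> growth_class c"
proof -
  have "cmod (complex_of_real (exp (- c * (cmod z)\<^sup>2)) * annihilator a t z) \<le> 1" for z
  proof -
    have "cmod (annihilator a t z) \<le> exp (c * (cmod z)\<^sup>2)"
      using assms by (intro order_trans[OF norm_annihilator_le]) (auto intro: mult_right_mono)
    then have "exp (- c * (cmod z)\<^sup>2) * cmod (annihilator a t z) \<le> exp (- c * (cmod z)\<^sup>2) * exp (c * (cmod z)\<^sup>2)"
      by (intro mult_left_mono) auto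
    then show ?thesis
      by (simp add: norm_mult exp_add[symmetric])
  qed
  moreover have "annihilator a t \<in> borel_measurable lebesgue"
    by (intro measurable_completion) (simp add: borel_measurable_continuous_onI continuous_annihilator assms)
  ultimately show ?thesis
    by (auto simp: growth_class_def)
qed

text \<open>On the imaginary axis the modulus is the Gaussian \<open>exp (a |z|\<^sup>2 - 1)\<close>; on the real axis it is
  \<open>exp ((1 - a) |z|\<^sup>2)\<close> times a factor that decays no faster than \<open>exp (- sqrt |1 - \<i> t z|)\<close>.  Since \<open>a < 1 - a\<close>, the two
  disagree at distant points.\<close>

lemma not_radial_annihilator:
  assumes "a < 1 / 2" "0 < t"
  shows "\<not> radial (annihilator a t)"
proof
  assume rad: "radial (annihilator a t)"
  \<comment> \<open>Chosen so that \<open>(1 - 2 a) x\<^sup>2 > t x\<close>.\<close>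
  define x where "x = (t + 1) / (1 - 2 * a)"
  have x: "0 < x" "(1 - 2 * a) * x = t + 1"
    using assms by (simp_all add: x_def)
  have "annihilator a t (\<i> * of_real x) = annihilator a t (of_real x)"
    using radial_imp_quarter_turn[OF continuous_annihilator[OF assms(2)] rad] .
  then have "cmod (annihilator a t (\<i> * of_real x)) = cmod (annihilator a t (of_real x))"
    by simp
  then have "exp (- 1 + a * x\<^sup>2) = exp (- Re (csqrt (1 - \<i> * of_real t * of_real x)) + (1 - a) * x\<^sup>2)"
    unfolding norm_annihilator by (simp add: moment_free_def mult_exp_exp)
  then have eq: "1 + (1 - 2 * a) * x\<^sup>2 = Re (csqrt (1 - \<i> * of_real t * of_real x))"
    by (simp add: algebra_simps)
  define w where "w = 1 - \<i> * of_real t * complex_of_real x"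
  have "Re (csqrt w) \<le> sqrt (cmod w)"
    using complex_Re_le_cmod[of "csqrt w"] by simp
  also have "\<dots> \<le> 1 + t * x"
  proof (rule real_le_lsqrt)
    have "cmod w \<le> 1 + t * x"
      using norm_triangle_ineq4[of 1 "\<i> * of_real t * complex_of_real x"] assms x by (simp add: w_def norm_mult)
    also have "\<dots> \<le> (1 + t * x)\<^sup>2"
      using assms x by (simp add: power2_sum)
    finally show "cmod w \<le> (1 + t * x)\<^sup>2" .
  qed (use assms x in auto)
  finally have "(1 - 2 * a) * x\<^sup>2 \<le> t * x"
    using eq by (simp add: w_def)
  moreover have "(1 - 2 * a) * x\<^sup>2 = t * x + x"
    using x(2) by (simp add: power2_eq_square mult.assoc[symmetric] distrib_right)
  ultimately show False
    using x by simp
qed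

text \<open>The key cancellation.  On each horizontal line the integrand is \<open>moment_free t\<close> times a polynomial.  Along the
  real axis the growth of \<open>exp (a z\<^sup>2)\<close> exactly uses up the Gaussian decay of the weighted symbol; the decay of
  \<open>moment_free t\<close> is what keeps the integral absolutely convergent.\<close>

lemma annihilator_integral:
  fixes a t :: real and \<kappa> :: complex and p :: "complex poly" and j :: nat
  assumes t: "0 < t"
  defines "I \<equiv> \<lambda>z. exp (- (cmod z)\<^sup>2) *\<^sub>R (annihilator a t z * (\<kappa> * (exp (of_real a * z\<^sup>2) * poly p z)) * cnj z ^ j)"
  shows "integrable lborel I" and "integral\<^sup>L lborel I = 0"
proof -
  have I: "I z = \<kappa> * exp (- (of_real (Im z))\<^sup>2) * (moment_free t (of_real (Re z)) * (poly p z * cnj z ^ j))" for z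
  proof -
    have "complex_of_real (exp (- (cmod z)\<^sup>2)) * exp ((of_real (Re z))\<^sup>2 - of_real a * z\<^sup>2) * exp (of_real a * z\<^sup>2) 
        = exp (- (of_real (Im z))\<^sup>2)"
      by (simp add: exp_of_real[symmetric] exp_add[symmetric] cmod_power2)
    then have "exp (- (of_real (Im z))\<^sup>2) * (\<kappa> * moment_free t (of_real (Re z)) * poly p z * cnj z ^ j)
      = (complex_of_real (exp (- (cmod z)\<^sup>2)) * exp ((of_real (Re z))\<^sup>2 - of_real a * z\<^sup>2) * exp (of_real a * z\<^sup>2)) *
        (\<kappa> * moment_free t (of_real (Re z)) * poly p z * cnj z ^ j)"
      by simp
    then show ?thesis
      unfolding I_def annihilator_def scaleR_conv_of_real by (simp only: mult_ac)
  qed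
  obtain A where A: "0 \<le> A" "\<And>z. cmod (poly p z) \<le> A * (1 + cmod z) ^ degree p"
    using poly_bound[of p] by blast
  define n where "n = degree p + j"
  obtain C where C: "0 < C" "\<And>z. 0 \<le> Im z \<Longrightarrow> cmod (moment_free t z) * (1 + cmod z) ^ (n + 2) \<le> C"
    using moment_free_decay[OF t, of "n + 2"] by blast
  obtain B where B: "0 < B" "\<And>r::real. 0 \<le> r \<Longrightarrow> (1 + r) ^ n \<le> B * exp (1 / 2 * r\<^sup>2)"
    using power_le_gaussian[of "1 / 2" n] by auto
  have cont: "continuous_on UNIV I"
    unfolding I by (intro continuous_intros continuous_moment_free t)
  show int: "integrable lborel I"
  proof (rule integrable_plane_bound[OF cont])
    fix z
    define x where "x = \<bar>Re z\<bar>"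
    define y where "y = \<bar>Im z\<bar>"
    have xy: "0 \<le> x" "0 \<le> y" by (simp_all add: x_def y_def)
    have "cmod z \<le> x + y"
      using cmod_le[of z] by (simp add: x_def y_def)
    then have z: "1 + cmod z \<le> (1 + x) * (1 + y)"
      using mult_nonneg_nonneg[OF xy] by (simp add: algebra_simps)
    have "cmod (poly p z * cnj z ^ j) \<le> (A * (1 + cmod z) ^ degree p) * (1 + cmod z) ^ j"
      unfolding norm_mult norm_power complex_mod_cnj using A by (intro mult_mono power_mono) auto
    also have "\<dots> = A * (1 + cmod z) ^ n"
      by (simp add: n_def power_add)
    also have "\<dots> \<le> A * ((1 + x) * (1 + y)) ^ n"
      using A z by (intro mult_left_mono power_mono) auto
    finally have pz: "cmod (poly p z * cnj z ^ j) \<le> A * ((1 + x) ^ n * (1 + y) ^ n)"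
      by (simp add: power_mult_distrib)
    have W: "inverse (1 + (Re z)\<^sup>2) * (1 + x)\<^sup>2 \<ge> 1"
    proof -
      have "1 + (Re z)\<^sup>2 \<le> (1 + x)\<^sup>2"
        by (simp add: x_def power2_sum)
      then show ?thesis
        by (simp add: divide_simps add_pos_nonneg)
    qed
    have mx: "cmod (moment_free t (of_real (Re z))) * (1 + x) ^ n \<le> C * inverse (1 + (Re z)\<^sup>2)"
    proof -
      have "cmod (moment_free t (of_real (Re z))) * (1 + x) ^ n * 1
          \<le> cmod (moment_free t (of_real (Re z))) * (1 + x) ^ n * (inverse (1 + (Re z)\<^sup>2) * (1 + x)\<^sup>2)"
        using W xy by (intro mult_left_mono) auto
      also have "\<dots> = (cmod (moment_free t (of_real (Re z))) * (1 + cmod (of_real (Re z) :: complex)) ^ (n + 2)) * inverse (1 + (Re z)\<^sup>2)"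
        by (simp add: x_def power_add power2_eq_square mult_ac)
      also have "\<dots> \<le> C * inverse (1 + (Re z)\<^sup>2)"
        using C(2)[of "of_real (Re z)"] by (intro mult_right_mono) auto
      finally show ?thesis by simp
    qed
    have my: "exp (- (Im z)\<^sup>2) * (1 + y) ^ n \<le> B * (3 * inverse (1 + (Im z)\<^sup>2))"
    proof -
      have "exp (- (Im z)\<^sup>2) * (1 + y) ^ n \<le> exp (- (Im z)\<^sup>2) * (B * exp (1 / 2 * (Im z)\<^sup>2))"
        using B(2)[of y] by (intro mult_left_mono) (auto simp: y_def)
      also have "\<dots> = B * exp (- (Im z)\<^sup>2 + 1 / 2 * (Im z)\<^sup>2)"
        by (simp only: exp_add mult_ac)
      also have "- (Im z)\<^sup>2 + 1 / 2 * (Im z)\<^sup>2 = - (1 / 2) * (Im z)\<^sup>2"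
        by simp
      also have "B * exp (- (1 / 2) * (Im z)\<^sup>2) \<le> B * ((1 + 1 / (1 / 2)) * inverse (1 + (Im z)\<^sup>2))"
        using B(1) by (intro mult_left_mono exp_neg_square_le) auto
      finally show ?thesis by simp
    qed
    have "norm (I z) = cmod \<kappa> * (exp (- (Im z)\<^sup>2) * (cmod (moment_free t (of_real (Re z))) * cmod (poly p z * cnj z ^ j)))"
      unfolding I by (simp add: norm_mult flip: of_real_power)
    also have "\<dots> \<le> cmod \<kappa> * (exp (- (Im z)\<^sup>2) * (cmod (moment_free t (of_real (Re z))) * (A * ((1 + x) ^ n * (1 + y) ^ n))))"
      using pz by (intro mult_left_mono) auto
    also have "\<dots> = cmod \<kappa> * A * ((cmod (moment_free t (of_real (Re z))) * (1 + x) ^ n) * (exp (- (Im z)\<^sup>2) * (1 + y) ^ n))"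
      by (simp add: mult_ac)
    also have "\<dots> \<le> cmod \<kappa> * A * ((C * inverse (1 + (Re z)\<^sup>2)) * (B * (3 * inverse (1 + (Im z)\<^sup>2))))"
      using A B C xy by (intro mult_left_mono mult_mono mx my) auto
    also have "\<dots> = (cmod \<kappa> * A * C * B * 3) * plane_weight z"
      by (simp add: plane_weight_def)
    finally show "norm (I z) \<le> (cmod \<kappa> * A * C * B * 3) * plane_weight z" .
  qed
  have "(\<integral>x. I (Complex x y) \<partial>lborel) = 0" for y
  proof -
    \<comment> \<open>On the line \<open>Im z = y\<close> both \<open>z\<close> and \<open>cnj z\<close> are polynomials in \<open>x\<close> with complex coefficients.\<close>
    define q where "q = pcompose p [:\<i> * of_real y, 1:] * [:- \<i> * of_real y, 1:] ^ j"
    have "(\<integral>x. I (Complex x y) \<partial>lborel)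
        = (\<integral>x. \<kappa> * exp (- (of_real y)\<^sup>2) * (moment_free t (of_real x) * poly q (of_real x)) \<partial>lborel)"
    proof (intro Bochner_Integration.integral_cong refl)
      fix x
      have "poly p (Complex x y) * cnj (Complex x y) ^ j = poly q (of_real x)"
        by (simp add: q_def poly_pcompose poly_power Complex_eq algebra_simps)
      then show "I (Complex x y) = \<kappa> * exp (- (of_real y)\<^sup>2) * (moment_free t (of_real x) * poly q (of_real x))"
        unfolding I by simp
    qed
    also have "\<dots> = 0"
      unfolding integral_mult_right_zero moment_free_moments[OF t] by simp
    finally show ?thesis .
  qed
  then show "integral\<^sup>L lborel I = 0"
    unfolding integral_plane_yx[OF int] by simp
qed

section \<open>Polynomials in the domain of the annihilating symbol\<close>

lemma annihilator_integrand:
  fixes x y :: real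
  shows "exp (- (cmod (Complex x y))\<^sup>2) *\<^sub>R (annihilator a t (Complex x y) * poly p (Complex x y) * cnj (Complex x y) ^ j)
    = moment_free t (of_real x) * exp (- of_real (a * x\<^sup>2)) *
      (exp (- of_real (1 - a) * (of_real y)\<^sup>2 - 2 * \<i> * of_real (a * x) * of_real y) *
       (poly p (of_real x + \<i> * of_real y) * (of_real x - \<i> * of_real y) ^ j))"
proof -
  have z2: "(Complex x y)\<^sup>2 = of_real (x\<^sup>2 - y\<^sup>2) + 2 * \<i> * of_real x * of_real y"
    by (simp add: complex_eq_iff power2_eq_square)
  have "complex_of_real (exp (- (cmod (Complex x y))\<^sup>2)) * exp ((of_real x)\<^sup>2 - of_real a * (Complex x y)\<^sup>2)
      = exp (- of_real (a * x\<^sup>2)) * exp (- of_real (1 - a) * (of_real y)\<^sup>2 - 2 * \<i> * of_real (a * x) * of_real y)"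
    unfolding z2 mult_exp_exp exp_of_real[symmetric]
    by (rule arg_cong[where f = exp]) (simp add: cmod_power2 algebra_simps)
  then have "exp (- of_real (a * x\<^sup>2)) * exp (- of_real (1 - a) * (of_real y)\<^sup>2 - 2 * \<i> * of_real (a * x) * of_real y) *
      (moment_free t (of_real x) * poly p (of_real x + \<i> * of_real y) * (of_real x - \<i> * of_real y) ^ j)
    = complex_of_real (exp (- (cmod (Complex x y))\<^sup>2)) * exp ((of_real x)\<^sup>2 - of_real a * (Complex x y)\<^sup>2) *
      (moment_free t (of_real x) * poly p (of_real x + \<i> * of_real y) * (of_real x - \<i> * of_real y) ^ j)"
    by simp
  note eq = this[symmetric]
  have cnj: "cnj (Complex x y) = of_real x - \<i> * of_real y"
    and poly: "poly p (Complex x y) = poly p (of_real x + \<i> * of_real y)"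
    by (simp_all add: Complex_eq)
  show ?thesis
    using eq unfolding annihilator_def scaleR_conv_of_real cnj poly complex.sel by (simp only: mult_ac)
qed

lemma integrable_annihilator_poly:
  assumes a: "0 < a" "a \<le> 1 / 2" and t: "0 < t"
  shows "integrable lborel (\<lambda>z. exp (- (cmod z)\<^sup>2) *\<^sub>R (annihilator a t z * poly p z * cnj z ^ j))"
proof -
  obtain C where C: "\<And>z. (1 + cmod z) ^ j * cmod (poly p z) * exp (- a * (cmod z)\<^sup>2) \<le> C * plane_weight z"
    using gaussian_decay[OF gauss_bounded_poly[of "a / 2" p], of a j] a by auto
  show ?thesis
  proof (rule integrable_plane_bound)
    show "continuous_on UNIV (\<lambda>z. exp (- (cmod z)\<^sup>2) *\<^sub>R (annihilator a t z * poly p z * cnj z ^ j))"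
      by (intro continuous_intros continuous_annihilator t)
    fix z
    have "norm (exp (- (cmod z)\<^sup>2) *\<^sub>R (annihilator a t z * poly p z * cnj z ^ j))
        = exp (- (cmod z)\<^sup>2) * cmod (annihilator a t z) * (cmod (poly p z) * cmod z ^ j)"
      by (simp add: norm_mult norm_power)
    also have "\<dots> \<le> exp (- (cmod z)\<^sup>2) * exp ((1 - a) * (cmod z)\<^sup>2) * (cmod (poly p z) * (1 + cmod z) ^ j)"
      by (intro mult_mono norm_annihilator_le a power_mono) auto
    also have "exp (- (cmod z)\<^sup>2) * exp ((1 - a) * (cmod z)\<^sup>2) = exp (- a * (cmod z)\<^sup>2)"
      by (simp add: mult_exp_exp algebra_simps)
    also have "exp (- a * (cmod z)\<^sup>2) * (cmod (poly p z) * (1 + cmod z) ^ j) \<le> C * plane_weight z"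
      using C[of z] by (simp add: mult_ac)
    finally show "norm (exp (- (cmod z)\<^sup>2) *\<^sub>R (annihilator a t z * poly p z * cnj z ^ j)) \<le> C * plane_weight z" .
  qed
qed

text \<open>The integral over a vertical line is moved to the saddle point of its Gaussian factor.  This removes the
  oscillation and shrinks \<open>z\<bar> = x - \<i>y\<close> to \<open>(1 - 2a) / (1 - a) x - \<i>u\<close>.\<close>

lemma vertical_line_shift:
  fixes x a :: real
  assumes a: "0 < a" "a < 1"
  shows "(\<integral>y. exp (- of_real (1 - a) * (of_real y)\<^sup>2 - 2 * \<i> * of_real (a * x) * of_real y) *
       (poly p (of_real x + \<i> * of_real y) * (of_real x - \<i> * of_real y) ^ j) \<partial>lborel)
    = exp (- of_real (a\<^sup>2 * x\<^sup>2 / (1 - a))) * (\<integral>u. exp (- of_real ((1 - a) * u\<^sup>2)) *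
       (poly p (of_real (x / (1 - a)) + \<i> * of_real u) * (of_real ((1 - 2 * a) / (1 - a) * x) - \<i> * of_real u) ^ j) \<partial>lborel)"
proof -
  \<comment> \<open>The exponent is stationary at \<open>y = - \<i> \<theta>\<close>.\<close>
  define \<theta> where "\<theta> = a * x / (1 - a)"
  have a1: "0 < 1 - a" using a by simp
  have \<theta>: "(1 - a) * \<theta> = a * x"
    using a1 by (simp add: \<theta>_def)
  have x\<theta>: "0 \<le> x * \<theta>"
  proof -
    have "x * \<theta> = a * x\<^sup>2 / (1 - a)"
      by (simp add: \<theta>_def power2_eq_square)
    then show ?thesis
      using a by simp
  qed
  have xp: "x + \<theta> = x / (1 - a)" and xm: "x - \<theta> = (1 - 2 * a) / (1 - a) * x"
    using a1 by (simp_all add: \<theta>_def field_simps)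
  define Q where "Q = pcompose p [:of_real x, \<i>:] * [:of_real x, - \<i>:] ^ j"
  have Q: "poly Q w = poly p (of_real x + \<i> * w) * (of_real x - \<i> * w) ^ j" for w
    by (simp add: Q_def poly_pcompose poly_power mult.commute)
  define E where "E w = exp (- of_real (1 - a) * w\<^sup>2 - 2 * \<i> * of_real (a * x) * w) * poly Q w" for w
  obtain A where A: "0 \<le> A" "\<And>z. cmod (poly Q z) \<le> A * (1 + cmod z) ^ degree Q"
    using poly_bound[of Q] by blast
  obtain B where B: "0 < B" "\<And>r::real. 0 \<le> r \<Longrightarrow> (1 + r) ^ degree Q \<le> B * exp ((1 - a) / 2 * r\<^sup>2)"
    using power_le_gaussian[of "(1 - a) / 2" "degree Q"] a1 by auto
  define K where "K = exp ((1 - a) * \<theta>\<^sup>2) * (A * ((1 + \<bar>\<theta>\<bar>) ^ degree Q * B))"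
  have K: "0 \<le> K"
    using A B by (simp add: K_def)
  have "(\<integral>u. E (Complex u (- \<theta>)) \<partial>lborel) = (\<integral>u. E (Complex u 0) \<partial>lborel)"
  proof (rule contour_shift)
    show "E holomorphic_on UNIV"
      unfolding E_def by (intro holomorphic_intros)
    fix u s :: real
    assume s: "0 \<le> s" "s \<le> 1"
    define w where "w = Complex u (s * - \<theta>)"
    have sq: "(s * \<theta>)\<^sup>2 \<le> \<theta>\<^sup>2"
    proof -
      have "\<bar>s * \<theta>\<bar> \<le> \<bar>\<theta>\<bar>"
        using s by (simp add: abs_mult mult_left_le_one_le)
      then show ?thesis by (simp add: abs_le_square_iff)
    qed
    have "Re (- of_real (1 - a) * w\<^sup>2 - 2 * \<i> * of_real (a * x) * w)
        = - (1 - a) * u\<^sup>2 + (1 - a) * (s * \<theta>)\<^sup>2 - 2 * a * s * (x * \<theta>)"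
      by (simp add: w_def power2_eq_square algebra_simps)
    also have "\<dots> \<le> - (1 - a) * u\<^sup>2 + (1 - a) * \<theta>\<^sup>2"
    proof -
      have "0 \<le> 2 * a * s * (x * \<theta>)"
        by (rule mult_nonneg_nonneg[OF _ x\<theta>]) (use a s in simp)
      moreover have "(1 - a) * (s * \<theta>)\<^sup>2 \<le> (1 - a) * \<theta>\<^sup>2"
        using sq a1 by (intro mult_left_mono) auto
      ultimately show ?thesis by linarith
    qed
    finally have e: "cmod (exp (- of_real (1 - a) * w\<^sup>2 - 2 * \<i> * of_real (a * x) * w)) \<le> exp (- (1 - a) * u\<^sup>2) * exp ((1 - a) * \<theta>\<^sup>2)"
      by (simp add: mult_exp_exp)
    have "cmod w \<le> \<bar>u\<bar> + \<bar>\<theta>\<bar>"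
      using cmod_le[of w] s mult_left_le_one_le[of "\<bar>\<theta>\<bar>" s] by (simp add: w_def abs_mult)
    moreover have "(1 + \<bar>u\<bar>) * (1 + \<bar>\<theta>\<bar>) = 1 + \<bar>u\<bar> + \<bar>\<theta>\<bar> + \<bar>u\<bar> * \<bar>\<theta>\<bar>" "0 \<le> \<bar>u\<bar> * \<bar>\<theta>\<bar>"
      by (simp_all add: algebra_simps)
    ultimately have "1 + cmod w \<le> (1 + \<bar>u\<bar>) * (1 + \<bar>\<theta>\<bar>)"
      by linarith
    then have "(1 + cmod w) ^ degree Q \<le> ((1 + \<bar>u\<bar>) * (1 + \<bar>\<theta>\<bar>)) ^ degree Q"
      by (intro power_mono) auto
    also have "\<dots> = (1 + \<bar>\<theta>\<bar>) ^ degree Q * (1 + \<bar>u\<bar>) ^ degree Q"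
      by (simp add: power_mult_distrib)
    also have "\<dots> \<le> (1 + \<bar>\<theta>\<bar>) ^ degree Q * (B * exp ((1 - a) / 2 * u\<^sup>2))"
      using B(2)[of "\<bar>u\<bar>"] by (intro mult_left_mono) auto
    finally have "cmod (poly Q w) \<le> A * ((1 + \<bar>\<theta>\<bar>) ^ degree Q * (B * exp ((1 - a) / 2 * u\<^sup>2)))"
      using A order_trans[OF A(2) mult_left_mono] by blast
    then have "cmod (E w) \<le> (exp (- (1 - a) * u\<^sup>2) * exp ((1 - a) * \<theta>\<^sup>2)) * (A * ((1 + \<bar>\<theta>\<bar>) ^ degree Q * (B * exp ((1 - a) / 2 * u\<^sup>2))))"
      unfolding E_def norm_mult using e by (intro mult_mono) auto
    also have "\<dots> = K * exp (- (1 - a) * u\<^sup>2 + (1 - a) / 2 * u\<^sup>2)"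
      unfolding K_def by (simp only: exp_add mult_ac)
    also have "- (1 - a) * u\<^sup>2 + (1 - a) / 2 * u\<^sup>2 = - ((1 - a) / 2) * u\<^sup>2"
      by (simp add: field_simps)
    also have "K * exp (- ((1 - a) / 2) * u\<^sup>2) \<le> K * ((1 + 1 / ((1 - a) / 2)) * inverse (1 + u\<^sup>2))"
      using K a1 by (intro mult_left_mono exp_neg_square_le) auto
    finally show "norm (E (Complex u (s * - \<theta>))) \<le> (K * (1 + 1 / ((1 - a) / 2))) * inverse (1 + u\<^sup>2)"
      by (simp add: w_def mult_ac)
  qed auto
  moreover have "E (Complex u (- \<theta>)) = exp (- of_real (a\<^sup>2 * x\<^sup>2 / (1 - a))) * (exp (- of_real ((1 - a) * u\<^sup>2)) *
       (poly p (of_real (x / (1 - a)) + \<i> * of_real u) * (of_real ((1 - 2 * a) / (1 - a) * x) - \<i> * of_real u) ^ j))" for u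
  proof -
    have "of_real x + \<i> * Complex u (- \<theta>) = of_real (x + \<theta>) + \<i> * of_real u"
      "of_real x - \<i> * Complex u (- \<theta>) = of_real (x - \<theta>) - \<i> * of_real u"
      by (simp_all add: complex_eq_iff)
    then have pq: "poly Q (Complex u (- \<theta>)) = poly p (of_real (x / (1 - a)) + \<i> * of_real u) * (of_real ((1 - 2 * a) / (1 - a) * x) - \<i> * of_real u) ^ j"
      unfolding Q xp xm by simp
    have "Im (- of_real (1 - a) * (Complex u (- \<theta>))\<^sup>2 - 2 * \<i> * of_real (a * x) * Complex u (- \<theta>))
        = 2 * u * ((1 - a) * \<theta>) - 2 * u * (a * x)"
      by (simp add: power2_eq_square algebra_simps)
    moreover have "Re (- of_real (1 - a) * (Complex u (- \<theta>))\<^sup>2 - 2 * \<i> * of_real (a * x) * Complex u (- \<theta>))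
        = - ((1 - a) * u\<^sup>2) + ((1 - a) * \<theta>) * \<theta> - 2 * (a * x) * \<theta>"
      by (simp add: power2_eq_square algebra_simps)
    moreover have "(a * x) * \<theta> = a\<^sup>2 * x\<^sup>2 / (1 - a)"
      by (simp add: \<theta>_def power2_eq_square)
    ultimately have "- of_real (1 - a) * (Complex u (- \<theta>))\<^sup>2 - 2 * \<i> * of_real (a * x) * Complex u (- \<theta>)
       = - of_real (a\<^sup>2 * x\<^sup>2 / (1 - a)) + - of_real ((1 - a) * u\<^sup>2)"
      unfolding \<theta> by (intro complex_eqI) simp_all
    then show ?thesis
      unfolding E_def pq by (simp only: exp_add mult.assoc)
  qed
  moreover have "E (Complex u 0) = exp (- of_real (1 - a) * (of_real u)\<^sup>2 - 2 * \<i> * of_real (a * x) * of_real u) *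
       (poly p (of_real x + \<i> * of_real u) * (of_real x - \<i> * of_real u) ^ j)" for u
    by (simp add: E_def Q complex_of_real_def)
  ultimately show ?thesis
    by (simp only: integral_mult_right_zero)
qed

lemma annihilator_poly_integral:
  assumes a: "0 < a" "a \<le> 1 / 2" and t: "0 < t"
  shows "(\<integral>z. exp (- (cmod z)\<^sup>2) *\<^sub>R (annihilator a t z * poly p z * cnj z ^ j) \<partial>lborel)
    = (\<integral>x. moment_free t (of_real x) * exp (- of_real (a / (1 - a) * x\<^sup>2)) * (\<integral>u. exp (- of_real ((1 - a) * u\<^sup>2)) *
       (poly p (of_real (x / (1 - a)) + \<i> * of_real u) * (of_real ((1 - 2 * a) / (1 - a) * x) - \<i> * of_real u) ^ j) \<partial>lborel) \<partial>lborel)"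
  unfolding integral_plane_xy[OF integrable_annihilator_poly[OF assms]]
proof (intro Bochner_Integration.integral_cong refl)
  fix x
  have a1: "0 < 1 - a" using a by simp
  have "- (a * x\<^sup>2) + - (a\<^sup>2 * x\<^sup>2 / (1 - a)) = - (a / (1 - a) * x\<^sup>2)"
    using a1 by (simp add: field_simps power2_eq_square)
  then have "exp (- complex_of_real (a * x\<^sup>2)) * exp (- of_real (a\<^sup>2 * x\<^sup>2 / (1 - a))) = exp (- of_real (a / (1 - a) * x\<^sup>2))"
    unfolding mult_exp_exp of_real_minus[symmetric] of_real_add[symmetric] by simp
  then show "(\<integral>y. exp (- (cmod (Complex x y))\<^sup>2) *\<^sub>R (annihilator a t (Complex x y) * poly p (Complex x y) * cnj (Complex x y) ^ j) \<partial>lborel)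
    = moment_free t (of_real x) * exp (- of_real (a / (1 - a) * x\<^sup>2)) * (\<integral>u. exp (- of_real ((1 - a) * u\<^sup>2)) *
       (poly p (of_real (x / (1 - a)) + \<i> * of_real u) * (of_real ((1 - 2 * a) / (1 - a) * x) - \<i> * of_real u) ^ j) \<partial>lborel)"
    unfolding annihilator_integrand integral_mult_right_zero
    using a by (subst vertical_line_shift) (simp_all add: mult.assoc[symmetric])
qed

text \<open>After the shift the weight has rates \<open>a / (1 - a)\<close> in \<open>x\<close> and \<open>1 - a\<close> in \<open>u\<close>, while \<open>cnj z\<close> has become
  \<open>\<kappa> x - \<i> u\<close> with \<open>\<kappa> = (1 - 2 a) / (1 - a)\<close>.  Geometric decay of the coefficients needs both rates, measured in the
  variables \<open>\<kappa> x\<close> and \<open>u\<close>, to exceed \<open>1 / 2\<close>.  For \<open>x\<close> this says \<open>(1 - 2 a)\<^sup>2 < 2 a (1 - a)\<close>, which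
  holds from \<open>a = 1 / 4\<close> on but fails for small \<open>a\<close>.\<close>

lemma saddle_point_margin:
  fixes a :: real
  assumes a: "1 / 4 \<le> a" "a < 1 / 2"
  shows "\<exists>\<delta> \<epsilon>. 1 / 2 < \<delta> \<and> 0 < \<epsilon> \<and> \<delta> * ((1 - 2 * a) / (1 - a))\<^sup>2 + 2 * \<epsilon> \<le> a / (1 - a) \<and> \<delta> + 2 * \<epsilon> \<le> 1 - a"
proof -
  define \<kappa> where "\<kappa> = (1 - 2 * a) / (1 - a)"
  have a1: "0 < 1 - a" using a by simp
  have \<kappa>: "0 \<le> \<kappa>" "\<kappa> \<le> 1"
    using a by (simp_all add: \<kappa>_def)
  have "0 \<le> (a - 1 / 4) * (3 / 4 - a)"
    using a by (intro mult_nonneg_nonneg) auto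
  also have "(a - 1 / 4) * (3 / 4 - a) = a - a\<^sup>2 - 3 / 16"
    by (simp add: power2_eq_square field_simps)
  finally have "a\<^sup>2 \<le> a - 3 / 16"
    by simp
  moreover have "(1 - 2 * a)\<^sup>2 = 1 - 4 * a + 4 * a\<^sup>2" "2 * a * (1 - a) = 2 * a - 2 * a\<^sup>2"
    by (simp_all add: power2_eq_square algebra_simps)
  ultimately have "(1 - 2 * a)\<^sup>2 < 2 * a * (1 - a)"
    by linarith
  then have "\<kappa>\<^sup>2 < 2 * a * (1 - a) / (1 - a)\<^sup>2"
    using a1 by (simp add: \<kappa>_def power_divide divide_strict_right_mono)
  also have "\<dots> = 2 * (a / (1 - a))"
    using a1 by (simp add: power2_eq_square)
  finally have "\<kappa>\<^sup>2 / 2 < a / (1 - a)" by linarith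
  define \<eta> where "\<eta> = min (1 / 2 - a) (a / (1 - a) - \<kappa>\<^sup>2 / 2)"
  have \<eta>: "0 < \<eta>" "\<eta> \<le> 1 / 2 - a" "\<eta> \<le> a / (1 - a) - \<kappa>\<^sup>2 / 2"
    using a \<open>\<kappa>\<^sup>2 / 2 < a / (1 - a)\<close> by (auto simp: \<eta>_def)
  have "\<kappa>\<^sup>2 \<le> 1"
    using \<kappa> by (simp add: power_le_one)
  then have "\<eta> / 3 * \<kappa>\<^sup>2 \<le> \<eta> / 3"
    using \<eta>(1) by (intro mult_left_le) auto
  then have "(1 / 2 + \<eta> / 3) * \<kappa>\<^sup>2 + 2 * (\<eta> / 3) \<le> a / (1 - a)"
    using \<eta>(3) by (simp add: algebra_simps)
  moreover have "1 / 2 + \<eta> / 3 + 2 * (\<eta> / 3) \<le> 1 - a"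
    using \<eta>(2) by simp
  ultimately show ?thesis
    using \<eta>(1) unfolding \<kappa>_def by (intro exI[of _ "1 / 2 + \<eta> / 3"] exI[of _ "\<eta> / 3"]) auto
qed

text \<open>For \<open>a < 1 / 2\<close> the absolute value of the original integrand is too large to give square-summable coefficients, so
  the estimate is made on the shifted lines.\<close>

lemma annihilator_coeff_bound:
  assumes a: "1 / 4 \<le> a" "a < 1 / 2" and t: "0 < t"
  shows "\<exists>C q. 0 < q \<and> q < 1 \<and> (\<forall>j. cmod (toeplitz_coeff (annihilator a t) (poly p) j) \<le> C * q ^ j)"
proof -
  define \<kappa> where "\<kappa> = (1 - 2 * a) / (1 - a)"
  have a1: "1 / 2 < 1 - a" using a by simp
  have a': "0 < a" "a \<le> 1 / 2" using a by auto
  obtain \<delta> \<epsilon> where \<delta>: "1 / 2 < \<delta>" "0 < \<epsilon>" "\<delta> * \<kappa>\<^sup>2 + 2 * \<epsilon> \<le> a / (1 - a)" "\<delta> + 2 * \<epsilon> \<le> 1 - a"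
    using saddle_point_margin[OF a] unfolding \<kappa>_def by blast
  define q where "q = 1 / sqrt (2 * \<delta>)"
  have q: "0 < q" "q < 1"
    using \<delta> by (auto simp: q_def)
  obtain A where A: "0 \<le> A" "\<And>z. cmod (poly p z) \<le> A * (1 + cmod z) ^ degree p"
    using poly_bound[of p] by blast
  define n where "n = degree p"
  obtain B where B: "0 < B" "\<And>r::real. 0 \<le> r \<Longrightarrow> (1 + r) ^ n \<le> B * exp (\<epsilon> * r\<^sup>2)"
    using power_le_gaussian[OF \<delta>(2)] by blast
  define W where "W x = inverse (1 + x\<^sup>2)" for x :: real
  define J where "J = integral\<^sup>L lborel W"
  have intW: "integrable lborel W"
    unfolding W_def by (rule integrable_inverse_one_plus_square)
  define D where "D = A * 2 ^ n * B\<^sup>2 * (1 + 1 / \<epsilon>)\<^sup>2"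
  have D: "0 \<le> D"
    using A B by (simp add: D_def)
  have le: "norm (exp (- of_real ((1 - a) * u\<^sup>2)) *
       (poly p (of_real (x / (1 - a)) + \<i> * of_real u) * (of_real (\<kappa> * x) - \<i> * of_real u) ^ j))
      \<le> exp (a / (1 - a) * x\<^sup>2) * (sqrt (fact j) * q ^ j * D * W x * W u)" for x u :: real and j
  proof -
    define v where "v = complex_of_real (\<kappa> * x) - \<i> * of_real u"
    have v2: "(cmod v)\<^sup>2 = \<kappa>\<^sup>2 * x\<^sup>2 + u\<^sup>2"
      by (simp add: v_def cmod_power2 power_mult_distrib)
    have "cmod v ^ j / sqrt (fact j) \<le> q ^ j * exp (\<delta> * (cmod v)\<^sup>2)"
      using fock_basis_growth[of "2 * \<delta>" j v] \<delta>(1) by (simp add: q_def fock_basis_def norm_divide norm_power)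
    then have vj: "cmod v ^ j \<le> sqrt (fact j) * q ^ j * exp (\<delta> * (cmod v)\<^sup>2)"
      by (simp add: field_simps)
    define z where "z = complex_of_real (x / (1 - a)) + \<i> * of_real u"
    have "cmod z \<le> \<bar>x\<bar> / (1 - a) + \<bar>u\<bar>"
      using cmod_le[of z] a1 by (simp add: z_def)
    also have "\<bar>x\<bar> / (1 - a) \<le> \<bar>x\<bar> / (1 / 2)"
      using a1 by (intro divide_left_mono) auto
    finally have "cmod z \<le> \<bar>x\<bar> / (1 / 2) + \<bar>u\<bar>"
      by simp
    moreover have "2 * ((1 + \<bar>x\<bar>) * (1 + \<bar>u\<bar>)) = 2 + \<bar>x\<bar> / (1 / 2) + 2 * \<bar>u\<bar> + 2 * (\<bar>x\<bar> * \<bar>u\<bar>)"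
      by (simp add: algebra_simps)
    moreover have "0 \<le> \<bar>x\<bar> * \<bar>u\<bar>"
      by simp
    ultimately have "1 + cmod z \<le> 2 * ((1 + \<bar>x\<bar>) * (1 + \<bar>u\<bar>))"
      using abs_ge_zero[of u] by linarith
    then have "(1 + cmod z) ^ n \<le> (2 * ((1 + \<bar>x\<bar>) * (1 + \<bar>u\<bar>))) ^ n"
      by (intro power_mono) auto
    also have "\<dots> = 2 ^ n * ((1 + \<bar>x\<bar>) ^ n * (1 + \<bar>u\<bar>) ^ n)"
      by (simp add: power_mult_distrib)
    also have "\<dots> \<le> 2 ^ n * ((B * exp (\<epsilon> * x\<^sup>2)) * (B * exp (\<epsilon> * u\<^sup>2)))"
      using B(1) B(2)[of "\<bar>x\<bar>"] B(2)[of "\<bar>u\<bar>"] by (intro mult_left_mono mult_mono) auto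
    finally have "A * (1 + cmod z) ^ n \<le> A * (2 ^ n * ((B * exp (\<epsilon> * x\<^sup>2)) * (B * exp (\<epsilon> * u\<^sup>2))))"
      using A(1) by (intro mult_left_mono) auto
    with A(2)[of z] have pz: "cmod (poly p z) \<le> A * (2 ^ n * ((B * exp (\<epsilon> * x\<^sup>2)) * (B * exp (\<epsilon> * u\<^sup>2))))"
      by (simp add: n_def)
    have ex: "\<epsilon> * x\<^sup>2 + \<epsilon> * u\<^sup>2 + \<delta> * (cmod v)\<^sup>2 - (1 - a) * u\<^sup>2 \<le> a / (1 - a) * x\<^sup>2 + - \<epsilon> * x\<^sup>2 + - \<epsilon> * u\<^sup>2"
    proof -
      have "(\<delta> * \<kappa>\<^sup>2 + 2 * \<epsilon>) * x\<^sup>2 \<le> a / (1 - a) * x\<^sup>2"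
        by (rule mult_right_mono[OF \<delta>(3)]) simp
      moreover have "(\<delta> + 2 * \<epsilon>) * u\<^sup>2 \<le> (1 - a) * u\<^sup>2"
        by (rule mult_right_mono[OF \<delta>(4)]) simp
      ultimately show ?thesis
        unfolding v2 by (simp only: ring_distribs mult.assoc)
    qed
    have "norm (exp (- of_real ((1 - a) * u\<^sup>2)) * (poly p z * v ^ j)) = exp (- (1 - a) * u\<^sup>2) * (cmod (poly p z) * cmod v ^ j)"
      by (simp only: norm_mult norm_power norm_exp_eq_Re uminus_complex.sel Re_complex_of_real mult_minus_left)
    also have "\<dots> \<le> exp (- (1 - a) * u\<^sup>2) * ((A * (2 ^ n * ((B * exp (\<epsilon> * x\<^sup>2)) * (B * exp (\<epsilon> * u\<^sup>2))))) *
        (sqrt (fact j) * q ^ j * exp (\<delta> * (cmod v)\<^sup>2)))"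
      using A B pz vj by (intro mult_left_mono mult_mono) auto
    also have "\<dots> = sqrt (fact j) * q ^ j * (A * 2 ^ n * B\<^sup>2) * exp (\<epsilon> * x\<^sup>2 + \<epsilon> * u\<^sup>2 + \<delta> * (cmod v)\<^sup>2 - (1 - a) * u\<^sup>2)"
      unfolding diff_conv_add_uminus mult_minus_left[symmetric] power2_eq_square[of B] by (simp only: exp_add mult_ac)
    also have "\<dots> \<le> sqrt (fact j) * q ^ j * (A * 2 ^ n * B\<^sup>2) * exp (a / (1 - a) * x\<^sup>2 + - \<epsilon> * x\<^sup>2 + - \<epsilon> * u\<^sup>2)"
      using A B q ex by (intro mult_left_mono) auto
    also have "\<dots> = sqrt (fact j) * q ^ j * (A * 2 ^ n * B\<^sup>2) * exp (a / (1 - a) * x\<^sup>2) * (exp (- \<epsilon> * x\<^sup>2) * exp (- \<epsilon> * u\<^sup>2))"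
      by (simp only: exp_add mult_ac)
    also have "\<dots> \<le> sqrt (fact j) * q ^ j * (A * 2 ^ n * B\<^sup>2) * exp (a / (1 - a) * x\<^sup>2) * (((1 + 1 / \<epsilon>) * W x) * ((1 + 1 / \<epsilon>) * W u))"
      unfolding W_def using A B q \<delta>(2) by (intro mult_left_mono mult_mono exp_neg_square_le) auto
    also have "\<dots> = exp (a / (1 - a) * x\<^sup>2) * (sqrt (fact j) * q ^ j * D * W x * W u)"
      by (simp add: D_def power2_eq_square[of "1 + 1 / \<epsilon>"] mult_ac)
    finally show ?thesis
      unfolding v_def z_def .
  qed
  have "cmod (toeplitz_coeff (annihilator a t) (poly p) j) \<le> (D * J * J / pi) * q ^ j" for j
  proof -
    define S where "S x = moment_free t (of_real x) * exp (- of_real (a / (1 - a) * x\<^sup>2)) * (\<integral>u. exp (- of_real ((1 - a) * u\<^sup>2)) *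
       (poly p (of_real (x / (1 - a)) + \<i> * of_real u) * (of_real (\<kappa> * x) - \<i> * of_real u) ^ j) \<partial>lborel)" for x :: real
    have S: "norm (S x) \<le> sqrt (fact j) * q ^ j * D * J * W x" for x
    proof -
      have "norm (\<integral>u. exp (- of_real ((1 - a) * u\<^sup>2)) *
         (poly p (of_real (x / (1 - a)) + \<i> * of_real u) * (of_real (\<kappa> * x) - \<i> * of_real u) ^ j) \<partial>lborel)
         \<le> (\<integral>u. exp (a / (1 - a) * x\<^sup>2) * (sqrt (fact j) * q ^ j * D * W x * W u) \<partial>lborel)"
        by (rule norm_integral_le[OF _ le]) (intro integrable_mult_right intW)
      also have "\<dots> = exp (a / (1 - a) * x\<^sup>2) * (sqrt (fact j) * q ^ j * D * W x * J)"
        by (simp add: J_def)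
      finally have "norm (S x) \<le> 1 * exp (- (a / (1 - a) * x\<^sup>2)) * (exp (a / (1 - a) * x\<^sup>2) * (sqrt (fact j) * q ^ j * D * W x * J))"
        unfolding S_def norm_mult norm_exp_eq_Re uminus_complex.sel Re_complex_of_real
        by (intro mult_mono norm_moment_free_le_1 order_refl) auto
      also have "\<dots> = (exp (- (a / (1 - a) * x\<^sup>2)) * exp (a / (1 - a) * x\<^sup>2)) * (sqrt (fact j) * q ^ j * D * W x * J)"
        by (simp only: mult_1_left mult.assoc)
      also have "exp (- (a / (1 - a) * x\<^sup>2)) * exp (a / (1 - a) * x\<^sup>2) = 1"
        by (simp add: mult_exp_exp)
      finally show ?thesis by (simp add: mult_ac)
    qed
    have "cmod (\<integral>z. exp (- (cmod z)\<^sup>2) *\<^sub>R (annihilator a t z * poly p z * cnj z ^ j) \<partial>lborel) = cmod (\<integral>x. S x \<partial>lborel)"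
      unfolding annihilator_poly_integral[OF a' t] S_def \<kappa>_def ..
    also have "\<dots> \<le> (\<integral>x. sqrt (fact j) * q ^ j * D * J * W x \<partial>lborel)"
      by (rule norm_integral_le[OF _ S]) (intro integrable_mult_right intW)
    also have "\<dots> = sqrt (fact j) * q ^ j * D * J * J"
      by (simp add: J_def)
    finally have "cmod (\<integral>z. exp (- (cmod z)\<^sup>2) *\<^sub>R (annihilator a t z * poly p z * cnj z ^ j) \<partial>lborel) / (pi * sqrt (fact j))
        \<le> sqrt (fact j) * q ^ j * D * J * J / (pi * sqrt (fact j))"
      by (intro divide_right_mono) auto
    moreover have "toeplitz_coeff (annihilator a t) (poly p) j
      = (\<integral>z. exp (- (cmod z)\<^sup>2) *\<^sub>R (annihilator a t z * poly p z * cnj z ^ j) \<partial>lborel) / of_real (pi * sqrt (fact j))"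
      by (rule toeplitz_coeff_eq_integral(2)[OF _ _ integrable_annihilator_poly[OF a' t]])
         (intro continuous_annihilator t continuous_intros)+
    moreover have "sqrt (fact j) * q ^ j * D * J * J / (pi * sqrt (fact j)) = (D * J * J / pi) * q ^ j"
      by simp
    ultimately show ?thesis
      by (simp add: norm_divide norm_mult)
  qed
  with q show ?thesis by blast
qed

lemma poly_in_toeplitz_dom_annihilator:
  assumes a: "1 / 4 \<le> a" "a < 1 / 2" and t: "0 < t"
  shows "poly p \<in> toeplitz_dom (annihilator a t)"
proof -
  obtain C q where q: "0 < q" "q < 1" "\<And>j. cmod (toeplitz_coeff (annihilator a t) (poly p) j) \<le> C * q ^ j"
    using annihilator_coeff_bound[OF assms] by blast
  have "integrable gauss_measure (\<lambda>z. annihilator a t z * poly p z * cnj (fock_basis j z))" for j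
    using a by (intro toeplitz_coeff_eq_integral(1) integrable_annihilator_poly continuous_annihilator t continuous_intros) auto
  then show ?thesis
    using toeplitz_geometric(1)[OF q] poly_in_fock_space by (simp add: toeplitz_dom_def)
qed

section \<open>The annihilating symbol has a nonzero Toeplitz operator\<close>

lemma gaussian_integral_neq_0:
  fixes e :: real
  assumes "0 < e"
  shows "integrable lborel (\<lambda>x::real. exp (- complex_of_real (e * x\<^sup>2)))"
    and "(\<integral>x. exp (- complex_of_real (e * x\<^sup>2)) \<partial>lborel) \<noteq> 0"
proof -
  have eq: "exp (- complex_of_real (e * x\<^sup>2)) = of_real (exp (- e * x\<^sup>2))" for x
    by (simp add: exp_of_real[symmetric])
  have int: "integrable lborel (\<lambda>x::real. exp (- e * x\<^sup>2))"
    using exp_neg_square_le[OF assms]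
    by (intro integrable_line_bound[of _ "1 + 1 / e"] continuous_intros) simp
  show "integrable lborel (\<lambda>x::real. exp (- complex_of_real (e * x\<^sup>2)))"
    unfolding eq using int by (rule integrable_of_real)
  show "(\<integral>x. exp (- complex_of_real (e * x\<^sup>2)) \<partial>lborel) \<noteq> 0"
  proof
    assume "(\<integral>x. exp (- complex_of_real (e * x\<^sup>2)) \<partial>lborel) = 0"
    then have "(\<integral>x. exp (- e * x\<^sup>2) \<partial>lborel) = 0"
      unfolding eq integral_complex_of_real by (simp only: of_real_eq_0_iff)
    then have "AE x in lborel. exp (- e * x\<^sup>2) = 0"
      using int by (subst (asm) integral_nonneg_eq_0_iff_AE) auto
    then have "AE x::real in lborel. False"
      by simp
    then show False
      by (simp add: trivial_limit_def[symmetric] ae_filter_eq_bot_iff)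
  qed
qed

text \<open>As \<open>t \<rightarrow> 0\<close> the function \<open>moment_free t\<close> tends to the constant \<open>e\<^bsup>-1\<^esup>\<close>, so its Gaussian integral is eventually
  nonzero.\<close>

lemma moment_free_gaussian_integral_neq_0:
  assumes b: "0 < b"
  shows "\<exists>t>0. (\<integral>x. moment_free t (of_real x) * exp (- complex_of_real (b * x\<^sup>2)) \<partial>lborel) \<noteq> 0"
proof (rule ccontr)
  assume contr: "\<not> ?thesis"
  define t where "t n = inverse (real (Suc n))" for n
  have t: "0 < t n" for n by (simp add: t_def)
  have t0: "t \<longlonglongrightarrow> 0"
    unfolding t_def by (rule LIMSEQ_inverse_real_of_nat)
  have "(\<lambda>n. \<integral>x. moment_free (t n) (of_real x) * exp (- complex_of_real (b * x\<^sup>2)) \<partial>lborel)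
      \<longlonglongrightarrow> (\<integral>x. exp (- 1) * exp (- complex_of_real (b * x\<^sup>2)) \<partial>lborel)"
  proof (rule integral_dominated_convergence)
    show "(\<lambda>x. exp (- 1) * exp (- complex_of_real (b * x\<^sup>2))) \<in> borel_measurable lborel"
      by (intro borel_measurable_integrable integrable_mult_right gaussian_integral_neq_0(1) b)
    show "(\<lambda>x. moment_free (t n) (of_real x) * exp (- complex_of_real (b * x\<^sup>2))) \<in> borel_measurable lborel" for n
    proof -
      have "continuous_on UNIV (\<lambda>x. moment_free (t n) (of_real x) * exp (- complex_of_real (b * x\<^sup>2)))"
        by (intro continuous_intros continuous_moment_free t)
      then show ?thesis
        by (simp add: borel_measurable_continuous_onI)
    qed
    show "integrable lborel (\<lambda>x. norm (exp (- complex_of_real (b * x\<^sup>2))))"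
      by (intro integrable_norm gaussian_integral_neq_0(1) b)
    show "AE x in lborel. norm (moment_free (t n) (of_real x) * exp (- complex_of_real (b * x\<^sup>2))) \<le> norm (exp (- complex_of_real (b * x\<^sup>2)))" for n
      unfolding norm_mult by (intro always_eventually allI mult_left_le_one_le norm_moment_free_le_1) auto
    have "(\<lambda>n. moment_free (t n) (of_real x)) \<longlonglongrightarrow> exp (- csqrt 1)" for x :: real
    proof -
      have "(\<lambda>n. 1 - \<i> * of_real (t n) * of_real x) \<longlonglongrightarrow> 1 - \<i> * of_real 0 * of_real x"
        by (intro tendsto_intros t0)
      then have "(\<lambda>n. 1 - \<i> * of_real (t n) * of_real x) \<longlonglongrightarrow> 1"
        by simp
      then have "(\<lambda>n. csqrt (1 - \<i> * of_real (t n) * of_real x)) \<longlonglongrightarrow> csqrt 1"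
        by (rule isCont_tendsto_compose[rotated]) (simp add: continuous_at_csqrt)
      then show ?thesis
        unfolding moment_free_def by (intro tendsto_intros)
    qed
    then show "AE x in lborel. (\<lambda>n. moment_free (t n) (of_real x) * exp (- complex_of_real (b * x\<^sup>2)))
        \<longlonglongrightarrow> exp (- 1) * exp (- complex_of_real (b * x\<^sup>2))"
      by (intro always_eventually allI tendsto_mult tendsto_const) simp
  qed
  moreover have "(\<integral>x. moment_free (t n) (of_real x) * exp (- complex_of_real (b * x\<^sup>2)) \<partial>lborel) = 0" for n
    using contr t by blast
  ultimately have "(\<integral>x. exp (- 1) * exp (- complex_of_real (b * x\<^sup>2)) \<partial>lborel) = 0"
    by (simp add: LIMSEQ_const_iff)
  then have "(\<integral>x. exp (- complex_of_real (b * x\<^sup>2)) \<partial>lborel) = 0"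
    unfolding integral_mult_right_zero by simp
  then show False
    using gaussian_integral_neq_0(2)[OF b] by contradiction
qed

lemma toeplitz_nonzero_annihilator:
  assumes a: "1 / 4 \<le> a" "a < 1 / 2"
  shows "\<exists>t>0. toeplitz_nonzero (annihilator a t)"
proof -
  have a': "0 < a" "a \<le> 1 / 2" using a by auto
  obtain t where t: "0 < t" and nz: "(\<integral>x. moment_free t (of_real x) * exp (- complex_of_real (a / (1 - a) * x\<^sup>2)) \<partial>lborel) \<noteq> 0"
    using moment_free_gaussian_integral_neq_0[of "a / (1 - a)"] a by auto
  obtain C q where q: "0 < q" "q < 1" "\<And>j. cmod (toeplitz_coeff (annihilator a t) (poly 1) j) \<le> C * q ^ j"
    using annihilator_coeff_bound[OF a t] by blast
  have "(\<integral>z. exp (- (cmod z)\<^sup>2) *\<^sub>R (annihilator a t z * poly 1 z * cnj z ^ 0) \<partial>lborel)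
      = (\<integral>x. moment_free t (of_real x) * exp (- complex_of_real (a / (1 - a) * x\<^sup>2)) \<partial>lborel)
        * (\<integral>u. exp (- complex_of_real ((1 - a) * u\<^sup>2)) \<partial>lborel)"
    by (subst annihilator_poly_integral[OF a' t])
       (simp only: poly_1 power_0 mult_1_right integral_mult_left_zero)
  then have "(\<integral>z. exp (- (cmod z)\<^sup>2) *\<^sub>R (annihilator a t z * poly 1 z * cnj z ^ 0) \<partial>lborel) \<noteq> 0"
    using nz gaussian_integral_neq_0(2)[of "1 - a"] a by simp
  moreover have "toeplitz_coeff (annihilator a t) (poly 1) 0
      = (\<integral>z. exp (- (cmod z)\<^sup>2) *\<^sub>R (annihilator a t z * poly 1 z * cnj z ^ 0) \<partial>lborel) / of_real (pi * sqrt (fact 0))"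
    by (rule toeplitz_coeff_eq_integral(2)[OF _ _ integrable_annihilator_poly[OF a' t]])
       (intro continuous_annihilator t continuous_intros)+
  ultimately have "toeplitz_coeff (annihilator a t) (poly 1) 0 \<noteq> 0"
    by simp
  moreover have "toeplitz (annihilator a t) (poly 1) 0 = toeplitz_coeff (annihilator a t) (poly 1) 0"
  proof -
    have "(\<lambda>j. toeplitz_coeff (annihilator a t) (poly 1) j * fock_basis j 0) sums
        (\<Sum>j\<in>{0}. toeplitz_coeff (annihilator a t) (poly 1) j * fock_basis j 0)"
      by (rule sums_finite) (auto simp: fock_basis_def)
    then have "(\<lambda>j. toeplitz_coeff (annihilator a t) (poly 1) j * fock_basis j 0) sums toeplitz_coeff (annihilator a t) (poly 1) 0"
      by (simp add: fock_basis_def)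
    then show ?thesis
      using toeplitz_geometric(2)[OF q, of 0] by (metis sums_unique2)
  qed
  ultimately have "toeplitz (annihilator a t) (poly 1) \<noteq> (\<lambda>z. 0)"
    by auto
  then show ?thesis
    using poly_in_toeplitz_dom_annihilator[OF a t] t unfolding toeplitz_nonzero_def by blast
qed

section \<open>The zero product\<close>

text \<open>The relation \<open>\<sigma> / (1 + l)\<^sup>2 = a\<close> says that the Toeplitz operator of the Gaussian symbol produces exactly the
  factor \<open>exp (a z\<^sup>2)\<close> that the annihilating symbol needs.\<close>

lemma zero_product_pair_annihilator:
  assumes a: "1 / 4 \<le> a" "a < 1 / 2" "1 - a \<le> c"
    and \<sigma>: "0 < \<sigma>" "0 \<le> l" "\<sigma> < l + 1 / 2" "\<sigma> - l \<le> c" "\<sigma> / (1 + l)\<^sup>2 = a"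
  shows "\<exists>f. zero_product_pair c f (gaussian_symbol \<sigma> l)"
proof -
  have \<sigma>0: "0 \<le> \<sigma>" using \<sigma> by simp
  obtain t where t: "0 < t" and nz: "toeplitz_nonzero (annihilator a t)"
    using toeplitz_nonzero_annihilator[OF a(1,2)] by blast
  let ?f = "annihilator a t" and ?g = "gaussian_symbol \<sigma> l"
  define \<kappa> where "\<kappa> = gauss_moment (1 + l) (\<lambda>z. 1) 0 / of_real pi"
  have kill: "toeplitz ?g (poly p) \<in> toeplitz_dom ?f \<and> toeplitz ?f (toeplitz ?g (poly p)) = (\<lambda>z. 0)" for p
  proof -
    define k where "k = toeplitz ?g (poly p)"
    define r where "r = pcompose p [:0, 1 / of_real (1 + l):]"
    have k: "k z = \<kappa> * (exp (of_real a * z\<^sup>2) * poly r z)" for z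
      unfolding k_def toeplitz_gaussian_symbol[OF \<sigma>0 \<sigma>(2,3)]
      by (simp add: r_def \<kappa>_def poly_pcompose \<sigma>(5)[symmetric] power_divide)
    have ck: "continuous_on UNIV k"
      unfolding k by (intro continuous_intros)
    have int: "integrable lborel (\<lambda>z. exp (- (cmod z)\<^sup>2) *\<^sub>R (?f z * k z * cnj z ^ j))"
      and zero: "(\<integral>z. exp (- (cmod z)\<^sup>2) *\<^sub>R (?f z * k z * cnj z ^ j) \<partial>lborel) = 0" for j
      unfolding k by (rule annihilator_integral[OF t])+
    have coeff: "toeplitz_coeff ?f k j = 0" for j
      using toeplitz_coeff_eq_integral(2)[OF continuous_annihilator[OF t] ck int] zero by simp
    have "integrable gauss_measure (\<lambda>z. ?f z * k z * cnj (fock_basis j z))" for j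
      by (rule toeplitz_coeff_eq_integral(1)[OF continuous_annihilator[OF t] ck int])
    moreover have "k \<in> fock_space"
      unfolding k_def by (rule toeplitz_gaussian_symbol_in_fock_space[OF \<sigma>0 \<sigma>(2,3)])
    ultimately have dom: "k \<in> toeplitz_dom ?f"
      by (simp add: toeplitz_dom_def coeff)
    have "(\<lambda>j. toeplitz_coeff ?f k j * fock_basis j z) sums toeplitz ?f k z" for z
      by (rule toeplitz_geometric(2)[where q = "1 / 2" and C = 0]) (simp_all add: coeff)
    then have "toeplitz ?f k z = 0" for z
      unfolding coeff mult_zero_left using sums_zero sums_unique2 by blast
    with dom show ?thesis
      unfolding k_def by auto
  qed
  have "annihilator a t 0 \<noteq> 0"
    by (simp add: annihilator_def moment_free_def)
  then have "?f \<noteq> (\<lambda>z. 0)" by auto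
  moreover have "?g \<noteq> (\<lambda>z. 0)"
    by (auto simp: gaussian_symbol_def fun_eq_iff)
  moreover have "polynomial_functions \<subseteq> toeplitz_prod_dom ?f ?g"
    using kill poly_in_toeplitz_dom_gaussian_symbol[OF \<sigma>0 \<sigma>(2,3)]
    by (auto simp: polynomial_functions_def toeplitz_prod_dom_def)
  moreover have "?f \<in> growth_class c"
    using a t by (intro annihilator_in_growth_class) auto
  moreover have "?g \<in> growth_class c"
    by (rule gaussian_symbol_in_growth_class[OF \<sigma>0 \<sigma>(4)])
  moreover have "polynomial_functions \<subseteq> toeplitz_dom ?f" "polynomial_functions \<subseteq> toeplitz_dom ?g"
    using poly_in_toeplitz_dom_annihilator[OF a(1,2) t] poly_in_toeplitz_dom_gaussian_symbol[OF \<sigma>0 \<sigma>(2,3)]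
    by (auto simp: polynomial_functions_def)
  moreover have "\<forall>p\<in>polynomial_functions. toeplitz_prod ?f ?g p = (\<lambda>z. 0)"
    using kill by (auto simp: polynomial_functions_def toeplitz_prod_def)
  ultimately have "zero_product_pair c ?f ?g"
    unfolding zero_product_pair_def
    using nz smooth_annihilator[OF t] smooth_gaussian_symbol not_radial_annihilator[OF a(2) t]
      not_radial_gaussian_symbol[OF \<sigma>(1)] toeplitz_nonzero_gaussian_symbol[OF \<sigma>0 \<sigma>(2,3)]
    by blast
  then show ?thesis by blast
qed

theorem theorem1p2:
  fixes c :: real
  assumes "1 / 2 < c" and "c < 1"
  shows "(\<exists>f g. zero_product_pair c f g) \<and>
         (3 / 4 \<le> c \<longrightarrow> (\<exists>f g. zero_product_pair c f g \<and> bounded (range g)))"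
proof -
  \<comment> \<open>The value of \<open>\<sigma> / (1 + \<sigma>)\<^sup>2\<close>, the rate reached by the bounded symbols with \<open>l = \<sigma>\<close>, is largest at \<open>\<sigma> = 1\<close>,
    where it is \<open>1 / 4\<close>; the annihilating symbol then has growth rate \<open>1 - 1 / 4 = 3 / 4\<close>.\<close>
  have large: "\<exists>f g. zero_product_pair c f g \<and> bounded (range g)" if "3 / 4 \<le> c"
  proof -
    have "cmod (gaussian_symbol 1 1 z) \<le> 1" for z
      using norm_gaussian_symbol_le[of 1 1 z] by simp
    then have "bounded (range (gaussian_symbol 1 1))"
      by (auto simp: bounded_iff)
    moreover have "\<exists>f. zero_product_pair c f (gaussian_symbol 1 1)"
      by (rule zero_product_pair_annihilator[of "1 / 4"]) (use that in \<open>auto simp: power2_eq_square\<close>)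
    ultimately show ?thesis by blast
  qed
  \<comment> \<open>Here \<open>a = 1 - c\<close> lies strictly between \<open>1 / 4\<close> and \<open>1 / 2\<close>.\<close>
  have small: "\<exists>f g. zero_product_pair c f g" if "c < 3 / 4"
  proof -
    have "\<exists>f. zero_product_pair c f (gaussian_symbol (1 - c) 0)"
      by (rule zero_product_pair_annihilator[of "1 - c"]) (use that assms in auto)
    then show ?thesis by blast
  qed
  show ?thesis
    using large small by (cases "c < 3 / 4") auto
qed

end
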